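(* Let $\mathbb{k}$ be a field, $S=\mathbb{k}[x_1,\ldots,x_n]$, and let $I\subsetneq S$ be a homogeneous ideal with linear powers, generated in degree $d$. Let $k\ge1$ and $\beta_i^{(k)}=\beta_i(S/I^k)$. If $\dim I=1$, then $$\begin{bmatrix}\beta_2^{(k)}\\ \vdots\\ \beta_n^{(k)}\end{bmatrix}=\left[\binom{j}{i}\right]_{\substack{0\le i\le n-2\\ 0\le j\le n-2}}\left[\beta_1^{(k)}-\binom{dk+i}{i}\right]_{0\le i\le n-2}.$$ If $\dim I=2$, then $$\begin{bmatrix}\beta_2^{(k)}\\ \vdots\\ \beta_{n-1}^{(k)}\end{bmatrix}=\left[\binom{j}{i}\right]_{\substack{0\le i\le n-3\\ 0\le j\le n-3}}\left[\beta_1^{(k)}-(-1)^{n+i}\binom{n-2}{i}\beta_n^{(k)}-\binom{dk+i}{i}\right]_{0\le i\le n-3}.$$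
   Context: $S$ is standard graded. For a homogeneous ideal $J\subset S$, the Betti numbers $\beta_i(S/J)$ are the ranks of the free modules in a minimal graded free resolution $0\to S^{\beta_n}\to\cdots\to S^{\beta_1}\to S\to S/J\to 0$. "Generated in degree $d$" means that all minimal homogeneous generators have degree $d$. A homogeneous ideal $J$ has linear resolution if all maps $\partial_i:S^{\beta_i}\to S^{\beta_{i-1}}$ with $i>1$ in a minimal graded free resolution of $S/J$ are represented by matrices whose non-zero entries have degree one. The ideal $I$ has linear powers if $I^k$ has linear resolution for all integers $k\ge1$. $\dim I$ denotes the Krull dimension of $S/I$. Convention: $\binom{j}{i}=0$ when $i>j$. $[c_{ij}]$ denotes the matrix with entry $c_{ij}$ in row $i$, column $j$, and $[c_i]$ denotes a column vector. Vectors and matrices with empty index range are empty. *)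

theory Defs
  imports
    "HOL-Library.Poly_Mapping"
    "HOL-Library.Extended_Nat"
    "HOL-Library.Cardinality"
    "HOL-Algebra.Ideal_Product"
    "HOL-Algebra.QuotRing"
    "HOL-Algebra.Algebraic_Closure_Type"
    "Jordan_Normal_Form.Matrix"
begin

text \<open>
  The polynomial ring over the field \<open>'k\<close> in the variables indexed by the finite type \<open>'v\<close>, so
  that the number of variables is \<open>n = CARD('v)\<close>. Monomials are finitely supported exponent
  functions.
\<close>

type_synonym ('v, 'k) mpoly = "('v \<Rightarrow>\<^sub>0 nat) \<Rightarrow>\<^sub>0 'k"

text \<open>The same ring as a HOL-Algebra record, so that HOL-Algebra's ideals apply to it.\<close>

abbreviation poly_ring :: "('v::finite, 'k::field) mpoly ring"
  where "poly_ring \<equiv> ring_of_type_algebra"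

definition mon_deg :: "('v::finite \<Rightarrow>\<^sub>0 nat) \<Rightarrow> nat"
  where "mon_deg m = (\<Sum>x\<in>UNIV. Poly_Mapping.lookup m x)"

text \<open>The zero polynomial is homogeneous of every degree.\<close>

definition homogeneous :: "nat \<Rightarrow> ('v::finite, 'k::field) mpoly \<Rightarrow> bool"
  where "homogeneous e f \<longleftrightarrow> (\<forall>m \<in> Poly_Mapping.keys f. mon_deg m = e)"

definition homogeneous_generators :: "('v::finite, 'k::field) mpoly set \<Rightarrow> ('v, 'k) mpoly set \<Rightarrow> bool"
  where "homogeneous_generators G J \<longleftrightarrow>
    (\<forall>g \<in> G. \<exists>e. homogeneous e g) \<and> Idl\<^bsub>poly_ring\<^esub> G = J"

definition homogeneous_ideal :: "('v::finite, 'k::field) mpoly set \<Rightarrow> bool"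
  where "homogeneous_ideal J \<longleftrightarrow> (\<exists>G. homogeneous_generators G J)"

definition minimal_homogeneous_generators ::
    "('v::finite, 'k::field) mpoly set \<Rightarrow> ('v, 'k) mpoly set \<Rightarrow> bool"
  where "minimal_homogeneous_generators G J \<longleftrightarrow>
    homogeneous_generators G J \<and> (\<forall>G'. G' \<subset> G \<longrightarrow> Idl\<^bsub>poly_ring\<^esub> G' \<noteq> J)"

definition generated_in_degree :: "nat \<Rightarrow> ('v::finite, 'k::field) mpoly set \<Rightarrow> bool"
  where "generated_in_degree d J \<longleftrightarrow>
    (\<forall>G. minimal_homogeneous_generators G J \<longrightarrow> (\<forall>g \<in> G. homogeneous d g))"

text \<open>The ideal \<open>J\<^sup>k\<close>; in particular \<open>J\<^sup>0\<close> is the whole ring.\<close>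

definition ideal_pow :: "('v::finite, 'k::field) mpoly set \<Rightarrow> nat \<Rightarrow> ('v, 'k) mpoly set"
  where "ideal_pow J k = J [^]\<^bsub>ideals_set poly_ring\<^esub> k"

text \<open>The supremum of the lengths of strict chains of prime ideals (\<open>0\<close> for the zero ring).\<close>

definition krull_dim :: "('a, 'b) ring_scheme \<Rightarrow> enat"
  where "krull_dim R = Sup {enat l | l.
    \<exists>P :: nat \<Rightarrow> 'a set. (\<forall>i \<le> l. primeideal (P i) R) \<and> (\<forall>i < l. P i \<subset> P (Suc i))}"

definition dim_ideal :: "('v::finite, 'k::field) mpoly set \<Rightarrow> enat"
  where "dim_ideal J = krull_dim (poly_ring Quot J)"

text \<open>
  A graded free resolution \<open>0 \<rightarrow> F\<^sub>n \<rightarrow> \<dots> \<rightarrow> F\<^sub>1 \<rightarrow> F\<^sub>0 = S \<rightarrow> S/J \<rightarrow> 0\<close>, where \<open>F\<^sub>i\<close> is free of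
  rank \<open>b i\<close>, its \<open>q\<close>-th basis element has degree \<open>a i q\<close>, and the map \<open>F\<^sub>i \<rightarrow> F\<^bsub>i-1\<^esub>\<close> is given by
  the matrix \<open>D i\<close> acting on column vectors (row and column indices start at \<open>0\<close>). A map of degree
  \<open>0\<close> has as \<open>(p, q)\<close> entry a homogeneous polynomial of degree \<open>a i q - a (i - 1) p\<close>.
  Since \<open>b (n + 1) = 0\<close>, exactness at \<open>i = n\<close> says that \<open>D n\<close> is injective.
\<close>

definition graded_free_resolution ::
    "('v::finite, 'k::field) mpoly set \<Rightarrow> (nat \<Rightarrow> nat) \<Rightarrow> (nat \<Rightarrow> nat \<Rightarrow> int)
      \<Rightarrow> (nat \<Rightarrow> ('v, 'k) mpoly mat) \<Rightarrow> bool"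
  where "graded_free_resolution J b a D \<longleftrightarrow>
    b 0 = 1 \<and> a 0 0 = 0 \<and>
    (\<forall>i > CARD('v). b i = 0) \<and>
    (\<forall>i \<ge> 1. D i \<in> carrier_mat (b (i - 1)) (b i)) \<and>
    (\<forall>i \<ge> 1. \<forall>p < b (i - 1). \<forall>q < b i. D i $$ (p, q) \<noteq> 0 \<longrightarrow>
       (\<exists>e. a i q = a (i - 1) p + int e \<and> homogeneous e (D i $$ (p, q)))) \<and>
    {(D 1 *\<^sub>v w) $ 0 | w. w \<in> carrier_vec (b 1)} = J \<and>
    (\<forall>i \<ge> 1. {v \<in> carrier_vec (b i). D i *\<^sub>v v = 0\<^sub>v (b (i - 1))}
       = {D (i + 1) *\<^sub>v w | w. w \<in> carrier_vec (b (i + 1))})"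

text \<open>
  Minimality: each map sends \<open>F\<^sub>i\<close> into \<open>\<mm> F\<^bsub>i-1\<^esub>\<close>, where \<open>\<mm>\<close> is the ideal generated by the
  variables, i.e. the polynomials with constant coefficient \<open>0\<close>.
\<close>

definition minimal_graded_free_resolution ::
    "('v::finite, 'k::field) mpoly set \<Rightarrow> (nat \<Rightarrow> nat) \<Rightarrow> (nat \<Rightarrow> nat \<Rightarrow> int)
      \<Rightarrow> (nat \<Rightarrow> ('v, 'k) mpoly mat) \<Rightarrow> bool"
  where "minimal_graded_free_resolution J b a D \<longleftrightarrow>
    graded_free_resolution J b a D \<and>
    (\<forall>i \<ge> 1. \<forall>p < b (i - 1). \<forall>q < b i. Poly_Mapping.lookup (D i $$ (p, q)) 0 = 0)"

text \<open>\<open>betti J i\<close> is \<open>\<beta>\<^sub>i(S/J)\<close>; it is the Betti number of the quotient, not of the ideal.\<close>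

definition betti :: "('v::finite, 'k::field) mpoly set \<Rightarrow> nat \<Rightarrow> nat"
  where "betti J i = (THE r. \<exists>b a D. minimal_graded_free_resolution J b a D \<and> r = b i)"

text \<open>The map \<open>D 1\<close> is not constrained, so the degree of the generators of \<open>J\<close> is free.\<close>

definition has_linear_resolution :: "('v::finite, 'k::field) mpoly set \<Rightarrow> bool"
  where "has_linear_resolution J \<longleftrightarrow>
    (\<exists>b a D. minimal_graded_free_resolution J b a D \<and>
       (\<forall>i > 1. \<forall>p < b (i - 1). \<forall>q < b i. D i $$ (p, q) \<noteq> 0 \<longrightarrow> homogeneous 1 (D i $$ (p, q))))"

definition has_linear_powers :: "('v::finite, 'k::field) mpoly set \<Rightarrow> bool"
  where "has_linear_powers J \<longleftrightarrow> (\<forall>k \<ge> 1. has_linear_resolution (ideal_pow J k))"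

end

theory Submission
  imports
    Defs
    "HOL-Computational_Algebra.Computational_Algebra"
    "HOL-Library.Function_Algebras"
    "Jordan_Normal_Form.Determinant"
begin

text \<open>
  Let \<open>J = I\<^sup>k\<close> and \<open>e = d k\<close>. Minimality forces all columns of the first matrix of a resolution of
  \<open>S/J\<close> into degree \<open>e\<close>, so linearity puts the generators of the \<open>i\<close>-th free module into degree
  \<open>e + i - 1\<close>, and the Hilbert series of \<open>S/J\<close> is \<open>K(t) / (1 - t)\<^sup>n\<close> with
  \<open>K(t) = 1 + (\<Sum>i\<ge>1. (-1)\<^sup>i \<beta>\<^sub>i t\<^bsup>e+i-1\<^esup>) = 1 - \<beta>\<^sub>1 t\<^sup>e + t\<^bsup>e+1\<^esup> R(t)\<close>. The primes above \<open>J\<close> are those above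
  \<open>I\<close>, so if \<open>dim I = r\<close> the series is \<open>O((1 - t)\<^bsup>-r\<^esup>)\<close> as \<open>t \<rightarrow> 1\<close>, and \<open>(1 - t)\<^bsup>n-r\<^esup>\<close> divides
  \<open>K\<close>. With \<open>t = 1 - u\<close> this reads \<open>R(1 - u) = \<beta>\<^sub>1 / (1 - u) - 1 / (1 - u)\<^bsup>e+1\<^esup>\<close> modulo
  \<open>u\<^bsup>n-r\<^esup>\<close>, which determines the first \<open>n - r\<close> coefficients of \<open>R(1 - u)\<close>; the coefficient of
  \<open>u\<^bsup>n-2\<^esup>\<close> is \<open>\<beta>\<^sub>n\<close>. Expanding back in powers of \<open>t\<close> gives the binomial matrix.
\<close>

section \<open>Homogeneous components and homogeneous primes\<close>

text \<open>Krull dimension enters only through the order of the pole at \<open>t = 1\<close>. This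
  order is bounded without Hilbert polynomials: a homogeneous \<open>f\<close> splits the Hilbert
  series of \<open>S/J\<close> into those of the colon ideal \<open>J : f\<close> and of
  \<open>J + (f)\<close>, and the ascending chain condition makes the recursion terminate. Evaluated
  at a real \<open>t\<close> between \<open>0\<close> and \<open>1\<close>, all series are
  nonnegative numbers, so bounds for the two pieces add up, and a polynomial that is
  \<open>O((1 - t)^m)\<close> at \<open>1\<close> is divisible by \<open>(1 - t)^m\<close>. The
  substitution \<open>t = 1 - u\<close> is an involution, so the same signed binomials lead from
  \<open>R\<close> to its coefficients in \<open>u\<close> and back. In dimension 2 exactly one of
  these coefficients is left open by the divisibility. Its contribution is spread over the remaining
  columns by the identity that the sum over \<open>j\<close> of
  \<open>(-1)^j (j choose i) (n-2 choose j)\<close> is zero for \<open>i < n - 2\<close>; this is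
  the origin of the term with the sign \<open>(-1)^(n+i)\<close>. As \<open>betti\<close> is a
  definite description, the ranks of minimal resolutions have to be shown unique before any of this
  applies to it.\<close>

interpretation rmod: Modules.module "(*) :: 'a::comm_ring_1 \<Rightarrow> 'a \<Rightarrow> 'a"
  by unfold_locales (simp_all add: algebra_simps)

text \<open>This instance would reassociate every product to the left.\<close>

declare rmod.scale_scale [simp del]

lemma poly_mapping_sum_single:
  fixes f :: "'a \<Rightarrow>\<^sub>0 'b::comm_monoid_add"
  shows "f = (\<Sum>m\<in>Poly_Mapping.keys f. Poly_Mapping.single m (Poly_Mapping.lookup f m))"
proof (rule poly_mapping_eqI)
  fix k
  have "(\<Sum>m\<in>Poly_Mapping.keys f. Poly_Mapping.lookup (Poly_Mapping.single m (Poly_Mapping.lookup f m)) k)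
      = (\<Sum>m\<in>Poly_Mapping.keys f. if m = k then Poly_Mapping.lookup f k else 0)"
    by (intro sum.cong) (auto simp: lookup_single when_def)
  also have "\<dots> = Poly_Mapping.lookup f k"
    by (auto simp: in_keys_iff)
  finally show "Poly_Mapping.lookup f k = Poly_Mapping.lookup
      (\<Sum>m\<in>Poly_Mapping.keys f. Poly_Mapping.single m (Poly_Mapping.lookup f m)) k"
    by (simp add: lookup_sum)
qed

lemma single_mult_eq_sum:
  fixes f :: "'a::comm_monoid_add \<Rightarrow>\<^sub>0 'b::comm_semiring_0"
  shows "Poly_Mapping.single a c * f
    = (\<Sum>m\<in>Poly_Mapping.keys f. Poly_Mapping.single (a + m) (c * Poly_Mapping.lookup f m))"
  by (subst (1) poly_mapping_sum_single[of f]) (simp add: sum_distrib_left mult_single)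

lemma lookup_single_mult:
  fixes f :: "'a::cancel_comm_monoid_add \<Rightarrow>\<^sub>0 'b::comm_semiring_0"
  shows "Poly_Mapping.lookup (Poly_Mapping.single a c * f) (a + m) = c * Poly_Mapping.lookup f m"
proof -
  have "Poly_Mapping.lookup (Poly_Mapping.single a c * f) (a + m)
      = (\<Sum>k\<in>Poly_Mapping.keys f. if k = m then c * Poly_Mapping.lookup f m else 0)"
    unfolding single_mult_eq_sum lookup_sum
    by (intro sum.cong) (auto simp: lookup_single when_def)
  also have "\<dots> = c * Poly_Mapping.lookup f m"
    by (auto simp: in_keys_iff)
  finally show ?thesis .
qed

lemma lookup_const_mult [simp]:
  fixes f :: "'a::cancel_comm_monoid_add \<Rightarrow>\<^sub>0 'b::comm_semiring_0"
  shows "Poly_Mapping.lookup (Poly_Mapping.single 0 c * f) m = c * Poly_Mapping.lookup f m"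
  using lookup_single_mult[of 0 c f m] by simp

lemma keys_single_mult:
  fixes f :: "'a::cancel_comm_monoid_add \<Rightarrow>\<^sub>0 'b::field"
  assumes "c \<noteq> 0"
  shows "Poly_Mapping.keys (Poly_Mapping.single a c * f) = (+) a ` Poly_Mapping.keys f"
proof
  show "Poly_Mapping.keys (Poly_Mapping.single a c * f) \<subseteq> (+) a ` Poly_Mapping.keys f"
    using keys_mult[of "Poly_Mapping.single a c" f] by (auto simp: assms)
  show "(+) a ` Poly_Mapping.keys f \<subseteq> Poly_Mapping.keys (Poly_Mapping.single a c * f)"
    by (auto simp: in_keys_iff lookup_single_mult assms)
qed

lift_definition restrict_keys :: "('a \<Rightarrow> bool) \<Rightarrow> ('a \<Rightarrow>\<^sub>0 'b::zero) \<Rightarrow> ('a \<Rightarrow>\<^sub>0 'b)"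
  is "\<lambda>P f m. if P m then f m else 0"
  by (erule rev_finite_subset) auto

lemma restrict_keys_add: "restrict_keys P (f + g) = restrict_keys P f + restrict_keys P g"
  by (intro poly_mapping_eqI) (simp add: restrict_keys.rep_eq lookup_add)

lemma restrict_keys_zero [simp]: "restrict_keys P 0 = 0"
  by (intro poly_mapping_eqI) (simp add: restrict_keys.rep_eq)

lemma restrict_keys_sum: "restrict_keys P (sum f A) = (\<Sum>a\<in>A. restrict_keys P (f a))"
  by (induction A rule: infinite_finite_induct) (auto simp: restrict_keys_add)

lemma keys_restrict_keys: "Poly_Mapping.keys (restrict_keys P f) = {m \<in> Poly_Mapping.keys f. P m}"
  by (auto simp: in_keys_iff restrict_keys.rep_eq split: if_splits)

lemma mon_deg_add: "mon_deg (a + b) = mon_deg a + mon_deg b"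
  by (simp add: mon_deg_def lookup_add sum.distrib)

lemma mon_deg_zero [simp]: "mon_deg 0 = 0"
  by (simp add: mon_deg_def)

lemma mon_deg_eq_0_iff: "mon_deg m = 0 \<longleftrightarrow> m = 0"
  by (auto simp: mon_deg_def intro: poly_mapping_eqI)

lemma mon_deg_single [simp]: "mon_deg (Poly_Mapping.single x n) = n"
  by (simp add: mon_deg_def lookup_single when_def)

abbreviation hcomp :: "nat \<Rightarrow> ('v::finite, 'k::field) mpoly \<Rightarrow> ('v, 'k) mpoly"
  where "hcomp e \<equiv> restrict_keys (\<lambda>m. mon_deg m = e)"

lemma homogeneous_0 [simp]: "homogeneous e 0"
  by (simp add: homogeneous_def)

lemma homogeneous_hcomp [simp]: "homogeneous e (hcomp e f)"
  by (auto simp: homogeneous_def keys_restrict_keys)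

lemma hcomp_homogeneous:
  assumes "homogeneous e f"
  shows "hcomp j f = (if j = e then f else 0)"
  using assms by (intro poly_mapping_eqI)
    (auto simp: restrict_keys.rep_eq homogeneous_def in_keys_iff)

lemma homogeneous_mult: "homogeneous a f \<Longrightarrow> homogeneous b g \<Longrightarrow> homogeneous (a + b) (f * g)"
  unfolding homogeneous_def
proof
  fix m assume f: "\<forall>m\<in>Poly_Mapping.keys f. mon_deg m = a"
    and g: "\<forall>m\<in>Poly_Mapping.keys g. mon_deg m = b" and "m \<in> Poly_Mapping.keys (f * g)"
  then obtain x y where "x \<in> Poly_Mapping.keys f" "y \<in> Poly_Mapping.keys g" "m = x + y"
    using keys_mult[of f g] by blast
  with f g show "mon_deg m = a + b" by (simp add: mon_deg_add)
qed

lemma homogeneous_add: "homogeneous a f \<Longrightarrow> homogeneous a g \<Longrightarrow> homogeneous a (f + g)"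
  using Poly_Mapping.keys_add[of f g] unfolding homogeneous_def by blast

lemma homogeneous_const [simp]: "homogeneous 0 (Poly_Mapping.single 0 c)"
  by (auto simp: homogeneous_def)

lemma homogeneous_var [simp]: "homogeneous 1 (Poly_Mapping.single (Poly_Mapping.single x 1) c)"
  by (auto simp: homogeneous_def)

lemma sum_hcomp_superset:
  assumes "finite A" "mon_deg ` Poly_Mapping.keys f \<subseteq> A"
  shows "f = (\<Sum>e\<in>A. hcomp e f)"
proof (rule poly_mapping_eqI)
  fix m
  have "(\<Sum>e\<in>A. Poly_Mapping.lookup (hcomp e f) m)
      = (\<Sum>e\<in>A. if e = mon_deg m then Poly_Mapping.lookup f m else 0)"
    by (intro sum.cong) (auto simp: restrict_keys.rep_eq)
  also have "\<dots> = Poly_Mapping.lookup f m"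
    using assms by (auto simp: in_keys_iff image_subset_iff)
  finally show "Poly_Mapping.lookup f m = Poly_Mapping.lookup (\<Sum>e\<in>A. hcomp e f) m"
    by (simp add: lookup_sum)
qed

lemma sum_hcomp: "f = (\<Sum>e\<in>mon_deg ` Poly_Mapping.keys f. hcomp e f)"
  by (rule sum_hcomp_superset) auto

lemma hcomp_homogeneous_mult:
  assumes "homogeneous e f"
  shows "hcomp m (f * g) = (if e \<le> m then f * hcomp (m - e) g else 0)"
proof -
  have "hcomp m (f * g) = (\<Sum>j\<in>mon_deg ` Poly_Mapping.keys g. hcomp m (f * hcomp j g))"
    by (subst (1) sum_hcomp[of g]) (simp only: sum_distrib_left restrict_keys_sum)
  also have "\<dots> = (\<Sum>j\<in>mon_deg ` Poly_Mapping.keys g. if m = e + j then f * hcomp j g else 0)"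
    by (intro sum.cong refl, subst hcomp_homogeneous[of "e + _"])
      (auto intro: homogeneous_mult assms)
  also have "\<dots> = (\<Sum>j\<in>mon_deg ` Poly_Mapping.keys g.
      if j = m - e then (if e \<le> m then f * hcomp (m - e) g else 0) else 0)"
    by (intro sum.cong) auto
  also have "\<dots> = (if e \<le> m then f * hcomp (m - e) g else 0)"
  proof (cases "m - e \<in> mon_deg ` Poly_Mapping.keys g")
    case False
    then have "hcomp (m - e) g = 0"
      by (intro poly_mapping_eqI) (auto simp: restrict_keys.rep_eq image_iff, metis in_keys_iff)
    then show ?thesis by (simp add: False)
  qed simp
  finally show ?thesis .
qed

lemma hcomp_mult: "hcomp m (f * g) = (\<Sum>i\<le>m. hcomp i f * hcomp (m - i) g)"
proof -
  \<comment> \<open>Large enough for the components of \<open>f\<close> to add up to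
    \<open>f\<close>; the degrees above \<open>m\<close> are dropped afterwards, since their terms
    vanish.\<close>
  let ?A = "{..m} \<union> mon_deg ` Poly_Mapping.keys f"
  have "hcomp m (f * g) = (\<Sum>i\<in>?A. hcomp m (hcomp i f * g))"
    by (subst (1) sum_hcomp_superset[of ?A f]) (auto simp: sum_distrib_right restrict_keys_sum)
  also have "\<dots> = (\<Sum>i\<in>?A. if i \<le> m then hcomp i f * hcomp (m - i) g else 0)"
    by (intro sum.cong refl, subst hcomp_homogeneous_mult[of "_"]) auto
  also have "\<dots> = (\<Sum>i\<in>{..m}. if i \<le> m then hcomp i f * hcomp (m - i) g else 0)"
    by (rule sum.mono_neutral_right) auto
  finally show ?thesis by simp
qed

text \<open>Homogeneity is encoded as closure under components because this form passes directly to
  colon ideals and to adjoining a homogeneous element. For ideals spanned by homogeneous elements,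
  \<open>graded_idealI_homogeneous\<close> supplies it.\<close>

definition graded_ideal :: "('v::finite, 'k::field) mpoly set \<Rightarrow> bool"
  where "graded_ideal J \<longleftrightarrow> rmod.subspace J \<and> (\<forall>f\<in>J. \<forall>e. hcomp e f \<in> J)"

lemma graded_ideal_subspace: "graded_ideal J \<Longrightarrow> rmod.subspace J"
  by (simp add: graded_ideal_def)

lemma graded_ideal_hcomp: "graded_ideal J \<Longrightarrow> f \<in> J \<Longrightarrow> hcomp e f \<in> J"
  by (simp add: graded_ideal_def)

lemma graded_idealI_homogeneous:
  assumes "rmod.subspace J" "\<And>f. f \<in> J \<Longrightarrow> f \<in> rmod.span {g \<in> J. \<exists>e. homogeneous e g}"
  shows "graded_ideal J"
  unfolding graded_ideal_def
proof (intro conjI ballI allI)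
  fix f e assume "f \<in> J"
  from assms(2)[OF this] show "hcomp e f \<in> J"
  proof (induction arbitrary: e rule: rmod.span_induct_alt)
    case base
    then show ?case using rmod.subspace_0[OF assms(1)] by simp
  next
    case (step c x y)
    then obtain j where j: "homogeneous j x" "x \<in> J" by auto
    have "hcomp e (c * x) = (if j \<le> e then x * hcomp (e - j) c else 0)"
      using hcomp_homogeneous_mult[OF j(1), of e c] by (simp add: mult.commute)
    also have "\<dots> \<in> J"
      using rmod.subspace_scale[OF assms(1) j(2), of "hcomp (e - j) c"] rmod.subspace_0[OF assms(1)]
      by (simp add: mult.commute)
    finally show ?case
      using step rmod.subspace_add[OF assms(1)] by (simp add: restrict_keys_add)
  qed
qed fact

text \<open>Prime ideals of a type-class ring. HOL-Algebra's \<open>primeideal\<close> enters only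
  for the quotient ring, whose Krull dimension is taken.\<close>

definition prime_idl :: "'a::comm_ring_1 set \<Rightarrow> bool"
  where "prime_idl P \<longleftrightarrow> rmod.subspace P \<and> P \<noteq> UNIV \<and> (\<forall>f g. f * g \<in> P \<longrightarrow> f \<in> P \<or> g \<in> P)"

text \<open>If \<open>f\<close> and \<open>g\<close> lie outside \<open>J\<close>, take their
  highest components outside \<open>J\<close>, of degrees \<open>a\<close> and \<open>b\<close>.
  Modulo \<open>J\<close>, the component of \<open>f * g\<close> in degree \<open>a + b\<close> is
  the product of these two, so it suffices to test primality on homogeneous elements.\<close>

lemma graded_prime_idlI:
  assumes J: "graded_ideal J" "J \<noteq> UNIV"
    and hom: "\<And>f g a b. homogeneous a f \<Longrightarrow> homogeneous b g \<Longrightarrow> f * g \<in> J \<Longrightarrow> f \<in> J \<or> g \<in> J"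
  shows "prime_idl J"
  unfolding prime_idl_def
proof (intro conjI allI impI)
  note sub = graded_ideal_subspace[OF J(1)]
  have top: "\<exists>e. hcomp e f \<notin> J \<and> (\<forall>j>e. hcomp j f \<in> J)" if "f \<notin> J" for f
  proof -
    let ?B = "{e \<in> mon_deg ` Poly_Mapping.keys f. hcomp e f \<notin> J}"
    have "?B \<noteq> {}"
    proof
      assume "?B = {}"
      then have "(\<Sum>e\<in>mon_deg ` Poly_Mapping.keys f. hcomp e f) \<in> J"
        by (intro rmod.subspace_sum[OF sub]) auto
      with that sum_hcomp[of f] show False by simp
    qed
    moreover have fin: "finite ?B" by simp
    ultimately have "Max ?B \<in> ?B" by (rule Max_in[rotated])
    moreover have "hcomp j f \<in> J" if "j > Max ?B" for j
    proof (rule ccontr)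
      assume n: "hcomp j f \<notin> J"
      then have "hcomp j f \<noteq> 0" using rmod.subspace_0[OF sub] by auto
      then have "Poly_Mapping.keys (hcomp j f) \<noteq> {}"
        by (auto simp: set_eq_iff in_keys_iff intro: poly_mapping_eqI)
      then have "j \<in> mon_deg ` Poly_Mapping.keys f" by (auto simp: keys_restrict_keys)
      with n have "j \<in> ?B" by simp
      with Max_ge[OF fin this] that show False by simp
    qed
    ultimately show ?thesis by blast
  qed
  fix f g assume fg: "f * g \<in> J"
  show "f \<in> J \<or> g \<in> J"
  proof (rule ccontr)
    assume "\<not> (f \<in> J \<or> g \<in> J)"
    then obtain a b where a: "hcomp a f \<notin> J" "\<And>j. j > a \<Longrightarrow> hcomp j f \<in> J"
      and b: "hcomp b g \<notin> J" "\<And>j. j > b \<Longrightarrow> hcomp j g \<in> J"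
      using top[of f] top[of g] by blast
    have "hcomp (a + b) (f * g) = (\<Sum>i\<in>{..a+b}-{a}. hcomp i f * hcomp (a + b - i) g) + hcomp a f * hcomp b g"
      unfolding hcomp_mult by (subst sum.remove[of _ a]) (auto simp: add.commute)
    moreover have "(\<Sum>i\<in>{..a+b}-{a}. hcomp i f * hcomp (a + b - i) g) \<in> J"
    proof (rule rmod.subspace_sum[OF sub])
      \<comment> \<open>For \<open>i < a\<close> the second factor has degree above
        \<open>b\<close>, for \<open>i > a\<close> the first has degree above \<open>a\<close>;
        either way one factor is in \<open>J\<close>.\<close>
      fix i assume i: "i \<in> {..a+b}-{a}"
      show "hcomp i f * hcomp (a + b - i) g \<in> J"
      proof (cases "i < a")
        case True
        then show ?thesis using rmod.subspace_scale[OF sub b(2)] by simp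
      next
        case False
        then show ?thesis using rmod.subspace_scale[OF sub a(2), of i "hcomp (a + b - i) g"] i
          by (simp add: mult.commute)
      qed
    qed
    moreover have "hcomp (a + b) (f * g) \<in> J" using graded_ideal_hcomp[OF J(1) fg] .
    ultimately have "hcomp (a + b) (f * g) - (\<Sum>i\<in>{..a+b}-{a}. hcomp i f * hcomp (a + b - i) g) \<in> J"
        "hcomp (a + b) (f * g) - (\<Sum>i\<in>{..a+b}-{a}. hcomp i f * hcomp (a + b - i) g) = hcomp a f * hcomp b g"
      using rmod.subspace_diff[OF sub] by (blast, simp)
    then have "hcomp a f * hcomp b g \<in> J" by simp
    then show False using hom[of a "hcomp a f" b "hcomp b g"] a b by simp
  qed
qed (use J in \<open>auto simp: graded_ideal_def\<close>)

section \<open>Dimensions of finite-dimensional subspaces\<close>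

text \<open>\<open>dim\<close> is \<open>0\<close> on infinite-dimensional spaces, so monotonicity
  is a matter of finitely spanned ones.\<close>

lemma (in vector_space) dim_mono_finite:
  assumes "A \<subseteq> B" "B \<subseteq> span C" "finite C"
  shows "dim A \<le> dim B"
proof -
  obtain A' where A': "A' \<subseteq> A" "independent A'" "A \<subseteq> span A'" "card A' = dim A"
    using basis_exists by blast
  obtain B' where B': "B' \<subseteq> B" "independent B'" "B \<subseteq> span B'" "card B' = dim B"
    using basis_exists by blast
  have "finite B'"
    using independent_span_bound[OF assms(3) B'(2)] B'(1) assms(2) by blast
  then show ?thesis
    using independent_span_bound[of B' A'] A' B' assms(1) by (metis order.trans)
qed

lemma (in vector_space) dim_zero_subspace: "dim {0} = 0"
  using dim_le_card[of "{0}" "{}"] by simp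

text \<open>Rank-nullity for the induced map from \<open>U\<close> to the quotient by
  \<open>T\<close>, stated without quotient spaces. A basis \<open>B0\<close> of the preimage of
  \<open>T\<close> is extended by \<open>B1\<close> to a basis of \<open>U\<close>; the images of
  \<open>B1\<close> together with a basis of \<open>T\<close> form a basis of
  \<open>f(U) + T\<close>.\<close>

lemma (in vector_space_pair) dim_image_plus:
  assumes f: "Vector_Spaces.linear s1 s2 f"
    and U: "vs1.subspace U" "U \<subseteq> vs1.span A" "finite A"
    and T: "vs2.subspace T" "T \<subseteq> vs2.span C" "finite C"
  shows "vs1.dim U + vs2.dim T
    = vs1.dim {x \<in> U. f x \<in> T} + vs2.dim {f u + t |u t. u \<in> U \<and> t \<in> T}"
proof -
  interpret f: Vector_Spaces.linear s1 s2 f by fact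
  let ?K = "{x \<in> U. f x \<in> T}" and ?W = "{f u + t |u t. u \<in> U \<and> t \<in> T}"
  have subK: "vs1.subspace ?K"
    using U(1) T(1) by (auto simp: vs1.subspace_def vs2.subspace_def f.add f.scale f.zero)
  obtain B0 where B0: "B0 \<subseteq> ?K" "vs1.independent B0" "?K \<subseteq> vs1.span B0"
    using vs1.maximal_independent_subset[of ?K] by blast
  obtain B where B: "B0 \<subseteq> B" "B \<subseteq> U" "vs1.independent B" "U \<subseteq> vs1.span B"
    using vs1.maximal_independent_subset_extend[of B0 U] B0 by blast
  obtain C0 where C0: "C0 \<subseteq> T" "vs2.independent C0" "T \<subseteq> vs2.span C0"
    using vs2.maximal_independent_subset[of T] by blast
  have fin: "finite B" "finite C0"
    using vs1.independent_span_bound[OF U(3) B(3)] vs2.independent_span_bound[OF T(3) C0(2)]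
      B C0 U T by blast+
  then have finB0: "finite B0" using B(1) finite_subset by blast
  define B1 where "B1 = B - B0"
  have finB1: "finite B1" using fin by (simp add: B1_def)
  have Tspan: "T = vs2.span C0"
    using C0 T(1) by (meson subset_antisym vs2.span_minimal)
  \<comment> \<open>A combination of \<open>B1\<close> sent into \<open>T\<close> lies in the span
    of \<open>B0\<close>, so independence of \<open>B\<close> kills its coefficients. Injectivity of
    \<open>f\<close> on \<open>B1\<close>, disjointness from \<open>C0\<close> and independence all
    follow from this.\<close>
  have key: "u b = 0" if "(\<Sum>b\<in>B1. s2 (u b) (f b)) \<in> T" "b \<in> B1" for u b
  proof -
    let ?v = "\<Sum>b\<in>B1. s1 (u b) b"
    have "?v \<in> U"
      by (intro vs1.subspace_sum[OF U(1)] vs1.subspace_scale[OF U(1)]) (use B in \<open>auto simp: B1_def\<close>)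
    moreover have "f ?v \<in> T" using that by (simp add: f.sum f.scale)
    ultimately have "?v \<in> vs1.span B0" using B0 by blast
    then obtain w where w: "?v = (\<Sum>b\<in>B0. s1 (w b) b)"
      using vs1.span_finite[OF finB0] by auto
    define g where "g b = (if b \<in> B0 then - w b else u b)" for b
    have "(\<Sum>b\<in>B. s1 (g b) b) = (\<Sum>b\<in>B1. s1 (g b) b) + (\<Sum>b\<in>B0. s1 (g b) b)"
      unfolding B1_def using sum.subset_diff[OF B(1) fin(1)] .
    also have "(\<Sum>b\<in>B1. s1 (g b) b) = ?v"
      by (intro sum.cong) (auto simp: g_def B1_def)
    also have "(\<Sum>b\<in>B0. s1 (g b) b) = - (\<Sum>b\<in>B0. s1 (w b) b)"
      by (simp add: g_def sum_negf vs1.scale_minus_left)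
    finally have "(\<Sum>b\<in>B. s1 (g b) b) = 0" using w by simp
    then have "g b = 0" using vs1.independentD[OF B(3) fin(1) order_refl] that by (auto simp: B1_def)
    then show ?thesis using that by (auto simp: g_def B1_def)
  qed
  have inj: "inj_on f B1"
  proof (rule inj_onI, rule ccontr)
    fix x y assume xy: "x \<in> B1" "y \<in> B1" "f x = f y" "x \<noteq> y"
    let ?u = "\<lambda>b. if b = x then 1 else if b = y then - 1 else (0::'a)"
    have "(\<Sum>b\<in>B1. s2 (?u b) (f b)) = (\<Sum>b\<in>{x, y}. s2 (?u b) (f b))"
      by (rule sum.mono_neutral_right) (use xy finB1 in auto)
    also have "\<dots> = 0" using xy by (simp add: vs2.scale_minus_left)
    finally have "?u x = 0" using key[of ?u x] xy vs2.subspace_0[OF T(1)] by simp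
    then show False by simp
  qed
  have disj: "f ` B1 \<inter> C0 = {}"
  proof (rule ccontr)
    assume "f ` B1 \<inter> C0 \<noteq> {}"
    then obtain x where x: "x \<in> B1" "f x \<in> T" using C0 by auto
    let ?u = "\<lambda>b. if b = x then 1 else (0::'a)"
    have "(\<Sum>b\<in>B1. s2 (?u b) (f b)) = (\<Sum>b\<in>{x}. s2 (?u b) (f b))"
      by (rule sum.mono_neutral_right) (use x finB1 in auto)
    then have "?u x = 0" using key[of ?u x] x by simp
    then show False by simp
  qed
  let ?D = "f ` B1 \<union> C0"
  have indep: "vs2.independent ?D"
  proof (rule vs2.independent_if_scalars_zero)
    show "finite ?D" using finB1 fin by simp
    fix g x assume "(\<Sum>x\<in>?D. s2 (g x) x) = 0" and x: "x \<in> ?D"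
    then have "(\<Sum>x\<in>f ` B1. s2 (g x) x) + (\<Sum>x\<in>C0. s2 (g x) x) = 0"
      using sum.union_disjoint[of "f ` B1" C0 "\<lambda>x. s2 (g x) x"] disj finB1 fin by simp
    moreover have "(\<Sum>x\<in>f ` B1. s2 (g x) x) = (\<Sum>b\<in>B1. s2 (g (f b)) (f b))"
      by (simp add: sum.reindex[OF inj])
    ultimately have *: "(\<Sum>b\<in>B1. s2 (g (f b)) (f b)) = - (\<Sum>x\<in>C0. s2 (g x) x)"
      and **: "(\<Sum>b\<in>B1. s2 (g (f b)) (f b)) + (\<Sum>x\<in>C0. s2 (g x) x) = 0"
      by (auto simp: eq_neg_iff_add_eq_0)
    have "- (\<Sum>x\<in>C0. s2 (g x) x) \<in> T"
      by (intro vs2.subspace_neg[OF T(1)] vs2.subspace_sum[OF T(1)] vs2.subspace_scale[OF T(1)])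
        (use C0 in auto)
    with * have z: "g (f b) = 0" if "b \<in> B1" for b
      using key[of "\<lambda>b. g (f b)" b] that by simp
    then have "(\<Sum>x\<in>C0. s2 (g x) x) = 0" using ** by simp
    then have "g x = 0" if "x \<in> C0" for x
      using vs2.independentD[OF C0(2) fin(2) order_refl] that by simp
    with z x show "g x = 0" by auto
  qed
  have DW: "?D \<subseteq> ?W"
  proof
    fix x assume "x \<in> ?D"
    then show "x \<in> ?W"
    proof
      assume "x \<in> f ` B1"
      then obtain b where "b \<in> B1" "x = f b" by blast
      then have "x = f b + 0" "b \<in> U" "0 \<in> T"
        using B vs2.subspace_0[OF T(1)] by (auto simp: B1_def)
      then show ?thesis by blast
    next
      assume "x \<in> C0"
      then have "x = f 0 + x" "0 \<in> U" "x \<in> T"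
        using C0 vs1.subspace_0[OF U(1)] by (auto simp: f.zero)
      then show ?thesis by blast
    qed
  qed
  have WD: "?W \<subseteq> vs2.span ?D"
  proof clarify
    fix u t assume u: "u \<in> U" and t: "t \<in> T"
    have "f u \<in> vs2.span (f ` B)"
      using u B(4) f.span_image[of B] by blast
    moreover have "vs2.span (f ` B) \<subseteq> vs2.span ?D"
    proof (rule vs2.span_minimal)
      show "f ` B \<subseteq> vs2.span ?D"
      proof clarify
        fix b assume "b \<in> B"
        show "f b \<in> vs2.span ?D"
        proof (cases "b \<in> B0")
          case True
          then have "f b \<in> vs2.span C0" using B0 C0 by blast
          then show ?thesis using vs2.span_mono[of C0 ?D] by blast
        next
          case False
          then show ?thesis using \<open>b \<in> B\<close> by (intro vs2.span_base) (auto simp: B1_def)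
        qed
      qed
    qed (rule vs2.subspace_span)
    moreover have "t \<in> vs2.span ?D" using t C0 vs2.span_mono[of C0 ?D] by blast
    ultimately show "f u + t \<in> vs2.span ?D" by (blast intro: vs2.span_add)
  qed
  have "vs2.dim ?W = card ?D"
    using vs2.basis_card_eq_dim[OF DW WD indep] by simp
  also have "\<dots> = card B1 + card C0"
    using card_Un_disjoint[of "f ` B1" C0] disj finB1 fin card_image[OF inj] by simp
  finally have "vs2.dim ?W = card B1 + card C0" .
  moreover have "vs2.dim T = card C0" using vs2.basis_card_eq_dim[OF C0(1,3,2)] by simp
  moreover have "vs1.dim U = card B" using vs1.basis_card_eq_dim[OF B(2,4,3)] by simp
  moreover have "vs1.dim ?K = card B0" using vs1.basis_card_eq_dim[OF B0(1,3,2)] by simp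
  moreover have "card B = card B1 + card B0"
    unfolding B1_def using card_Diff_subset[OF finB0 B(1)] card_mono[OF fin(1) B(1)] by simp
  ultimately show ?thesis by simp
qed

lemma (in vector_space_pair) dim_kernel_image:
  assumes "Vector_Spaces.linear s1 s2 f" "vs1.subspace U" "U \<subseteq> vs1.span A" "finite A"
  shows "vs1.dim U = vs1.dim {x \<in> U. f x = 0} + vs2.dim (f ` U)"
proof -
  have "vs2.subspace {0}" "{0} \<subseteq> vs2.span {}" by (auto simp: vs2.subspace_def)
  moreover have "{f u + t |u t. u \<in> U \<and> t \<in> {0}} = f ` U" by auto
  ultimately show ?thesis
    using dim_image_plus[OF assms, of "{0}" "{}"] by (simp add: vs2.dim_zero_subspace)
qed

section \<open>The ascending chain condition\<close>

lemma nat_seq_mono_subseq: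
  fixes s :: "nat \<Rightarrow> nat"
  shows "\<exists>r::nat \<Rightarrow> nat. strict_mono r \<and> mono (\<lambda>n. s (r n))"
proof -
  obtain f where f: "strict_mono f" "monoseq (\<lambda>n. s (f n))"
    using seq_monosub[of s] by blast
  from f(2) consider "mono (\<lambda>n. s (f n))" | "antimono (\<lambda>n. s (f n))"
    by (auto simp: monoseq_iff)
  then show ?thesis
  proof cases
    case 1
    then show ?thesis using f(1) by blast
  next
    case 2
    \<comment> \<open>A nonincreasing sequence of naturals is constant from the position of its
      least value on.\<close>
    obtain N where N: "\<And>n. s (f N) \<le> s (f n)"
      using ex_has_least_nat[of "\<lambda>_. True" 0 "\<lambda>n. s (f n)"] by auto
    have "s (f (N + n)) = s (f N)" for n
      using N[of "N + n"] antimonoD[OF 2, of N "N + n"] by simp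
    moreover have "strict_mono (\<lambda>n. f (N + n))"
      using f(1) by (simp add: strict_mono_def)
    ultimately show ?thesis by (intro exI[of _ "\<lambda>n. f (N + n)"]) (simp add: mono_def)
  qed
qed

text \<open>Dickson's lemma. Passing to subsequences for one variable after another makes all
  exponents nondecreasing at once, since monotonicity survives in subsequences.\<close>

lemma dickson:
  fixes s :: "nat \<Rightarrow> ('v::finite \<Rightarrow>\<^sub>0 nat)"
  shows "\<exists>i j. i < j \<and> (\<forall>x. Poly_Mapping.lookup (s i) x \<le> Poly_Mapping.lookup (s j) x)"
proof -
  have "\<exists>r::nat \<Rightarrow> nat. strict_mono r \<and> (\<forall>x\<in>A. mono (\<lambda>n. Poly_Mapping.lookup (s (r n)) x))"
    if "finite A" for A :: "'v set"
    using that
  proof induction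
    case empty
    show ?case by (rule exI[of _ id]) (auto simp: strict_mono_def)
  next
    case (insert x A)
    then obtain r :: "nat \<Rightarrow> nat" where r: "strict_mono r" "\<forall>x\<in>A. mono (\<lambda>n. Poly_Mapping.lookup (s (r n)) x)"
      by blast
    obtain q :: "nat \<Rightarrow> nat" where q: "strict_mono q" "mono (\<lambda>n. Poly_Mapping.lookup (s (r (q n))) x)"
      using nat_seq_mono_subseq[of "\<lambda>n. Poly_Mapping.lookup (s (r n)) x"] by blast
    have "mono (\<lambda>n. Poly_Mapping.lookup (s (r (q n))) y)" if "y \<in> A" for y
      using r(2) that q(1) by (meson monoD monoI strict_mono_less_eq)
    then show ?case
      using q r(1) by (intro exI[of _ "\<lambda>n. r (q n)"]) (auto simp: strict_mono_def)
  qed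
  from this[of UNIV] obtain r :: "nat \<Rightarrow> nat" where r: "strict_mono r"
    "\<And>x. mono (\<lambda>n. Poly_Mapping.lookup (s (r n)) x)"
    by auto
  have "r 0 < r 1" using r(1) by (simp add: strict_mono_def)
  moreover have "Poly_Mapping.lookup (s (r 0)) x \<le> Poly_Mapping.lookup (s (r 1)) x" for x
    using monoD[OF r(2), of 0 1 x] by simp
  ultimately show ?thesis by blast
qed

text \<open>Sending the variables to distinct primes turns the order of the natural numbers into a
  monomial order.\<close>

lemma ex_monomial_weight:
  "\<exists>W :: ('v::finite \<Rightarrow>\<^sub>0 nat) \<Rightarrow> nat.
    inj W \<and> (\<forall>a b. W (a + b) = W a * W b) \<and> (\<forall>a. W a > 0)"
proof -
  obtain Q :: "nat set" where Q: "Q \<subseteq> {p. prime p}" "finite Q" "card Q = CARD('v)"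
    using infinite_arbitrarily_large[OF primes_infinite] by blast
  obtain p :: "'v \<Rightarrow> nat" where p: "bij_betw p UNIV Q"
    using finite_same_card_bij[of "UNIV :: 'v set" Q] Q by auto
  have pr: "prime (p x)" for x using p Q by (auto simp: bij_betw_def)
  define W where "W a = (\<Prod>x\<in>UNIV. p x ^ Poly_Mapping.lookup a x)" for a
  have inv_p: "inv_into UNIV p (p x) = x" for x
    using p by (simp add: bij_betw_def)
  \<comment> \<open>Unique factorization recovers every exponent, so distinct monomials never have
    equal weight.\<close>
  have "multiplicity (p x) (W a) = Poly_Mapping.lookup a x" for a x
  proof -
    have "W a = (\<Prod>q\<in>range p. q ^ Poly_Mapping.lookup a (inv_into UNIV p q))"
      unfolding W_def using p by (subst prod.reindex) (auto simp: bij_betw_def)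
    then show ?thesis
      using multiplicity_prod_prime_powers[of "range p" "p x" "\<lambda>q. Poly_Mapping.lookup a (inv_into UNIV p q)"] pr
      by (auto simp: inv_p)
  qed
  then have "inj W" by (metis injI poly_mapping_eqI)
  moreover have "W (a + b) = W a * W b" for a b
    by (simp add: W_def lookup_add power_add prod.distrib)
  moreover have "W a > 0" for a
    unfolding W_def by (intro prod_pos) (simp add: pr prime_gt_0_nat)
  ultimately show ?thesis by blast
qed

text \<open>Hilbert's basis theorem as well-foundedness, with larger ideals counting as smaller.
  Nested ideals with the same leading monomials coincide by division, so each step of a strict chain
  brings a new leading monomial; Dickson's lemma makes one of these a multiple of an earlier
  one.\<close>

lemma wf_subspace_mpoly:
  "wf {(J', J). rmod.subspace J \<and> rmod.subspace J' \<and> J \<subset> (J' :: ('v::finite, 'k::field) mpoly set)}"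
proof -
  obtain W :: "('v \<Rightarrow>\<^sub>0 nat) \<Rightarrow> nat"
    where W: "inj W" "\<And>a b. W (a + b) = W a * W b" "\<And>a. W a > 0"
    using ex_monomial_weight by blast
  define lead where "lead J = {m. \<exists>f\<in>J. m \<in> Poly_Mapping.keys f \<and> (\<forall>l\<in>Poly_Mapping.keys f. W l \<le> W m)}"
    for J :: "('v, 'k) mpoly set"
  have lead_add: "a + m \<in> lead J" if J: "rmod.subspace J" and m: "m \<in> lead J" for a m J
  proof -
    from m obtain f where f: "f \<in> J" "m \<in> Poly_Mapping.keys f" "\<forall>l\<in>Poly_Mapping.keys f. W l \<le> W m"
      by (auto simp: lead_def)
    have "Poly_Mapping.single a 1 * f \<in> J" using rmod.subspace_scale[OF J f(1)] .
    then show ?thesis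
      unfolding lead_def using f
      by (intro CollectI bexI[of _ "Poly_Mapping.single a 1 * f"]) (auto simp: keys_single_mult W(2))
  qed
  have lead_eq: "J' \<subseteq> J" if J: "rmod.subspace J" "rmod.subspace J'" "J \<subseteq> J'" "lead J' \<subseteq> lead J" for J J'
  proof
    fix f assume "f \<in> J'"
    then show "f \<in> J"
    \<comment> \<open>Induction on the largest weight. The value \<open>0\<close> for the zero
      polynomial lies below all others, because weights are positive.\<close>
    proof (induction "if f = 0 then 0 else Max (W ` Poly_Mapping.keys f)" arbitrary: f rule: less_induct)
      case less
      show ?case
      proof (cases "f = 0")
        case True
        then show ?thesis using rmod.subspace_0[OF J(1)] by simp
      next
        case False
        then have ne: "Poly_Mapping.keys f \<noteq> {}"
          by (auto simp: set_eq_iff in_keys_iff intro: poly_mapping_eqI)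
        then have "Max (W ` Poly_Mapping.keys f) \<in> W ` Poly_Mapping.keys f" by (intro Max_in) auto
        then obtain m where m: "m \<in> Poly_Mapping.keys f" "W m = Max (W ` Poly_Mapping.keys f)" by auto
        have le: "W l \<le> W m" if "l \<in> Poly_Mapping.keys f" for l
          using m(2) that by simp
        then have "m \<in> lead J'" unfolding lead_def using m(1) less.prems by blast
        then have "m \<in> lead J" using J(4) by blast
        then obtain g where g: "g \<in> J" "m \<in> Poly_Mapping.keys g" "\<forall>l\<in>Poly_Mapping.keys g. W l \<le> W m"
          by (auto simp: lead_def)
        \<comment> \<open>\<open>f\<close> and \<open>g\<close> have the same leading monomial, so a
          scalar multiple of \<open>g\<close> cancels the leading term of \<open>f\<close>.\<close>
        define c where "c = Poly_Mapping.lookup f m / Poly_Mapping.lookup g m"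
        define h where "h = f - Poly_Mapping.single 0 c * g"
        have cg: "Poly_Mapping.single 0 c * g \<in> J" using rmod.subspace_scale[OF J(1) g(1)] .
        have "h \<in> J'" unfolding h_def using less.prems cg J by (intro rmod.subspace_diff) auto
        have lt: "W l < W m" if l: "l \<in> Poly_Mapping.keys h" for l
        proof -
          have "Poly_Mapping.lookup h m = 0"
            using g(2) by (simp add: h_def lookup_minus c_def in_keys_iff)
          then have "l \<noteq> m" using l by (auto simp: in_keys_iff)
          moreover have "l \<in> Poly_Mapping.keys f \<or> l \<in> Poly_Mapping.keys g"
            using l by (auto simp: h_def lookup_minus in_keys_iff)
          ultimately show ?thesis
            using le g(3) W(1) by (metis injD le_neq_implies_less)
        qed
        have "(if h = 0 then 0 else Max (W ` Poly_Mapping.keys h)) < Max (W ` Poly_Mapping.keys f)"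
        proof (cases "h = 0")
          case True
          then show ?thesis using W(3)[of m] m(2) by simp
        next
          case False
          then have "Poly_Mapping.keys h \<noteq> {}"
            by (auto simp: set_eq_iff in_keys_iff intro: poly_mapping_eqI)
          then show ?thesis using False lt m(2) by simp
        qed
        then have "h \<in> J" using less.hyps[of h] \<open>h \<in> J'\<close> \<open>f \<noteq> 0\<close> by simp
        then have "h + Poly_Mapping.single 0 c * g \<in> J" using cg by (rule rmod.subspace_add[OF J(1)])
        then show ?thesis by (simp add: h_def)
      qed
    qed
  qed
  show ?thesis
    unfolding wf_iff_no_infinite_down_chain
  proof
    assume "\<exists>F. \<forall>i. (F (Suc i), F i) \<in> {(J', J). rmod.subspace J \<and> rmod.subspace J' \<and> J \<subset> (J' :: ('v, 'k) mpoly set)}"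
    then obtain F :: "nat \<Rightarrow> ('v, 'k) mpoly set"
      where F0: "\<forall>i. rmod.subspace (F i) \<and> rmod.subspace (F (Suc i)) \<and> F i \<subset> F (Suc i)"
      by auto
    then have F: "\<And>i. rmod.subspace (F i)" "\<And>i. F i \<subset> F (Suc i)" by auto
    have "\<exists>m. m \<in> lead (F (Suc i)) \<and> m \<notin> lead (F i)" for i
      using lead_eq[OF F(1)[of i] F(1)[of "Suc i"]] F(2)[of i] by blast
    then obtain s where s: "\<And>i. s i \<in> lead (F (Suc i))" "\<And>i. s i \<notin> lead (F i)" by metis
    obtain i j where ij: "i < j" "\<And>x. Poly_Mapping.lookup (s i) x \<le> Poly_Mapping.lookup (s j) x"
      using dickson[of s] by blast
    \<comment> \<open>As a multiple of \<open>s i\<close>, the monomial \<open>s j\<close> is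
      leading already in \<open>F (Suc i)\<close>, hence in \<open>F j\<close>, against its choice
      as new at stage \<open>j\<close>.\<close>
    have "s j = (s j - s i) + s i"
      by (intro poly_mapping_eqI) (simp add: lookup_add lookup_minus ij(2))
    then have "s j \<in> lead (F (Suc i))" using lead_add[OF F(1) s(1)] by metis
    moreover have "F (Suc i) \<subseteq> F j"
      using lift_Suc_mono_le[of F "Suc i" j] F(2) ij(1) by (simp add: psubset_imp_subset Suc_leI)
    then have "lead (F (Suc i)) \<subseteq> lead (F j)" by (auto simp: lead_def)
    ultimately show False using s(2) by blast
  qed
qed

section \<open>Hilbert functions\<close>

definition pscale :: "'k \<Rightarrow> ('v::finite, 'k::field) mpoly \<Rightarrow> ('v, 'k) mpoly"
  where "pscale c f = Poly_Mapping.single 0 c * f"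

interpretation pv: vector_space "pscale :: 'k \<Rightarrow> ('v::finite, 'k::field) mpoly \<Rightarrow> ('v, 'k) mpoly"
  by unfold_locales
    (simp_all add: pscale_def distrib_left distrib_right single_add mult_single mult.assoc[symmetric])

interpretation pvp: vector_space_pair
  "pscale :: 'k \<Rightarrow> ('v::finite, 'k::field) mpoly \<Rightarrow> ('v, 'k) mpoly"
  "pscale :: 'k \<Rightarrow> ('v::finite, 'k::field) mpoly \<Rightarrow> ('v, 'k) mpoly" ..

text \<open>Integer degrees allow the shifts \<open>z - e\<close> and \<open>z - c i\<close> without
  case distinctions; in negative degrees the space is \<open>{0}\<close>.\<close>

definition homz :: "int \<Rightarrow> ('v::finite, 'k::field) mpoly set"
  where "homz z = {f. \<forall>m\<in>Poly_Mapping.keys f. int (mon_deg m) = z}"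

lemma homz_of_nat [simp]: "f \<in> homz (int e) \<longleftrightarrow> homogeneous e f"
  by (simp add: homz_def homogeneous_def)

lemma homz_neg: "z < 0 \<Longrightarrow> homz z = {0}"
  by (auto simp: homz_def in_keys_iff intro: poly_mapping_eqI)

lemma pv_subspace_ideal: "rmod.subspace J \<Longrightarrow> pv.subspace J"
  by (simp add: pv.subspace_def rmod.subspace_def pscale_def)

lemma pv_subspace_homz: "pv.subspace (homz z)"
proof (cases "z < 0")
  case True
  then show ?thesis by (simp add: homz_neg)
next
  case False
  then obtain e where z: "z = int e" by (metis nonneg_int_cases not_less)
  show ?thesis unfolding z
    by (auto simp: pv.subspace_def pscale_def intro!: homogeneous_add homogeneous_mult[of 0 _ e, simplified])
qed

lemma finite_mon_deg: "finite {m :: 'v::finite \<Rightarrow>\<^sub>0 nat. mon_deg m = e}"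
proof (rule finite_imageD)
  have "Poly_Mapping.lookup m x \<le> mon_deg m" for m :: "'v \<Rightarrow>\<^sub>0 nat" and x
    unfolding mon_deg_def by (rule member_le_sum) auto
  then have "Poly_Mapping.lookup ` {m :: 'v \<Rightarrow>\<^sub>0 nat. mon_deg m = e} \<subseteq> PiE UNIV (\<lambda>_. {..e})"
    by (auto simp: PiE_def)
  then show "finite (Poly_Mapping.lookup ` {m :: 'v \<Rightarrow>\<^sub>0 nat. mon_deg m = e})"
    by (rule finite_subset) (intro finite_PiE, auto)
  show "inj_on Poly_Mapping.lookup {m :: 'v \<Rightarrow>\<^sub>0 nat. mon_deg m = e}"
    by (intro inj_onI poly_mapping_eqI) simp
qed

lemma homz_finite_span: "\<exists>C. finite C \<and> (homz z :: ('v::finite, 'k::field) mpoly set) \<subseteq> pv.span C"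
proof -
  let ?M = "{m :: 'v \<Rightarrow>\<^sub>0 nat. mon_deg m = nat z}"
  let ?C = "(\<lambda>m. Poly_Mapping.single m (1::'k)) ` ?M"
  have "f \<in> pv.span ?C" if f: "f \<in> homz z" for f :: "('v, 'k) mpoly"
  proof -
    have "f = (\<Sum>m\<in>Poly_Mapping.keys f. pscale (Poly_Mapping.lookup f m) (Poly_Mapping.single m 1))"
      by (subst poly_mapping_sum_single[of f]) (simp add: pscale_def mult_single)
    also have "\<dots> \<in> pv.span ?C"
      using f by (intro pv.span_sum pv.span_scale pv.span_base imageI) (auto simp: homz_def)
    finally show ?thesis .
  qed
  then show ?thesis using finite_mon_deg[of "nat z"] by blast
qed

text \<open>The Hilbert function of \<open>S/J\<close>. A difference of dimensions avoids quotient
  spaces, and integer values suit the alternating sums along a resolution.\<close>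

definition hilb :: "('v::finite, 'k::field) mpoly set \<Rightarrow> int \<Rightarrow> int"
  where "hilb J z = int (pv.dim (homz z :: ('v, 'k) mpoly set)) - int (pv.dim (J \<inter> homz z))"

lemma hilb_antimono: "J \<subseteq> J' \<Longrightarrow> hilb J' z \<le> hilb J z"
proof -
  assume "J \<subseteq> J'"
  moreover obtain C where "homz z \<subseteq> pv.span C" "finite (C :: ('a, 'b) mpoly set)"
    using homz_finite_span[of z] by blast
  ultimately show ?thesis
    unfolding hilb_def using pv.dim_mono_finite[of "J \<inter> homz z" "J' \<inter> homz z" C] by fastforce
qed

lemma hilb_UNIV: "hilb UNIV z = 0"
  by (simp add: hilb_def)

lemma hilb_nonneg: "hilb J z \<ge> 0"
  using hilb_antimono[of J UNIV z] by (simp add: hilb_UNIV)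

lemma hilb_neg: "z < 0 \<Longrightarrow> rmod.subspace J \<Longrightarrow> hilb J z = 0"
  using rmod.subspace_0[of J] by (simp add: hilb_def homz_neg insert_absorb)

section \<open>Colon ideals and adjoining an element\<close>

definition colon :: "'a::comm_ring_1 \<Rightarrow> 'a set \<Rightarrow> 'a set"
  where "colon f J = {g. f * g \<in> J}"

definition adjoin :: "'a::comm_ring_1 \<Rightarrow> 'a set \<Rightarrow> 'a set"
  where "adjoin f J = {j + f * g |j g. j \<in> J}"

lemma subspace_colon: "rmod.subspace J \<Longrightarrow> rmod.subspace (colon f J)"
proof -
  assume J: "rmod.subspace J"
  have "f * (c * x) \<in> J" if "f * x \<in> J" for c x
    using rmod.subspace_scale[OF J that, of c] by (simp only: mult.left_commute)
  then show ?thesis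
    using rmod.subspace_0[OF J] rmod.subspace_add[OF J] by (simp add: rmod.subspace_def colon_def distrib_left)
qed

lemma subspace_adjoin:
  assumes J: "rmod.subspace J"
  shows "rmod.subspace (adjoin f J)"
proof -
  have "x + y \<in> adjoin f J" if xy: "x \<in> adjoin f J" "y \<in> adjoin f J" for x y
  proof -
    from xy obtain j g j' g' where *: "x = j + f * g" "y = j' + f * g'" "j \<in> J" "j' \<in> J"
      unfolding adjoin_def by blast
    have "x + y = (j + j') + f * (g + g')"
      unfolding * by (simp add: distrib_left add_ac)
    moreover have "j + j' \<in> J" using rmod.subspace_add[OF J] * by blast
    ultimately have "\<exists>j g. x + y = j + f * g \<and> j \<in> J" by blast
    then show ?thesis by (auto simp: adjoin_def)
  qed
  moreover have "c * x \<in> adjoin f J" if x: "x \<in> adjoin f J" for x c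
  proof -
    from x obtain j g where *: "x = j + f * g" "j \<in> J"
      unfolding adjoin_def by blast
    have "c * x = c * j + f * (c * g)"
      unfolding * by (simp add: distrib_left mult.left_commute)
    moreover have "c * j \<in> J" using rmod.subspace_scale[OF J] * by blast
    ultimately have "\<exists>j g. c * x = j + f * g \<and> j \<in> J" by blast
    then show ?thesis unfolding adjoin_def by blast
  qed
  moreover have "0 \<in> adjoin f J"
    using rmod.subspace_0[OF J] unfolding adjoin_def by (intro CollectI exI[of _ 0]) simp
  ultimately show ?thesis by (simp add: rmod.subspace_def)
qed

lemma subset_colon: "rmod.subspace J \<Longrightarrow> J \<subseteq> colon f J"
  using rmod.subspace_scale[of J] by (auto simp: colon_def)

lemma subset_adjoin: "J \<subseteq> adjoin f J"
proof
  fix j assume "j \<in> J"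
  moreover have "j = j + f * 0" by simp
  ultimately show "j \<in> adjoin f J" unfolding adjoin_def by blast
qed

lemma mem_adjoin: "rmod.subspace J \<Longrightarrow> f \<in> adjoin f J"
  unfolding adjoin_def using rmod.subspace_0[of J] by (intro CollectI exI[of _ 0] exI[of _ 1]) simp

lemma graded_colon:
  assumes "graded_ideal J" "homogeneous e f"
  shows "graded_ideal (colon f J)"
  unfolding graded_ideal_def
proof (intro conjI ballI allI)
  show "rmod.subspace (colon f J)" using assms by (simp add: graded_ideal_def subspace_colon)
  fix g j assume "g \<in> colon f J"
  then have "hcomp (e + j) (f * g) \<in> J" using assms(1) by (simp add: graded_ideal_def colon_def)
  then show "hcomp j g \<in> colon f J" using assms(2) by (simp add: colon_def hcomp_homogeneous_mult)
qed

lemma graded_adjoin: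
  assumes "graded_ideal J" "homogeneous e f"
  shows "graded_ideal (adjoin f J)"
  unfolding graded_ideal_def
proof (intro conjI ballI allI)
  show "rmod.subspace (adjoin f J)" using assms by (simp add: graded_ideal_def subspace_adjoin)
  fix h m assume "h \<in> adjoin f J"
  then obtain j g where h: "h = j + f * g" "j \<in> J" by (auto simp: adjoin_def)
  have "hcomp m h = hcomp m j + f * (if e \<le> m then hcomp (m - e) g else 0)"
    using hcomp_homogeneous_mult[OF assms(2)] by (simp add: h restrict_keys_add)
  moreover have "hcomp m j \<in> J" using assms h by (simp add: graded_ideal_def)
  ultimately show "hcomp m h \<in> adjoin f J" unfolding adjoin_def by blast
qed

text \<open>The Hilbert function form of the exact sequence
  \<open>0 \<rightarrow> S/(J : f)(-e) \<rightarrow> S/J \<rightarrow> S/(J + (f)) \<rightarrow> 0\<close>.\<close>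

lemma hilb_split:
  fixes J :: "('v::finite, 'k::field) mpoly set"
  assumes J: "graded_ideal J" and f: "homogeneous e f"
  shows "hilb J z = hilb (colon f J) (z - int e) + hilb (adjoin f J) z"
proof -
  note sub = graded_ideal_subspace[OF J]
  let ?U = "homz (z - int e) :: ('v, 'k) mpoly set" and ?T = "J \<inter> homz z"
  have fhom: "f * u \<in> homz z" if "u \<in> ?U" for u
  proof (cases "z - int e < 0")
    case True
    then show ?thesis using that by (simp add: homz_neg homz_def)
  next
    case False
    then obtain a where a: "z - int e = int a" by (metis nonneg_int_cases not_less)
    then have "homogeneous a u" using that by simp
    then have "f * u \<in> homz (int (e + a))" by (simp only: homz_of_nat homogeneous_mult[OF f])
    moreover have "int (e + a) = z" using a by simp
    ultimately show ?thesis by simp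
  qed
  have lin: "Vector_Spaces.linear pscale pscale ((*) f)"
    by (intro Vector_Spaces.linear_iff[THEN iffD2] conjI allI pv.vector_space_axioms)
      (simp_all add: pscale_def distrib_left mult.left_commute)
  have subT: "pv.subspace ?T"
    by (intro pv.subspace_inter pv_subspace_ideal sub pv_subspace_homz)
  obtain A C where A: "?U \<subseteq> pv.span A" "finite A" and C: "(homz z :: ('v, 'k) mpoly set) \<subseteq> pv.span C" "finite C"
    using homz_finite_span by metis
  \<comment> \<open>Multiplication by \<open>f\<close> from degree \<open>z - e\<close> to degree
    \<open>z\<close>, taken modulo \<open>J\<close>: its kernel is the degree \<open>z - e\<close>
    part of the colon ideal, and its image together with \<open>?T\<close> is the degree
    \<open>z\<close> part of \<open>adjoin f J\<close>.\<close>
  have "pv.dim ?U + pv.dim ?T = pv.dim {x \<in> ?U. f * x \<in> ?T} + pv.dim {f * u + t |u t. u \<in> ?U \<and> t \<in> ?T}"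
    by (rule pvp.dim_image_plus[OF lin pv_subspace_homz A(1) A(2) subT order.trans[OF Int_lower2 C(1)] C(2)])
  also have "{x \<in> ?U. f * x \<in> ?T} = colon f J \<inter> ?U"
    using fhom by (auto simp: colon_def)
  also have "{f * u + t |u t. u \<in> ?U \<and> t \<in> ?T} = adjoin f J \<inter> homz z"
  proof safe
    fix u t assume ut: "u \<in> ?U" "t \<in> J" "t \<in> homz z"
    show "f * u + t \<in> homz z"
      using pv.subspace_add[OF pv_subspace_homz fhom] ut by blast
    have "f * u + t = t + f * u" by (rule add.commute)
    then show "f * u + t \<in> adjoin f J" using ut unfolding adjoin_def by blast
  next
    fix h assume h: "h \<in> adjoin f J" "h \<in> homz z"
    show "\<exists>u t. h = f * u + t \<and> u \<in> ?U \<and> t \<in> ?T"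
    proof (cases "z < 0")
      case True
      then show ?thesis using h rmod.subspace_0[OF sub]
        by (intro exI[of _ 0]) (simp add: homz_neg)
    next
      case False
      then obtain m where m: "z = int m" by (metis nonneg_int_cases not_less)
      from h obtain j g where jg: "h = j + f * g" "j \<in> J" by (auto simp: adjoin_def)
      \<comment> \<open>In degree \<open>m\<close> only the component of \<open>g\<close> of degree
        \<open>m - e\<close> contributes, and nothing does if \<open>e > m\<close>.\<close>
      let ?u = "if e \<le> m then hcomp (m - e) g else 0"
      have "h = hcomp m h" using h hcomp_homogeneous[of m h m] by (simp add: m)
      also have "\<dots> = f * ?u + hcomp m j"
        using hcomp_homogeneous_mult[OF f] by (simp add: jg restrict_keys_add)
      finally have "h = f * ?u + hcomp m j" .
      moreover have "?u \<in> ?U"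
      proof (cases "e \<le> m")
        case True
        then have "z - int e = int (m - e)" by (simp add: m of_nat_diff)
        then show ?thesis using True by (simp only: homz_of_nat) simp
      qed (simp add: homz_def)
      moreover have "hcomp m j \<in> ?T" using J jg by (simp add: graded_ideal_def m)
      ultimately show ?thesis by blast
    qed
  qed
  finally show ?thesis by (simp add: hilb_def)
qed

text \<open>The ideal generated by the variables in \<open>A\<close>; being a monomial ideal, it can
  be described through the monomials of its elements. For \<open>A = {}\<close> the quotient is
  \<open>S\<close>, for \<open>A = UNIV\<close> it is the field.\<close>

definition var_ideal :: "'v set \<Rightarrow> ('v::finite, 'k::field) mpoly set"
  where "var_ideal A = {f. \<forall>m\<in>Poly_Mapping.keys f. \<exists>x\<in>A. Poly_Mapping.lookup m x \<noteq> 0}"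

lemma var_ideal_empty [simp]: "var_ideal {} = {0}"
  by (auto simp: var_ideal_def in_keys_iff intro: poly_mapping_eqI)

lemma graded_var_ideal: "graded_ideal (var_ideal A :: ('v::finite, 'k::field) mpoly set)"
proof -
  have "c * f \<in> var_ideal A" if "f \<in> var_ideal A" for c f :: "('v, 'k) mpoly"
    unfolding var_ideal_def
  proof (intro CollectI ballI)
    fix m assume "m \<in> Poly_Mapping.keys (c * f)"
    then obtain a b where "m = a + b" "b \<in> Poly_Mapping.keys f" using keys_mult[of c f] by blast
    then show "\<exists>x\<in>A. Poly_Mapping.lookup m x \<noteq> 0"
      using that by (auto simp: var_ideal_def lookup_add)
  qed
  moreover have "f + g \<in> var_ideal A" if "f \<in> var_ideal A" "g \<in> var_ideal A" for f g :: "('v, 'k) mpoly"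
    using that Poly_Mapping.keys_add[of f g] unfolding var_ideal_def by blast
  moreover have "0 \<in> var_ideal A" by (simp add: var_ideal_def)
  moreover have "hcomp e f \<in> var_ideal A" if "f \<in> var_ideal A" for e and f :: "('v, 'k) mpoly"
    using that by (auto simp: var_ideal_def keys_restrict_keys)
  ultimately show ?thesis by (simp add: graded_ideal_def rmod.subspace_def)
qed

abbreviation pvar :: "'v \<Rightarrow> ('v::finite, 'k::field) mpoly"
  where "pvar x \<equiv> Poly_Mapping.single (Poly_Mapping.single x 1) 1"

lemma lookup_eq_single_plus:
  fixes m :: "'v \<Rightarrow>\<^sub>0 nat"
  assumes "Poly_Mapping.lookup m x \<noteq> 0"
  shows "m = Poly_Mapping.single x 1 + (m - Poly_Mapping.single x 1)"
  using assms by (intro poly_mapping_eqI) (auto simp: lookup_add lookup_minus lookup_single when_def)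

text \<open>Multiplication by a variable outside \<open>A\<close> leaves the exponents at
  \<open>A\<close> unchanged, so it is a nonzerodivisor modulo this ideal.\<close>

lemma colon_var_ideal:
  assumes "x \<notin> A"
  shows "colon (pvar x) (var_ideal A) = (var_ideal A :: ('v::finite, 'k::field) mpoly set)"
proof -
  have "Poly_Mapping.lookup (Poly_Mapping.single x 1 + m) y = Poly_Mapping.lookup m y"
    if "y \<in> A" for y and m :: "'v \<Rightarrow>\<^sub>0 nat"
    using assms that by (auto simp: lookup_add lookup_single when_def)
  then have "(\<exists>y\<in>A. Poly_Mapping.lookup (Poly_Mapping.single x 1 + m) y \<noteq> 0)
      \<longleftrightarrow> (\<exists>y\<in>A. Poly_Mapping.lookup m y \<noteq> 0)" for m :: "'v \<Rightarrow>\<^sub>0 nat"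
    by metis
  then show ?thesis
    unfolding colon_def var_ideal_def mem_Collect_eq keys_single_mult[OF one_neq_zero] ball_simps
    by simp
qed

lemma adjoin_var_ideal: "adjoin (pvar x) (var_ideal A) = (var_ideal (insert x A) :: ('v::finite, 'k::field) mpoly set)"
proof (intro subset_antisym subsetI)
  fix f :: "('v, 'k) mpoly" assume "f \<in> adjoin (pvar x) (var_ideal A)"
  then obtain j g where f: "f = j + pvar x * g" "j \<in> var_ideal A" by (auto simp: adjoin_def)
  have "j \<in> var_ideal (insert x A)" using f by (auto simp: var_ideal_def)
  moreover have "pvar x * g \<in> var_ideal (insert x A)"
    unfolding var_ideal_def mem_Collect_eq keys_single_mult[OF one_neq_zero] ball_simps
    by (simp add: lookup_add)
  ultimately show "f \<in> var_ideal (insert x A)"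
    using rmod.subspace_add[OF graded_ideal_subspace[OF graded_var_ideal]] f by blast
next
  fix f :: "('v, 'k) mpoly" assume f: "f \<in> var_ideal (insert x A)"
  note sub = subspace_adjoin[OF graded_ideal_subspace[OF graded_var_ideal[of A]], of "pvar x :: ('v, 'k) mpoly"]
  have "Poly_Mapping.single m c \<in> adjoin (pvar x) (var_ideal A)"
    if m: "m \<in> Poly_Mapping.keys f" for m and c :: 'k
  proof (cases "Poly_Mapping.lookup m x = 0")
    case True
    then have "Poly_Mapping.single m c \<in> var_ideal A" using f m by (auto simp: var_ideal_def)
    then show ?thesis using subset_adjoin by blast
  next
    case False
    have "0 + pvar x * Poly_Mapping.single (m - Poly_Mapping.single x 1) c
        = Poly_Mapping.single (Poly_Mapping.single x 1 + (m - Poly_Mapping.single x 1)) c"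
      by (simp add: mult_single)
    then have "Poly_Mapping.single m c = 0 + pvar x * Poly_Mapping.single (m - Poly_Mapping.single x 1) c"
      by (simp only: lookup_eq_single_plus[OF False, symmetric])
    moreover have "0 \<in> (var_ideal A :: ('v, 'k) mpoly set)" by (simp add: var_ideal_def)
    ultimately show ?thesis unfolding adjoin_def by blast
  qed
  then have "(\<Sum>m\<in>Poly_Mapping.keys f. Poly_Mapping.single m (Poly_Mapping.lookup f m)) \<in> adjoin (pvar x) (var_ideal A)"
    by (intro rmod.subspace_sum[OF sub])
  then show "f \<in> adjoin (pvar x) (var_ideal A)" 
    by (simp only: poly_mapping_sum_single[symmetric])
qed

lemma hilb_var_ideal_step:
  "x \<notin> A \<Longrightarrow> hilb (var_ideal A :: ('v::finite, 'k::field) mpoly set) z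
    = hilb (var_ideal A :: ('v, 'k) mpoly set) (z - 1) + hilb (var_ideal (insert x A) :: ('v, 'k) mpoly set) z"
  using hilb_split[OF graded_var_ideal homogeneous_var, of A z x 1]
  by (simp add: colon_var_ideal adjoin_var_ideal del: One_nat_def)

lemma hilb_var_ideal_UNIV:
  "hilb (var_ideal UNIV :: ('v::finite, 'k::field) mpoly set) (int m) = (if m = 0 then 1 else 0)"
proof (cases "m = 0")
  case True
  have eq: "homz 0 = pv.span {1 :: ('v, 'k) mpoly}"
  proof (intro subset_antisym subsetI)
    fix f :: "('v, 'k) mpoly" assume "f \<in> homz 0"
    then have f: "m = 0" if "m \<in> Poly_Mapping.keys f" for m
      using that by (simp add: homz_def mon_deg_eq_0_iff)
    have "pscale (Poly_Mapping.lookup f 0) 1 = f"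
    proof (rule poly_mapping_eqI)
      fix m show "Poly_Mapping.lookup (pscale (Poly_Mapping.lookup f 0) 1) m = Poly_Mapping.lookup f m"
        using f[of m] by (cases "m = 0") (auto simp: pscale_def lookup_single when_def in_keys_iff)
    qed
    moreover have "pscale (Poly_Mapping.lookup f 0) (1 :: ('v, 'k) mpoly) \<in> pv.span {1}"
      by (intro pv.span_scale pv.span_base) simp
    ultimately show "f \<in> pv.span {1}" by simp
  next
    fix f :: "('v, 'k) mpoly" assume "f \<in> pv.span {1}"
    then obtain c where "f = pscale c 1" by (auto simp: pv.span_singleton)
    then show "f \<in> homz 0" using homogeneous_const[of c] homz_of_nat[of f 0] by (simp add: pscale_def)
  qed
  have "pv.dim (homz 0 :: ('v, 'k) mpoly set) = 1"
    unfolding eq using pv.dim_span_eq_card_independent[of "{1 :: ('v, 'k) mpoly}"] by simp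
  moreover have "var_ideal UNIV \<inter> homz 0 = {0 :: ('v, 'k) mpoly}"
  proof -
    have "f = 0" if f: "f \<in> var_ideal UNIV" "f \<in> homz 0" for f :: "('v, 'k) mpoly"
    proof -
      have "Poly_Mapping.keys f = {}"
      proof (rule ccontr)
        assume "Poly_Mapping.keys f \<noteq> {}"
        then obtain m where m: "m \<in> Poly_Mapping.keys f" by blast
        with f(2) have "m = 0" by (simp add: homz_def mon_deg_eq_0_iff)
        moreover obtain x where "Poly_Mapping.lookup m x \<noteq> 0"
          using f(1) m unfolding var_ideal_def by blast
        ultimately show False by simp
      qed
      then show ?thesis by (auto simp: set_eq_iff in_keys_iff intro: poly_mapping_eqI)
    qed
    moreover have "0 \<in> (var_ideal UNIV :: ('v, 'k) mpoly set)" "0 \<in> (homz 0 :: ('v, 'k) mpoly set)"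
      by (auto simp: var_ideal_def homz_def)
    ultimately show ?thesis by blast
  qed
  ultimately show ?thesis using True by (simp add: hilb_def pv.dim_zero_subspace)
next
  case False
  have "homz (int m) \<subseteq> (var_ideal UNIV :: ('v, 'k) mpoly set)"
  proof
    fix f :: "('v, 'k) mpoly" assume f: "f \<in> homz (int m)"
    show "f \<in> var_ideal UNIV"
      unfolding var_ideal_def
    proof (intro CollectI ballI, rule ccontr)
      fix a assume "a \<in> Poly_Mapping.keys f" "\<not> (\<exists>x\<in>UNIV. Poly_Mapping.lookup a x \<noteq> 0)"
      then show False using f False by (auto simp: homogeneous_def mon_deg_def)
    qed
  qed
  then have "var_ideal UNIV \<inter> homz (int m) = (homz (int m) :: ('v, 'k) mpoly set)" by blast
  then show ?thesis using False by (simp add: hilb_def)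
qed

section \<open>Hilbert series and chains of primes\<close>

lemma sums_shift_int:
  fixes a :: "int \<Rightarrow> real"
  assumes "\<And>z. z < 0 \<Longrightarrow> a z = 0" "(\<lambda>m. a (int m) * t ^ m) sums S"
  shows "(\<lambda>m. a (int m - int e) * t ^ m) sums (t ^ e * S)"
proof -
  have "(\<lambda>m. t ^ e * (a (int m) * t ^ m)) sums (t ^ e * S)"
    using assms(2) by (rule sums_mult)
  also have "(\<lambda>m. t ^ e * (a (int m) * t ^ m)) = (\<lambda>m. a (int (m + e) - int e) * t ^ (m + e))"
    by (simp add: fun_eq_iff power_add)
  finally have "(\<lambda>m. a (int (m + e) - int e) * t ^ (m + e)) sums (t ^ e * S)" .
  moreover have "(\<Sum>i<e. a (int i - int e) * t ^ i) = 0"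
    by (intro sum.neutral) (auto simp: assms(1))
  ultimately show ?thesis
    using sums_iff_shift[of "\<lambda>m. a (int m - int e) * t ^ m" e "t ^ e * S"] by simp
qed

text \<open>Induction on the complement of \<open>A\<close>: removing a variable from the generators
  multiplies the series by \<open>1 / (1 - t)\<close>, a Cauchy product with the geometric series.
  The case \<open>A = {}\<close> is the series of \<open>S\<close>, which dominates all
  others.\<close>

lemma hilb_var_ideal_sums:
  fixes A :: "'v::finite set"
  assumes t: "0 < t" "t < (1::real)"
  shows "(\<lambda>m. real_of_int (hilb (var_ideal A :: ('v, 'k::field) mpoly set) (int m)) * t ^ m)
    sums ((1 / (1 - t)) ^ card (- A))"
proof -
  have "(\<lambda>m. real_of_int (hilb (var_ideal (- B) :: ('v, 'k::field) mpoly set) (int m)) * t ^ m)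
    sums ((1 / (1 - t)) ^ card B)" if "finite B" for B :: "'v set"
    using that
  proof induction
    case empty
    have "(\<lambda>m. if m = 0 then 1 else 0 :: real) sums 1"
      using sums_single[of 0 "\<lambda>_. 1 :: real"] by simp
    moreover have "(\<lambda>m. real_of_int (hilb (var_ideal UNIV :: ('v, 'k) mpoly set) (int m)) * t ^ m)
        = (\<lambda>m. if m = 0 then 1 else 0)"
      by (auto simp: hilb_var_ideal_UNIV)
    ultimately show ?case by simp
  next
    case (insert x B)
    let ?a = "\<lambda>z. hilb (var_ideal (- insert x B) :: ('v, 'k) mpoly set) z"
    let ?b = "\<lambda>z. hilb (var_ideal (- B) :: ('v, 'k) mpoly set) z"
    have "insert x (- insert x B) = - B" using insert.hyps by blast
    then have step: "?a z = ?a (z - 1) + ?b z" for z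
      using hilb_var_ideal_step[of x "- insert x B" z] by simp
    \<comment> \<open>By \<open>step\<close>, \<open>?b\<close> is the difference sequence of
      \<open>?a\<close>, and \<open>?a\<close> starts from \<open>0\<close> in degree
      \<open>-1\<close>.\<close>
    have ab: "?a (int m) = (\<Sum>i\<le>m. ?b (int i))" for m
    proof (induction m)
      case 0
      have "?a (0 - 1) = 0"
        using hilb_neg[of "- 1", OF _ graded_ideal_subspace[OF graded_var_ideal[of "- insert x B"]]]
        by simp
      with step[of 0] show ?case by simp
    next
      case (Suc m)
      with step[of "int (Suc m)"] show ?case by simp
    qed
    let ?f = "\<lambda>m. real_of_int (?b (int m)) * t ^ m" and ?g = "\<lambda>m. t ^ m"
    have "(\<lambda>k. \<Sum>i\<le>k. ?f i * ?g (k - i)) sums (suminf ?f * suminf ?g)"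
    proof (rule Cauchy_product_sums)
      show "summable (\<lambda>k. norm (?f k))"
        using sums_summable[OF insert.IH] t hilb_nonneg[of "var_ideal (- B) :: ('v, 'k) mpoly set"]
        by (simp add: abs_mult)
      show "summable (\<lambda>k. norm (?g k))" using t by (simp add: summable_geometric)
    qed
    also have "(\<lambda>k. \<Sum>i\<le>k. ?f i * ?g (k - i)) = (\<lambda>m. real_of_int (?a (int m)) * t ^ m)"
    proof
      fix k
      have "(\<Sum>i\<le>k. ?f i * ?g (k - i)) = (\<Sum>i\<le>k. real_of_int (?b (int i)) * t ^ k)"
        by (intro sum.cong) (auto simp flip: power_add)
      then show "(\<Sum>i\<le>k. ?f i * ?g (k - i)) = real_of_int (?a (int k)) * t ^ k"
        by (simp add: ab sum_distrib_right)
    qed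
    also have "suminf ?f * suminf ?g = (1 / (1 - t)) ^ card (insert x B)"
      using sums_unique[OF insert.IH] insert.hyps suminf_geometric[of t] t by simp
    finally show ?case .
  qed
  from this[of "- A"] show ?thesis by simp
qed

text \<open>The Hilbert series as a function of a real \<open>t\<close>, convergent for
  \<open>0 < t < 1\<close> by comparison with the series of \<open>S\<close>. Growth near
  \<open>t = 1\<close> becomes a matter of plain inequalities.\<close>

definition hs :: "('v::finite, 'k::field) mpoly set \<Rightarrow> real \<Rightarrow> real"
  where "hs J t = suminf (\<lambda>m. real_of_int (hilb J (int m)) * t ^ m)"

lemma hilb_sums_hs:
  fixes J :: "('v::finite, 'k::field) mpoly set"
  assumes J: "rmod.subspace J" and t: "0 < t" "t < 1"
  shows "(\<lambda>m. real_of_int (hilb J (int m)) * t ^ m) sums hs J t"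
  unfolding hs_def
proof (rule summable_sums, rule summable_comparison_test')
  show "summable (\<lambda>m. real_of_int (hilb (var_ideal {} :: ('v, 'k) mpoly set) (int m)) * t ^ m)"
    using hilb_var_ideal_sums[OF t] by (rule sums_summable)
  fix m
  have "hilb J (int m) \<le> hilb (var_ideal {} :: ('v, 'k) mpoly set) (int m)"
    using rmod.subspace_0[OF J] by (intro hilb_antimono) simp
  then show "norm (real_of_int (hilb J (int m)) * t ^ m)
      \<le> real_of_int (hilb (var_ideal {} :: ('v, 'k) mpoly set) (int m)) * t ^ m"
    using t hilb_nonneg[of J "int m"] by (auto simp: abs_mult intro!: mult_right_mono)
qed

lemma hs_nonneg: "0 < t \<Longrightarrow> t < 1 \<Longrightarrow> rmod.subspace J \<Longrightarrow> 0 \<le> hs J t"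
  using sums_summable[OF hilb_sums_hs, of J t] hilb_nonneg[of J]
  unfolding hs_def by (intro suminf_nonneg) auto

lemma hs_antimono:
  assumes "J \<subseteq> J'" "rmod.subspace J" "rmod.subspace J'" and t: "0 < t" "t < 1"
  shows "hs J' t \<le> hs J t"
  by (rule sums_le[OF _ hilb_sums_hs[OF assms(3) t] hilb_sums_hs[OF assms(2) t]])
    (use t hilb_antimono[OF assms(1)] in \<open>auto intro!: mult_right_mono\<close>)

lemma hs_split:
  assumes J: "graded_ideal J" and f: "homogeneous e f" and t: "0 < t" "t < 1"
  shows "hs J t = t ^ e * hs (colon f J) t + hs (adjoin f J) t"
proof -
  note sub = graded_ideal_subspace[OF J]
  have "(\<lambda>m. real_of_int (hilb (colon f J) (int m - int e)) * t ^ m) sums (t ^ e * hs (colon f J) t)"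
    by (rule sums_shift_int[OF _ hilb_sums_hs[OF subspace_colon[OF sub] t]])
      (simp add: hilb_neg subspace_colon[OF sub])
  from sums_add[OF this hilb_sums_hs[OF subspace_adjoin[OF sub, of f] t]]
  have "(\<lambda>m. real_of_int (hilb J (int m)) * t ^ m) sums (t ^ e * hs (colon f J) t + hs (adjoin f J) t)"
    by (simp add: hilb_split[OF J f] distrib_right)
  then show ?thesis using hilb_sums_hs[OF sub t] sums_unique2 by blast
qed

text \<open>\<open>l\<close> counts inclusions, so the negation of
  \<open>prime_chain (Suc r) J\<close> says, in terms of primes of \<open>S\<close>, that
  \<open>S/J\<close> has dimension at most \<open>r\<close>.\<close>

definition prime_chain :: "nat \<Rightarrow> 'a::comm_ring_1 set \<Rightarrow> bool"
  where "prime_chain l J \<longleftrightarrow> (\<exists>P :: nat \<Rightarrow> 'a set.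
    (\<forall>i\<le>l. prime_idl (P i)) \<and> (\<forall>i<l. P i \<subset> P (Suc i)) \<and> J \<subseteq> P 0)"

lemma prime_chain_mono: "J \<subseteq> J' \<Longrightarrow> prime_chain l J' \<Longrightarrow> prime_chain l J"
  unfolding prime_chain_def by blast

lemma prime_chain_Suc:
  assumes "prime_idl J" "J \<subset> J'" "prime_chain l J'"
  shows "prime_chain (Suc l) J"
proof -
  obtain P where P: "\<forall>i\<le>l. prime_idl (P i)" "\<forall>i<l. P i \<subset> P (Suc i)" "J' \<subseteq> P 0"
    using assms(3) unfolding prime_chain_def by blast
  show ?thesis
    unfolding prime_chain_def
  proof (intro exI[of _ "case_nat J P"] conjI allI impI)
    fix i
    show "i \<le> Suc l \<Longrightarrow> prime_idl (case_nat J P i)"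
      using P(1) assms(1) by (cases i) auto
    show "i < Suc l \<Longrightarrow> case_nat J P i \<subset> case_nat J P (Suc i)"
      using P(2,3) assms(2) by (cases i) auto
  qed simp
qed

section \<open>The ideal of all variables\<close>

lemma var_ideal_UNIV_eq: "var_ideal UNIV = {f :: ('v::finite, 'k::field) mpoly. Poly_Mapping.lookup f 0 = 0}"
proof (intro subset_antisym subsetI)
  fix f :: "('v, 'k) mpoly" assume "f \<in> var_ideal UNIV"
  then have "0 \<notin> Poly_Mapping.keys f" by (auto simp: var_ideal_def)
  then show "f \<in> {f. Poly_Mapping.lookup f 0 = 0}" by (simp add: in_keys_iff)
next
  fix f :: "('v, 'k) mpoly" assume f: "f \<in> {f. Poly_Mapping.lookup f 0 = 0}"
  show "f \<in> var_ideal UNIV"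
    unfolding var_ideal_def
  proof (intro CollectI ballI, rule ccontr)
    fix m assume "m \<in> Poly_Mapping.keys f" "\<not> (\<exists>x\<in>UNIV. Poly_Mapping.lookup m x \<noteq> 0)"
    moreover from this have "m = 0" by (intro poly_mapping_eqI) auto
    ultimately show False using f by (simp add: in_keys_iff)
  qed
qed

text \<open>The constant term is the component of degree \<open>0\<close>; a nonzero one would be a
  unit in \<open>J\<close>.\<close>

lemma graded_subset_var_ideal:
  fixes J :: "('v::finite, 'k::field) mpoly set"
  assumes J: "graded_ideal J" "J \<noteq> UNIV"
  shows "J \<subseteq> var_ideal UNIV"
proof
  fix f assume f: "f \<in> J"
  note sub = graded_ideal_subspace[OF J(1)]
  have "Poly_Mapping.lookup f 0 = 0"
  proof (rule ccontr)
    assume n: "Poly_Mapping.lookup f 0 \<noteq> 0"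
    have "hcomp 0 f = Poly_Mapping.single 0 (Poly_Mapping.lookup f 0)"
      by (intro poly_mapping_eqI) (auto simp: restrict_keys.rep_eq lookup_single when_def mon_deg_eq_0_iff)
    then have "Poly_Mapping.single 0 (Poly_Mapping.lookup f 0) \<in> J"
      using graded_ideal_hcomp[OF J(1) f, of 0] by simp
    then have "Poly_Mapping.single 0 (1 / Poly_Mapping.lookup f 0) * Poly_Mapping.single 0 (Poly_Mapping.lookup f 0) \<in> J"
      by (rule rmod.subspace_scale[OF sub])
    then have "1 \<in> J" using n by (simp add: mult_single)
    then have "g \<in> J" for g using rmod.subspace_scale[OF sub, of 1 g] by simp
    then show False using J(2) by blast
  qed
  then show "f \<in> var_ideal UNIV" by (simp add: var_ideal_UNIV_eq)
qed

lemma lookup_mult_0: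
  fixes f g :: "('v::finite, 'k::field) mpoly"
  shows "Poly_Mapping.lookup (f * g) 0 = Poly_Mapping.lookup f 0 * Poly_Mapping.lookup g 0"
proof -
  have h: "hcomp 0 h = Poly_Mapping.single 0 (Poly_Mapping.lookup h 0)" for h :: "('v, 'k) mpoly"
    by (intro poly_mapping_eqI) (auto simp: restrict_keys.rep_eq lookup_single when_def mon_deg_eq_0_iff)
  have "Poly_Mapping.lookup (f * g) 0 = Poly_Mapping.lookup (hcomp 0 (f * g)) 0"
    by (simp add: restrict_keys.rep_eq)
  also have "\<dots> = Poly_Mapping.lookup f 0 * Poly_Mapping.lookup g 0"
    unfolding hcomp_mult by (simp add: h mult_single)
  finally show ?thesis .
qed

lemma prime_var_ideal_UNIV: "prime_idl (var_ideal UNIV :: ('v::finite, 'k::field) mpoly set)"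
proof -
  have "(1 :: ('v, 'k) mpoly) \<notin> var_ideal UNIV" by (simp add: var_ideal_UNIV_eq)
  then have "(var_ideal UNIV :: ('v, 'k) mpoly set) \<noteq> UNIV" by blast
  then show ?thesis
    using graded_ideal_subspace[OF graded_var_ideal[of UNIV]]
    by (simp add: prime_idl_def) (simp add: var_ideal_UNIV_eq lookup_mult_0)
qed

lemma var_ideal_UNIV_subset:
  fixes J :: "('v::finite, 'k::field) mpoly set"
  assumes J: "rmod.subspace J" and x: "\<And>x. pvar x \<in> J"
  shows "var_ideal UNIV \<subseteq> J"
proof
  fix f :: "('v, 'k) mpoly" assume f: "f \<in> var_ideal UNIV"
  have "Poly_Mapping.single m c \<in> J" if m: "m \<in> Poly_Mapping.keys f" for m c
  proof -
    obtain x where x': "Poly_Mapping.lookup m x \<noteq> 0" using f m unfolding var_ideal_def by blast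
    have "Poly_Mapping.single (m - Poly_Mapping.single x 1) c * pvar x
        = Poly_Mapping.single (Poly_Mapping.single x 1 + (m - Poly_Mapping.single x 1)) c"
      by (simp add: mult_single add.commute)
    also have "\<dots> = Poly_Mapping.single m c"
      by (simp only: lookup_eq_single_plus[OF x', symmetric])
    finally show ?thesis using rmod.subspace_scale[OF J x[of x]] by metis
  qed
  then have "(\<Sum>m\<in>Poly_Mapping.keys f. Poly_Mapping.single m (Poly_Mapping.lookup f m)) \<in> J"
    by (intro rmod.subspace_sum[OF J])
  then show "f \<in> J" by (simp only: poly_mapping_sum_single[symmetric])
qed

text \<open>Noetherian induction. For a homogeneous prime \<open>J\<close> missing a variable \<open>x\<close>, passing to
  \<open>J + (x)\<close> shortens the chains of primes and multiplies the Hilbert series by \<open>1 - t\<close>; a non-prime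
  \<open>J\<close> is split by a homogeneous zero divisor.\<close>

lemma hs_bounded:
  fixes J :: "('v::finite, 'k::field) mpoly set"
  assumes "graded_ideal J" "\<not> prime_chain (Suc r) J"
  shows "\<exists>C. \<forall>t\<in>{0<..<1}. (1 - t) ^ r * hs J t \<le> C"
  using wf_subspace_mpoly assms
proof (induction J arbitrary: r rule: wf_induct_rule)
  case (less J)
  note J = less.prems(1) and chain = less.prems(2)
  note sub = graded_ideal_subspace[OF J]
  have IH: "\<exists>C. \<forall>t\<in>{0<..<1}. (1 - t) ^ r' * hs J' t \<le> C"
    if "J \<subset> J'" "graded_ideal J'" "\<not> prime_chain (Suc r') J'" for J' r'
    using less.IH[of J' r'] that sub graded_ideal_subspace[OF that(2)] by simp
  consider "J = UNIV" | "J \<noteq> UNIV" "prime_idl J" "\<And>x. pvar x \<in> J"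
    | x where "J \<noteq> UNIV" "prime_idl J" "pvar x \<notin> J" | "J \<noteq> UNIV" "\<not> prime_idl J"
    by blast
  then show ?case
  proof cases
    case 1
    then show ?thesis by (intro exI[of _ 0]) (simp add: hs_def hilb_UNIV)
  next
    case 2
    \<comment> \<open>Once \<open>J\<close> contains all variables, its series is at most that of
      \<open>var_ideal UNIV\<close>, which is \<open>1\<close>.\<close>
    note V = graded_ideal_subspace[OF graded_var_ideal[of UNIV]]
    have "(1 - t) ^ r * hs J t \<le> 1" if t: "t \<in> {0<..<1}" for t
    proof -
      have "hs J t \<le> hs (var_ideal UNIV :: ('v, 'k) mpoly set) t"
        using t var_ideal_UNIV_subset[OF sub 2(3)] by (intro hs_antimono sub V) auto
      also have "\<dots> = 1"
        using sums_unique2[OF hilb_sums_hs[OF V] hilb_var_ideal_sums[of t UNIV]] t by simp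
      finally have "hs J t \<le> 1" .
      then show ?thesis
        using t hs_nonneg[of t J] sub mult_mono[of "(1 - t) ^ r" 1 "hs J t" 1] power_le_one[of "1 - t" r]
        by simp
    qed
    then show ?thesis by blast
  next
    case 3
    let ?J = "adjoin (pvar x) J"
    have grJ: "graded_ideal ?J" by (rule graded_adjoin[OF J homogeneous_var])
    have ss: "J \<subset> ?J" using subset_adjoin[of J "pvar x"] mem_adjoin[OF sub, of "pvar x"] 3(3) by blast
    have nch: "\<not> prime_chain r ?J" using prime_chain_Suc[OF 3(2) ss] chain by blast
    show ?thesis
    proof (cases r)
      \<comment> \<open>For \<open>r = 0\<close> this situation is impossible: \<open>J\<close> is a
        prime strictly below the ideal of all variables, which gives a chain with one
        inclusion.\<close>
      case 0
      have "pvar x \<in> (var_ideal UNIV :: ('v, 'k) mpoly set)"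
        by (auto simp: var_ideal_def lookup_single intro!: exI[of _ x])
      then have "J \<noteq> var_ideal UNIV" using 3(3) by blast
      then have "J \<subset> var_ideal UNIV" using graded_subset_var_ideal[OF J 3(1)] by blast
      moreover have "prime_chain 0 (var_ideal UNIV :: ('v, 'k) mpoly set)"
        unfolding prime_chain_def
        by (intro exI[of _ "\<lambda>_. var_ideal UNIV"]) (auto simp: prime_var_ideal_UNIV)
      ultimately have "prime_chain (Suc 0) J" using prime_chain_Suc[OF 3(2)] by blast
      then show ?thesis using chain 0 by simp
    next
      case (Suc r')
      then obtain C where C: "\<forall>t\<in>{0<..<1}. (1 - t) ^ r' * hs ?J t \<le> C"
        using IH[OF ss grJ, of r'] nch by blast
      \<comment> \<open>\<open>pvar x\<close> is a nonzerodivisor modulo the prime \<open>J\<close>,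
        so \<open>hs_split\<close> reads \<open>hs J t = t * hs J t + hs ?J t\<close>.\<close>
      have "colon (pvar x) J = J"
        using 3(2,3) subset_colon[OF sub, of "pvar x"] by (auto simp: prime_idl_def colon_def)
      then have eq: "(1 - t) * hs J t = hs ?J t" if "t \<in> {0<..<1}" for t
        using hs_split[OF J homogeneous_var[of x 1], of t] that by (simp add: algebra_simps)
      have "(1 - t) ^ r * hs J t \<le> C" if "t \<in> {0<..<1}" for t
      proof -
        have "(1 - t) ^ r * hs J t = (1 - t) ^ r' * ((1 - t) * hs J t)" by (simp add: Suc)
        then show ?thesis using C that eq[OF that] by simp
      qed
      then show ?thesis by blast
    qed
  next
    case 4
    obtain a b f g where fg: "homogeneous a f" "homogeneous b g" "f * g \<in> J" "f \<notin> J" "g \<notin> J"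
      using graded_prime_idlI[OF J 4(1)] 4(2) by blast
    \<comment> \<open>Both pieces are strictly larger than \<open>J\<close>: adjoining brings in
      \<open>f\<close>, and the colon ideal contains \<open>g\<close>. Primes above them are primes
      above \<open>J\<close>, so the bound on chains is inherited.\<close>
    have ss1: "J \<subset> adjoin f J" using subset_adjoin[of J f] mem_adjoin[OF sub, of f] fg by blast
    have ss2: "J \<subset> colon f J" using subset_colon[OF sub, of f] fg by (auto simp: colon_def)
    obtain C1 where C1: "\<forall>t\<in>{0<..<1}. (1 - t) ^ r * hs (adjoin f J) t \<le> C1"
      using IH[OF ss1 graded_adjoin[OF J fg(1)]] chain prime_chain_mono[OF psubset_imp_subset[OF ss1]] by blast
    obtain C2 where C2: "\<forall>t\<in>{0<..<1}. (1 - t) ^ r * hs (colon f J) t \<le> C2"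
      using IH[OF ss2 graded_colon[OF J fg(1)]] chain prime_chain_mono[OF psubset_imp_subset[OF ss2]] by blast
    have "(1 - t) ^ r * hs J t \<le> C2 + C1" if t: "t \<in> {0<..<1}" for t
    proof -
      have "0 \<le> (1 - t) ^ r * hs (colon f J) t"
        using t hs_nonneg[of t "colon f J"] subspace_colon[OF sub] by simp
      then have "t ^ a * ((1 - t) ^ r * hs (colon f J) t) \<le> (1 - t) ^ r * hs (colon f J) t"
        using t power_le_one[of t a] by (intro mult_left_le_one_le) auto
      moreover have "(1 - t) ^ r * hs (colon f J) t \<le> C2" "(1 - t) ^ r * hs (adjoin f J) t \<le> C1"
        using C1 C2 t by blast+
      moreover have "(1 - t) ^ r * hs J t
          = t ^ a * ((1 - t) ^ r * hs (colon f J) t) + (1 - t) ^ r * hs (adjoin f J) t"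
      proof -
        have eq: "hs J t = t ^ a * hs (colon f J) t + hs (adjoin f J) t"
          using hs_split[OF J fg(1)] t by simp
        show ?thesis unfolding eq by (simp add: distrib_left)
      qed
      ultimately show ?thesis by linarith
    qed
    then show ?thesis by blast
  qed
qed

section \<open>Uniqueness of Betti numbers\<close>

text \<open>If \<open>m < n\<close>, padding \<open>A\<close> with zero columns and \<open>B\<close>
  with zero rows gives square matrices with product \<open>1\<close>. The product in the other order
  is then \<open>1\<close> as well, yet its last row is zero.\<close>

lemma mat_left_inverse_dim_le:
  fixes A B :: "'a::field mat"
  assumes A: "A \<in> carrier_mat n m" and B: "B \<in> carrier_mat m n" and AB: "A * B = 1\<^sub>m n"
  shows "n \<le> m"
proof (rule ccontr)
  assume "\<not> n \<le> m"
  then have mn: "m < n" by simp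
  define A' where "A' = mat n n (\<lambda>(i, j). if j < m then A $$ (i, j) else 0)"
  define B' where "B' = mat n n (\<lambda>(i, j). if i < m then B $$ (i, j) else 0)"
  have c: "A' \<in> carrier_mat n n" "B' \<in> carrier_mat n n" by (simp_all add: A'_def B'_def)
  have "A' * B' = A * B"
  proof (rule eq_matI)
    fix i j assume "i < dim_row (A * B)" "j < dim_col (A * B)"
    then have ij: "i < n" "j < n" using A B by auto
    have "(A' * B') $$ (i, j) = (\<Sum>k<n. A' $$ (i, k) * B' $$ (k, j))"
      using ij c by (simp add: scalar_prod_def atLeast0LessThan)
    also have "\<dots> = (\<Sum>k<m. A' $$ (i, k) * B' $$ (k, j))"
      using mn ij by (intro sum.mono_neutral_right) (auto simp: A'_def)
    also have "\<dots> = (\<Sum>k<m. A $$ (i, k) * B $$ (k, j))"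
      using mn ij by (intro sum.cong) (auto simp: A'_def B'_def)
    also have "\<dots> = (A * B) $$ (i, j)"
      using ij A B by (simp add: scalar_prod_def atLeast0LessThan)
    finally show "(A' * B') $$ (i, j) = (A * B) $$ (i, j)" .
  qed (use A B c in auto)
  then have "B' * A' = 1\<^sub>m n" using mat_mult_left_right_inverse[OF c] AB by simp
  then have "(B' * A') $$ (n - 1, n - 1) = 1" using mn by simp
  moreover have "(B' * A') $$ (n - 1, n - 1) = (\<Sum>k<n. B' $$ (n - 1, k) * A' $$ (k, n - 1))"
    using mn c by (simp add: scalar_prod_def atLeast0LessThan)
  moreover have "\<dots> = 0"
    using mn by (intro sum.neutral) (auto simp: B'_def)
  ultimately show False by simp
qed

lemma mat_lift:
  assumes D: "D \<in> carrier_mat r m" and M: "M \<in> carrier_mat r c"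
    and im: "\<And>j. j < c \<Longrightarrow> \<exists>w \<in> carrier_vec m. col M j = D *\<^sub>v w"
  shows "\<exists>E \<in> carrier_mat m c. D * E = M"
proof -
  from im obtain w where w: "\<And>j. j < c \<Longrightarrow> w j \<in> carrier_vec m \<and> col M j = D *\<^sub>v w j" by metis
  define E where "E = mat m c (\<lambda>(i, j). w j $ i)"
  have E: "E \<in> carrier_mat m c" by (simp add: E_def)
  have cX: "col E j = w j" if "j < c" for j
    using w[OF that] that by (intro eq_vecI) (auto simp: E_def)
  have "D * E = M"
  proof (rule eq_matI)
    fix i j assume "i < dim_row M" "j < dim_col M"
    then have ij: "i < r" "j < c" using M by auto
    have "(D * E) $$ (i, j) = col (D * E) j $ i" using ij D E by simp
    also have "col (D * E) j = col M j" using col_mult2[OF D E ij(2)] cX w ij by simp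
    finally show "(D * E) $$ (i, j) = M $$ (i, j)" using ij M by simp
  qed (use D E M in auto)
  with E show ?thesis by blast
qed

lemma mult_unit_vec:
  fixes A :: "'a::semiring_1 mat"
  assumes "A \<in> carrier_mat r c" "j < c"
  shows "A *\<^sub>v unit_vec c j = col A j"
  using assms by (intro eq_vecI) (auto simp: scalar_prod_right_unit[of _ c])

text \<open>The exactness conditions of \<open>graded_free_resolution\<close>, over any commutative
  ring; comparison maps are built from them.\<close>

definition resolution :: "'a::comm_ring_1 set \<Rightarrow> (nat \<Rightarrow> nat) \<Rightarrow> (nat \<Rightarrow> 'a mat) \<Rightarrow> bool"
  where "resolution J b D \<longleftrightarrow>
    b 0 = 1 \<and> (\<forall>i\<ge>1. D i \<in> carrier_mat (b (i - 1)) (b i)) \<and>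
    {(D 1 *\<^sub>v w) $ 0 | w. w \<in> carrier_vec (b 1)} = J \<and>
    (\<forall>i \<ge> 1. {v \<in> carrier_vec (b i). D i *\<^sub>v v = 0\<^sub>v (b (i - 1))}
       = {D (i + 1) *\<^sub>v w | w. w \<in> carrier_vec (b (i + 1))})"

lemma graded_free_resolution_resolution: "graded_free_resolution J b a D \<Longrightarrow> resolution J b D"
  by (simp add: graded_free_resolution_def resolution_def)

lemma resolution_carrier:
  "resolution J b D \<Longrightarrow> D (Suc i) \<in> carrier_mat (b i) (b (Suc i))"
proof -
  assume "resolution J b D"
  then have "\<forall>i\<ge>1. D i \<in> carrier_mat (b (i - 1)) (b i)"
    unfolding resolution_def by (elim conjE)
  from this[rule_format, of "Suc i"] show ?thesis by simp
qed

lemma resolution_image: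
  assumes "resolution J b D"
  shows "f \<in> J \<longleftrightarrow> (\<exists>w \<in> carrier_vec (b 1). f = (D 1 *\<^sub>v w) $ 0)"
proof -
  have "{(D 1 *\<^sub>v w) $ 0 | w. w \<in> carrier_vec (b 1)} = J"
    using assms unfolding resolution_def by (elim conjE)
  then show ?thesis by blast
qed

lemma resolution_exact:
  assumes "resolution J b D" "v \<in> carrier_vec (b (Suc i))"
  shows "D (Suc i) *\<^sub>v v = 0\<^sub>v (b i) \<longleftrightarrow> (\<exists>w \<in> carrier_vec (b (Suc (Suc i))). v = D (Suc (Suc i)) *\<^sub>v w)"
proof -
  have "\<forall>i \<ge> 1. {v \<in> carrier_vec (b i). D i *\<^sub>v v = 0\<^sub>v (b (i - 1))}
       = {D (i + 1) *\<^sub>v w | w. w \<in> carrier_vec (b (i + 1))}"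
    using assms(1) unfolding resolution_def by (elim conjE)
  from this[rule_format, of "Suc i"]
  have "{v \<in> carrier_vec (b (Suc i)). D (Suc i) *\<^sub>v v = 0\<^sub>v (b i)}
       = {D (Suc (Suc i)) *\<^sub>v w | w. w \<in> carrier_vec (b (Suc (Suc i)))}"
    by simp
  then show ?thesis using assms(2) by blast
qed

lemma resolution_lift:
  assumes R: "resolution J b D" and M: "M \<in> carrier_mat (b (Suc i)) c"
    and z: "D (Suc i) * M = 0\<^sub>m (b i) c"
  shows "\<exists>E \<in> carrier_mat (b (Suc (Suc i))) c. D (Suc (Suc i)) * E = M"
proof (rule mat_lift[OF resolution_carrier[OF R] M])
  fix j assume j: "j < c"
  have "D (Suc i) *\<^sub>v col M j = col (D (Suc i) * M) j"
    using col_mult2[OF resolution_carrier[OF R] M j] by simp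
  also have "\<dots> = 0\<^sub>v (b i)" using j by (simp add: z)
  finally show "\<exists>w\<in>carrier_vec (b (Suc (Suc i))). col M j = D (Suc (Suc i)) *\<^sub>v w"
    using resolution_exact[OF R, of "col M j" i] M j col_carrier_vec[OF j] by blast
qed

lemma resolution_complex:
  fixes D :: "nat \<Rightarrow> 'a::comm_ring_1 mat"
  assumes R: "resolution J b D"
  shows "D (Suc i) * D (Suc (Suc i)) = 0\<^sub>m (b i) (b (Suc (Suc i)))"
proof (rule mat_col_eqI)
  note c = resolution_carrier[OF R]
  fix j assume "j < dim_col (0\<^sub>m (b i) (b (Suc (Suc i))) :: 'a mat)"
  then have j: "j < b (Suc (Suc i))" by simp
  have "col (D (Suc i) * D (Suc (Suc i))) j = D (Suc i) *\<^sub>v col (D (Suc (Suc i))) j"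
    by (rule col_mult2[OF c c j])
  also have "col (D (Suc (Suc i))) j = D (Suc (Suc i)) *\<^sub>v unit_vec (b (Suc (Suc i))) j"
    using mult_unit_vec[OF c j] by simp
  also have "D (Suc i) *\<^sub>v \<dots> = 0\<^sub>v (b i)"
    using resolution_exact[OF R mult_mat_vec_carrier[OF c unit_vec_carrier], of i] unit_vec_carrier by blast
  finally show "col (D (Suc i) * D (Suc (Suc i))) j = col (0\<^sub>m (b i) (b (Suc (Suc i)))) j"
    using j by simp
qed (use resolution_carrier[OF R, of i] resolution_carrier[OF R, of "Suc i"] in auto)

text \<open>Comparison of resolutions over the identity of \<open>S\<close>: by exactness, the
  columns of \<open>E * D (Suc i)\<close> are images under \<open>D' (Suc i)\<close>, and their
  preimages form the next map.\<close>

lemma chain_map_exists: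
  fixes D D' :: "nat \<Rightarrow> 'a::comm_ring_1 mat"
  assumes R: "resolution J b D" and R': "resolution J b' D'"
  shows "\<exists>\<phi>. \<phi> 0 = 1\<^sub>m 1 \<and> (\<forall>i. \<phi> i \<in> carrier_mat (b' i) (b i)) \<and>
    (\<forall>i. D' (Suc i) * \<phi> (Suc i) = \<phi> i * D (Suc i))"
proof -
  note c = resolution_carrier[OF R] and c' = resolution_carrier[OF R']
  have b0: "b 0 = 1" "b' 0 = 1" using R R' by (simp_all add: resolution_def)
  \<comment> \<open>The invariant includes that the next square can be completed, because
    \<open>dependent_nat_choice\<close> must find a successor from the current map alone.\<close>
  define P where "P i E \<longleftrightarrow> E \<in> carrier_mat (b' i) (b i) \<and> (i = 0 \<longrightarrow> E = 1\<^sub>m 1) \<and>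
    (\<exists>Y \<in> carrier_mat (b' (Suc i)) (b (Suc i)). D' (Suc i) * Y = E * D (Suc i))" for i E
  define Q where "Q i E Y \<longleftrightarrow> D' (Suc i) * Y = E * D (Suc i)" for i E Y
  have "\<exists>f. \<forall>i. P i (f i) \<and> Q i (f i) (f (Suc i))"
  proof (rule dependent_nat_choice)
    have "\<exists>Y \<in> carrier_mat (b' (Suc 0)) (b (Suc 0)). D' (Suc 0) * Y = D (Suc 0)"
    proof (rule mat_lift[OF c'])
      show D1: "D (Suc 0) \<in> carrier_mat (b' 0) (b (Suc 0))" using c[of 0] b0 by simp
      fix j assume j: "j < b (Suc 0)"
      have "col (D (Suc 0)) j = D 1 *\<^sub>v unit_vec (b 1) j"
        using mult_unit_vec[OF c j] by simp
      then have "col (D (Suc 0)) j $ 0 \<in> J"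
        unfolding resolution_image[OF R] by (intro bexI[of _ "unit_vec (b 1) j"]) simp_all
      then obtain w where w: "w \<in> carrier_vec (b' 1)" "col (D (Suc 0)) j $ 0 = (D' 1 *\<^sub>v w) $ 0"
        unfolding resolution_image[OF R'] by blast
      have "col (D (Suc 0)) j = D' (Suc 0) *\<^sub>v w"
        using w(2) D1 c'[of 0] b0 by (intro eq_vecI) auto
      then show "\<exists>w\<in>carrier_vec (b' (Suc 0)). col (D (Suc 0)) j = D' (Suc 0) *\<^sub>v w"
        using w(1) by auto
    qed
    moreover have "1\<^sub>m 1 * D (Suc 0) = D (Suc 0)" using c[of 0] b0 by simp
    ultimately have "P 0 (1\<^sub>m 1)" by (simp add: P_def b0)
    then show "\<exists>x. P 0 x" by blast
  next
    fix E i assume "P i E"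
    then obtain Y where E: "E \<in> carrier_mat (b' i) (b i)"
      and Y: "Y \<in> carrier_mat (b' (Suc i)) (b (Suc i))" "D' (Suc i) * Y = E * D (Suc i)"
      by (auto simp: P_def)
    have "D' (Suc i) * (Y * D (Suc (Suc i))) = (E * D (Suc i)) * D (Suc (Suc i))"
      using assoc_mult_mat[OF c' Y(1) c] Y(2) by simp
    also have "\<dots> = E * (D (Suc i) * D (Suc (Suc i)))" by (rule assoc_mult_mat[OF E c c])
    also have "\<dots> = 0\<^sub>m (b' i) (b (Suc (Suc i)))"
      using E by (simp add: resolution_complex[OF R])
    finally have "\<exists>Z \<in> carrier_mat (b' (Suc (Suc i))) (b (Suc (Suc i))).
        D' (Suc (Suc i)) * Z = Y * D (Suc (Suc i))"
      by (rule resolution_lift[OF R' mult_carrier_mat[OF Y(1) c]])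
    then have "P (Suc i) Y" using Y by (simp add: P_def)
    then show "\<exists>y. P (Suc i) y \<and> Q i E y" using Y(2) by (auto simp: Q_def)
  qed
  then show ?thesis by (auto simp: P_def Q_def)
qed

text \<open>The residue map modulo the ideal of all variables. Minimality of a resolution says that
  it sends all its matrices to zero.\<close>

definition const_coeff :: "('v::finite, 'k::field) mpoly \<Rightarrow> 'k"
  where "const_coeff f = Poly_Mapping.lookup f 0"

interpretation const_coeff: comm_ring_hom "const_coeff :: ('v::finite, 'k::field) mpoly \<Rightarrow> 'k"
  by unfold_locales (simp_all add: const_coeff_def lookup_add lookup_mult_0)

lemma map_mat_const_coeff_add:
  "A \<in> carrier_mat r c \<Longrightarrow> B \<in> carrier_mat r c \<Longrightarrow>
    map_mat const_coeff (A + B) = map_mat const_coeff A + map_mat const_coeff B"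
  by (intro eq_matI) (auto simp: const_coeff.hom_add)

abbreviation minimal_res where "minimal_res b D \<equiv>
  \<forall>i\<ge>1. \<forall>p<b (i - 1). \<forall>q<b i. Poly_Mapping.lookup (D i $$ (p, q)) 0 = 0"

lemma minimal_res_const_coeff:
  assumes "resolution J b D" "minimal_res b D"
  shows "map_mat const_coeff (D (Suc i)) = 0\<^sub>m (b i) (b (Suc i))"
proof (rule eq_matI)
  fix p q assume "p < dim_row (0\<^sub>m (b i) (b (Suc i)))" "q < dim_col (0\<^sub>m (b i) (b (Suc i)))"
  then have pq: "p < b i" "q < b (Suc i)" by auto
  have "Poly_Mapping.lookup (D (Suc i) $$ (p, q)) 0 = 0"
    using assms(2)[rule_format, of "Suc i" p q] pq by simp
  then show "map_mat const_coeff (D (Suc i)) $$ (p, q) = 0\<^sub>m (b i) (b (Suc i)) $$ (p, q)"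
    using pq resolution_carrier[OF assms(1), of i] by (simp add: const_coeff_def)
qed (use resolution_carrier[OF assms(1), of i] in auto)

text \<open>A chain endomorphism lifting \<open>0\<close> is null homotopic, hence zero modulo the variables.\<close>

lemma null_homotopic_const_coeff:
  fixes D :: "nat \<Rightarrow> ('v::finite, 'k::field) mpoly mat"
  assumes R: "resolution J b D" and min: "minimal_res b D"
    and E: "\<And>i. E i \<in> carrier_mat (b i) (b i)" "E 0 = 0\<^sub>m 1 1"
    and chain: "\<And>i. D (Suc i) * E (Suc i) = E i * D (Suc i)"
  shows "map_mat const_coeff (E i) = 0\<^sub>m (b i) (b i)"
proof -
  note c = resolution_carrier[OF R]
  have b0: "b 0 = 1" using R by (simp add: resolution_def)
  \<comment> \<open>The homotopy is built step by step. The invariant makes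
    \<open>E (Suc i) - s * D (Suc i)\<close> a matrix of cycles, which lifts through
    \<open>D (Suc (Suc i))\<close> to the next homotopy \<open>s'\<close>.\<close>
  have "\<exists>s \<in> carrier_mat (b (Suc i)) (b i). D (Suc i) * E (Suc i) = D (Suc i) * (s * D (Suc i)) \<and>
      map_mat const_coeff (E i) = 0\<^sub>m (b i) (b i)"
  proof (induction i)
    case 0
    have "D (Suc 0) * E (Suc 0) = 0\<^sub>m (b 0) (b (Suc 0))"
      using chain[of 0] E(2) c[of 0] b0 by simp
    moreover have "D (Suc 0) * (0\<^sub>m (b (Suc 0)) (b 0) * D (Suc 0)) = 0\<^sub>m (b 0) (b (Suc 0))"
      using c[of 0] by simp
    moreover have "map_mat const_coeff (E 0) = 0\<^sub>m (b 0) (b 0)"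
      by (intro eq_matI) (auto simp: E(2) b0)
    ultimately show ?case by (intro bexI[of _ "0\<^sub>m (b (Suc 0)) (b 0)"]) auto
  next
    case (Suc i)
    then obtain s where s: "s \<in> carrier_mat (b (Suc i)) (b i)"
      "D (Suc i) * E (Suc i) = D (Suc i) * (s * D (Suc i))" by blast
    note sD = mult_carrier_mat[OF s(1) c]
    define M where "M = E (Suc i) - s * D (Suc i)"
    have M: "M \<in> carrier_mat (b (Suc i)) (b (Suc i))" unfolding M_def by (rule minus_carrier_mat[OF sD])
    have "D (Suc i) * M = D (Suc i) * E (Suc i) - D (Suc i) * (s * D (Suc i))"
      unfolding M_def by (rule mult_minus_distrib_mat[OF c E(1) sD])
    also have "\<dots> = 0\<^sub>m (b i) (b (Suc i))"
      unfolding s(2) using mult_carrier_mat[OF c sD] by simp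
    finally obtain s' where s': "s' \<in> carrier_mat (b (Suc (Suc i))) (b (Suc i))" "D (Suc (Suc i)) * s' = M"
      using resolution_lift[OF R M] by blast
    \<comment> \<open>Each summand has a matrix of the resolution as a factor, so both vanish modulo
      the variables.\<close>
    have Xeq: "E (Suc i) = D (Suc (Suc i)) * s' + s * D (Suc i)"
      unfolding s'(2) M_def using E(1)[of "Suc i"] sD by (intro eq_matI) auto
    have "D (Suc (Suc i)) * E (Suc (Suc i)) = (D (Suc (Suc i)) * s' + s * D (Suc i)) * D (Suc (Suc i))"
      using chain[of "Suc i"] Xeq by simp
    also have "\<dots> = (D (Suc (Suc i)) * s') * D (Suc (Suc i)) + (s * D (Suc i)) * D (Suc (Suc i))"
      by (rule add_mult_distrib_mat[OF mult_carrier_mat[OF c s'(1)] sD c])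
    also have "(s * D (Suc i)) * D (Suc (Suc i)) = s * (D (Suc i) * D (Suc (Suc i)))"
      by (rule assoc_mult_mat[OF s(1) c c])
    also have "\<dots> = 0\<^sub>m (b (Suc i)) (b (Suc (Suc i)))"
      using s(1) by (simp add: resolution_complex[OF R])
    also have "(D (Suc (Suc i)) * s') * D (Suc (Suc i)) = D (Suc (Suc i)) * (s' * D (Suc (Suc i)))"
      by (rule assoc_mult_mat[OF c s'(1) c])
    also have "\<dots> + 0\<^sub>m (b (Suc i)) (b (Suc (Suc i))) = \<dots>"
      by (rule right_add_zero_mat[OF mult_carrier_mat[OF c mult_carrier_mat[OF s'(1) c]]])
    finally have 1: "D (Suc (Suc i)) * E (Suc (Suc i)) = D (Suc (Suc i)) * (s' * D (Suc (Suc i)))" .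
    have "map_mat const_coeff (E (Suc i))
        = map_mat const_coeff (D (Suc (Suc i)) * s') + map_mat const_coeff (s * D (Suc i))"
      unfolding Xeq by (rule map_mat_const_coeff_add[OF mult_carrier_mat[OF c s'(1)] sD])
    also have "\<dots> = 0\<^sub>m (b (Suc i)) (b (Suc i))"
      unfolding const_coeff.mat_hom_mult[OF c s'(1)] const_coeff.mat_hom_mult[OF s(1) c]
        minimal_res_const_coeff[OF R min]
      using s(1) s'(1) by (simp add: map_carrier_mat)
    finally show ?case using s'(1) 1 by blast
  qed
  then show ?thesis by blast
qed

text \<open>With comparison maps in both directions, \<open>g i * f i - 1\<close> belongs to a chain
  map lifting \<open>0\<close> and vanishes modulo the variables. Hence the residue of
  \<open>g i\<close> is a left inverse of that of \<open>f i\<close> over the field, which compares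
  the ranks.\<close>

lemma minimal_resolution_rank_le:
  fixes D D' :: "nat \<Rightarrow> ('v::finite, 'k::field) mpoly mat"
  assumes R: "resolution J b D" "minimal_res b D" and R': "resolution J b' D'"
  shows "b i \<le> b' i"
proof -
  note c = resolution_carrier[OF R(1)] and c' = resolution_carrier[OF R']
  have b0: "b 0 = 1" using R by (simp add: resolution_def)
  obtain f where f: "f 0 = 1\<^sub>m 1" "\<And>i. f i \<in> carrier_mat (b' i) (b i)"
    "\<And>i. D' (Suc i) * f (Suc i) = f i * D (Suc i)"
    using chain_map_exists[OF R(1) R'] by blast
  obtain g where g: "g 0 = 1\<^sub>m 1" "\<And>i. g i \<in> carrier_mat (b i) (b' i)"
    "\<And>i. D (Suc i) * g (Suc i) = g i * D' (Suc i)"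
    using chain_map_exists[OF R' R(1)] by blast
  note gf = mult_carrier_mat[OF g(2) f(2)]
  define E where "E i = g i * f i - 1\<^sub>m (b i)" for i
  have E: "E i \<in> carrier_mat (b i) (b i)" for i
    unfolding E_def by (rule minus_carrier_mat[OF one_carrier_mat])
  have E0: "E 0 = 0\<^sub>m 1 1" by (simp add: E_def f g b0)
  have chain: "D (Suc i) * E (Suc i) = E i * D (Suc i)" for i
  proof -
    have "D (Suc i) * E (Suc i) = D (Suc i) * (g (Suc i) * f (Suc i)) - D (Suc i) * 1\<^sub>m (b (Suc i))"
      unfolding E_def by (rule mult_minus_distrib_mat[OF c gf one_carrier_mat])
    also have "D (Suc i) * (g (Suc i) * f (Suc i)) = (D (Suc i) * g (Suc i)) * f (Suc i)"
      by (rule assoc_mult_mat[OF c g(2) f(2), symmetric])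
    also have "\<dots> = g i * (D' (Suc i) * f (Suc i))"
      unfolding g(3) by (rule assoc_mult_mat[OF g(2) c' f(2)])
    also have "\<dots> = (g i * f i) * D (Suc i)"
      unfolding f(3) by (rule assoc_mult_mat[OF g(2) f(2) c, symmetric])
    also have "D (Suc i) * 1\<^sub>m (b (Suc i)) = 1\<^sub>m (b i) * D (Suc i)"
      using c[of i] by simp
    also have "(g i * f i) * D (Suc i) - \<dots> = E i * D (Suc i)"
      unfolding E_def by (rule minus_mult_distrib_mat[OF gf one_carrier_mat c, symmetric])
    finally show ?thesis .
  qed
  have zero: "map_mat const_coeff (E i) = 0\<^sub>m (b i) (b i)"
    by (rule null_homotopic_const_coeff[OF R E E0 chain])
  have "map_mat const_coeff (g i) * map_mat const_coeff (f i) = map_mat const_coeff (g i * f i)"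
    by (rule const_coeff.mat_hom_mult[OF g(2) f(2), symmetric])
  also have "g i * f i = E i + 1\<^sub>m (b i)"
    unfolding E_def using gf[of i] by (intro eq_matI) auto
  also have "map_mat const_coeff (E i + 1\<^sub>m (b i)) = map_mat const_coeff (E i)
      + map_mat const_coeff (1\<^sub>m (b i) :: ('v, 'k) mpoly mat)"
    by (rule map_mat_const_coeff_add[OF E one_carrier_mat])
  also have "\<dots> = 1\<^sub>m (b i)"
    by (simp add: zero const_coeff.mat_hom_one)
  finally show ?thesis
    using mat_left_inverse_dim_le[of "map_mat const_coeff (g i)" "b i" "b' i" "map_mat const_coeff (f i)"]
      f(2)[of i] g(2)[of i] by simp
qed

text \<open>Two minimal resolutions have equal ranks by \<open>minimal_resolution_rank_le\<close> in
  both directions, so the definite description denotes.\<close>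

lemma betti_eq:
  assumes "minimal_graded_free_resolution J b a D"
  shows "betti J i = b i"
  unfolding betti_def
proof (rule the_equality)
  have R: "resolution J b D" "minimal_res b D"
    using assms by (auto simp: minimal_graded_free_resolution_def graded_free_resolution_resolution)
  show "\<exists>b' a D. minimal_graded_free_resolution J b' a D \<and> b i = b' i" using assms by blast
  fix r assume "\<exists>b a D. minimal_graded_free_resolution J b a D \<and> r = b i"
  then obtain b' a' D' where R': "minimal_graded_free_resolution J b' a' D'" "r = b' i" by blast
  then have "resolution J b' D'" "minimal_res b' D'"
    by (auto simp: minimal_graded_free_resolution_def graded_free_resolution_resolution)
  then show "r = b i"
    using minimal_resolution_rank_le[OF R, of b' D' i] minimal_resolution_rank_le[of J b' D' b D i] R R'(2)
    by simp
qed

section \<open>The Hilbert function of a resolution\<close>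

definition fscale :: "'k \<Rightarrow> (nat \<Rightarrow> ('v::finite, 'k::field) mpoly) \<Rightarrow> nat \<Rightarrow> ('v, 'k) mpoly"
  where "fscale c v = (\<lambda>q. pscale c (v q))"

interpretation fv: vector_space "fscale :: 'k \<Rightarrow> (nat \<Rightarrow> ('v::finite, 'k::field) mpoly) \<Rightarrow> nat \<Rightarrow> ('v, 'k) mpoly"
  by unfold_locales
    (simp_all add: fscale_def fun_eq_iff pv.scale_right_distrib pv.scale_left_distrib)

interpretation fvf: vector_space_pair
  "fscale :: 'k \<Rightarrow> (nat \<Rightarrow> ('v::finite, 'k::field) mpoly) \<Rightarrow> nat \<Rightarrow> ('v, 'k) mpoly"
  "fscale :: 'k \<Rightarrow> (nat \<Rightarrow> ('v::finite, 'k::field) mpoly) \<Rightarrow> nat \<Rightarrow> ('v, 'k) mpoly" ..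

interpretation fvp: vector_space_pair
  "fscale :: 'k \<Rightarrow> (nat \<Rightarrow> ('v::finite, 'k::field) mpoly) \<Rightarrow> nat \<Rightarrow> ('v, 'k) mpoly"
  "pscale :: 'k \<Rightarrow> ('v::finite, 'k::field) mpoly \<Rightarrow> ('v, 'k) mpoly" ..

text \<open>The vectors of rank \<open>b\<close> with all entries in degree \<open>z\<close>. They
  are functions on \<open>nat\<close> padded by \<open>0\<close>, so that modules of different ranks
  lie in one vector space.\<close>

definition free_piece :: "nat \<Rightarrow> int \<Rightarrow> (nat \<Rightarrow> ('v::finite, 'k::field) mpoly) set"
  where "free_piece b z = {v. (\<forall>q<b. v q \<in> homz z) \<and> (\<forall>q\<ge>b. v q = 0)}"

lemma zero_homz [simp]: "0 \<in> homz z"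
  by (simp add: homz_def)

lemma homz_add: "f \<in> homz z \<Longrightarrow> g \<in> homz z \<Longrightarrow> f + g \<in> homz z"
  by (rule pv.subspace_add[OF pv_subspace_homz])

lemma homz_pscale: "f \<in> homz z \<Longrightarrow> pscale c f \<in> homz z"
  by (rule pv.subspace_scale[OF pv_subspace_homz])

lemma fv_subspace_free_piece: "fv.subspace (free_piece b z)"
  by (auto simp: fv.subspace_def free_piece_def fscale_def homz_add homz_pscale)

lemma linear_eval: "Vector_Spaces.linear fscale pscale (\<lambda>v. v b)"
  by (intro Vector_Spaces.linear_iff[THEN iffD2] conjI allI fv.vector_space_axioms pv.vector_space_axioms)
    (simp_all add: fscale_def)

lemma linear_unit: "Vector_Spaces.linear pscale fscale (\<lambda>f q. if q = j then f else 0)"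
  by (intro Vector_Spaces.linear_iff[THEN iffD2] conjI allI fv.vector_space_axioms pv.vector_space_axioms)
    (auto simp: fscale_def fun_eq_iff)

lemma free_piece_finite_span:
  "\<exists>C. finite C \<and> (free_piece b z :: (nat \<Rightarrow> ('v::finite, 'k::field) mpoly) set) \<subseteq> fv.span C"
proof -
  obtain C where C: "finite C" "(homz z :: ('v, 'k) mpoly set) \<subseteq> pv.span C"
    using homz_finite_span by blast
  let ?u = "\<lambda>j (f :: ('v, 'k) mpoly) q. if q = j then f else 0"
  let ?C = "\<Union>j<b. ?u j ` C"
  have "v \<in> fv.span ?C" if v: "v \<in> free_piece b z" for v
  proof -
    have "v = (\<Sum>j<b. ?u j (v j))"
    proof
      fix q
      have "(\<Sum>j<b. ?u j (v j)) q = (\<Sum>j<b. ?u j (v j) q)"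
        by (induction b) auto
      also have "\<dots> = v q" using v by (auto simp: free_piece_def)
      finally show "v q = (\<Sum>j<b. ?u j (v j)) q" by simp
    qed
    also have "\<dots> \<in> fv.span ?C"
    proof (rule fv.span_sum)
      fix j assume j: "j \<in> {..<b}"
      interpret l: Vector_Spaces.linear pscale fscale "?u j" by (rule linear_unit)
      have "?u j (v j) \<in> fv.span (?u j ` C)"
        unfolding l.span_image using v j C by (auto simp: free_piece_def)
      also have "\<dots> \<subseteq> fv.span ?C" using j by (intro fv.span_mono) blast
      finally show "?u j (v j) \<in> fv.span ?C" .
    qed
    finally show ?thesis .
  qed
  then show ?thesis using C(1) by (intro exI[of _ ?C]) auto
qed

text \<open>Evaluation at the last coordinate maps onto \<open>homz z\<close>, with the piece of
  smaller rank as kernel.\<close>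

lemma dim_free_piece:
  "fv.dim (free_piece b z :: (nat \<Rightarrow> ('v::finite, 'k::field) mpoly) set)
    = b * pv.dim (homz z :: ('v, 'k) mpoly set)"
proof (induction b)
  case 0
  have "free_piece 0 z = {0 :: nat \<Rightarrow> ('v, 'k) mpoly}" by (auto simp: free_piece_def fun_eq_iff)
  then show ?case by (simp add: fv.dim_zero_subspace)
next
  case (Suc b)
  obtain C where C: "finite C" "(free_piece (Suc b) z :: (nat \<Rightarrow> ('v, 'k) mpoly) set) \<subseteq> fv.span C"
    using free_piece_finite_span by blast
  have "fv.dim (free_piece (Suc b) z :: (nat \<Rightarrow> ('v, 'k) mpoly) set)
      = fv.dim {v \<in> free_piece (Suc b) z. v b = (0 :: ('v, 'k) mpoly)} + pv.dim ((\<lambda>v. v b) ` (free_piece (Suc b) z :: (nat \<Rightarrow> ('v, 'k) mpoly) set))"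
    by (rule fvp.dim_kernel_image[OF linear_eval fv_subspace_free_piece C(2,1)])
  also have "{v \<in> free_piece (Suc b) z. v b = (0 :: ('v, 'k) mpoly)} = free_piece b z"
  proof (intro subset_antisym subsetI)
    fix v :: "nat \<Rightarrow> ('v, 'k) mpoly" assume "v \<in> {v \<in> free_piece (Suc b) z. v b = 0}"
    then have v: "\<And>q. q < Suc b \<Longrightarrow> v q \<in> homz z" "\<And>q. Suc b \<le> q \<Longrightarrow> v q = 0" "v b = 0"
      by (auto simp: free_piece_def)
    have "v q = 0" if "b \<le> q" for q
      using v(2)[of q] v(3) that by (cases "q = b") auto
    then show "v \<in> free_piece b z" using v(1) by (simp add: free_piece_def)
  next
    fix v :: "nat \<Rightarrow> ('v, 'k) mpoly" assume "v \<in> free_piece b z"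
    then show "v \<in> {v \<in> free_piece (Suc b) z. v b = 0}"
      unfolding free_piece_def by (auto simp: less_Suc_eq)
  qed
  also have "(\<lambda>v. v b) ` (free_piece (Suc b) z :: (nat \<Rightarrow> ('v, 'k) mpoly) set) = homz z"
  proof (intro subset_antisym subsetI)
    fix f :: "('v, 'k) mpoly" assume "f \<in> homz z"
    then have "(\<lambda>q. if q = b then f else 0) \<in> free_piece (Suc b) z" by (auto simp: free_piece_def)
    then show "f \<in> (\<lambda>v. v b) ` (free_piece (Suc b) z :: (nat \<Rightarrow> ('v, 'k) mpoly) set)"
      by (intro image_eqI[of _ _ "\<lambda>q. if q = b then f else 0"]) simp_all
  qed (auto simp: free_piece_def)
  finally show ?case by (simp add: Suc)
qed

definition hcz :: "int \<Rightarrow> ('v::finite, 'k::field) mpoly \<Rightarrow> ('v, 'k) mpoly"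
  where "hcz z f = (if z < 0 then 0 else hcomp (nat z) f)"

lemma hcz_homz [simp]: "hcz z f \<in> homz z"
proof (cases "z < 0")
  case False
  then obtain m where "z = int m" by (metis nonneg_int_cases not_less)
  then show ?thesis by (simp add: hcz_def)
qed (simp add: hcz_def)

lemma hcz_id: "f \<in> homz z \<Longrightarrow> hcz z f = f"
proof (cases "z < 0")
  case False
  then obtain m where "z = int m" by (metis nonneg_int_cases not_less)
  then show "f \<in> homz z \<Longrightarrow> ?thesis" by (simp add: hcz_def hcomp_homogeneous)
qed (simp add: hcz_def homz_neg)

lemma hcz_sum: "hcz z (sum f A) = (\<Sum>a\<in>A. hcz z (f a))"
  by (simp add: hcz_def restrict_keys_sum)

lemma hcz_mult:
  assumes "homogeneous e f"
  shows "hcz z (f * g) = f * hcz (z - int e) g"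
proof (cases "z < 0")
  case False
  then obtain m where "z = int m" by (metis nonneg_int_cases not_less)
  then show ?thesis
    by (auto simp: hcz_def hcomp_homogeneous_mult[OF assms] nat_diff_distrib)
qed (simp add: hcz_def)

lemma homz_sum: "(\<And>a. a \<in> A \<Longrightarrow> f a \<in> homz z) \<Longrightarrow> sum f A \<in> homz z"
  by (rule pv.subspace_sum[OF pv_subspace_homz])

text \<open>The cycles in position \<open>i\<close>; in position \<open>0\<close> the augmentation \<open>S \<rightarrow> S/J\<close> plays the role
  of the differential.\<close>

definition cycles :: "'a::comm_ring_1 set \<Rightarrow> (nat \<Rightarrow> nat) \<Rightarrow> (nat \<Rightarrow> 'a mat) \<Rightarrow> nat \<Rightarrow> (nat \<Rightarrow> 'a) set"
  where "cycles J b D i = (if i = 0 then {v. v 0 \<in> J}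
    else {v. \<forall>p<b (i - 1). (\<Sum>q<b i. D i $$ (p, q) * v q) = 0})"

text \<open>Exactness in one form for all positions, with functions in place of vectors of fixed
  dimension; in position \<open>0\<close> it says that the first row generates
  \<open>J\<close>.\<close>

lemma cycles_iff:
  assumes R: "resolution J b D"
  shows "v \<in> cycles J b D i \<longleftrightarrow> (\<exists>w. \<forall>p<b i. v p = (\<Sum>q<b (Suc i). D (Suc i) $$ (p, q) * w q))"
proof -
  note c = resolution_carrier[OF R]
  have mv: "(D (Suc i) *\<^sub>v w) $ p = (\<Sum>q<b (Suc i). D (Suc i) $$ (p, q) * w $ q)"
    if "p < b i" "w \<in> carrier_vec (b (Suc i))" for p w i
    using that c[of i] by (auto simp: mult_mat_vec_def scalar_prod_def atLeast0LessThan intro!: sum.cong)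
  show ?thesis
  proof (cases i)
    case 0
    have b0: "b 0 = 1" using R by (simp add: resolution_def)
    have "v 0 \<in> J \<longleftrightarrow> (\<exists>w \<in> carrier_vec (b 1). v 0 = (D 1 *\<^sub>v w) $ 0)" by (rule resolution_image[OF R])
    also have "\<dots> \<longleftrightarrow> (\<exists>w. v 0 = (\<Sum>q<b 1. D 1 $$ (0, q) * w q))"
    proof safe
      fix w assume w: "w \<in> carrier_vec (b 1)" "v 0 = (D 1 *\<^sub>v w) $ 0"
      then show "\<exists>w. v 0 = (\<Sum>q<b 1. D 1 $$ (0, q) * w q)"
        using mv[of 0 0 w] b0 by (intro exI[of _ "\<lambda>q. w $ q"]) simp
    next
      fix w assume w: "v 0 = (\<Sum>q<b 1. D 1 $$ (0, q) * w q)"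
      then show "\<exists>w\<in>carrier_vec (b 1). v 0 = (D 1 *\<^sub>v w) $ 0"
        using mv[of 0 0 "vec (b 1) w"] b0 by (intro bexI[of _ "vec (b 1) w"]) simp_all
    qed
    finally show ?thesis using 0 b0 by (simp add: cycles_def)
  next
    case (Suc j)
    let ?v = "vec (b i) v"
    have cyc: "v \<in> cycles J b D i \<longleftrightarrow> D (Suc j) *\<^sub>v ?v = 0\<^sub>v (b j)"
    proof -
      have "D (Suc j) *\<^sub>v ?v = 0\<^sub>v (b j) \<longleftrightarrow> (\<forall>p<b j. (D (Suc j) *\<^sub>v ?v) $ p = 0)"
        using c[of j] by (auto simp: vec_eq_iff)
      also have "\<dots> \<longleftrightarrow> (\<forall>p<b j. (\<Sum>q<b (Suc j). D (Suc j) $$ (p, q) * v q) = 0)"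
        using mv[of _ j ?v] by (simp add: Suc)
      finally show ?thesis by (simp add: cycles_def Suc)
    qed
    also have "\<dots> \<longleftrightarrow> (\<exists>w \<in> carrier_vec (b (Suc i)). ?v = D (Suc i) *\<^sub>v w)"
      using resolution_exact[OF R, of ?v j] by (simp add: Suc)
    also have "\<dots> \<longleftrightarrow> (\<exists>w. \<forall>p<b i. v p = (\<Sum>q<b (Suc i). D (Suc i) $$ (p, q) * w q))"
    proof safe
      fix w assume w: "w \<in> carrier_vec (b (Suc i))" "?v = D (Suc i) *\<^sub>v w"
      have "v p = (\<Sum>q<b (Suc i). D (Suc i) $$ (p, q) * w $ q)" if "p < b i" for p
      proof -
        have "v p = ?v $ p" using that by simp
        then show ?thesis using mv[OF that w(1)] w(2) by simp
      qed
      then show "\<exists>w. \<forall>p<b i. v p = (\<Sum>q<b (Suc i). D (Suc i) $$ (p, q) * w q)"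
        by (intro exI[of _ "\<lambda>q. w $ q"]) blast
    next
      fix w assume w: "\<forall>p<b i. v p = (\<Sum>q<b (Suc i). D (Suc i) $$ (p, q) * w q)"
      have "?v = D (Suc i) *\<^sub>v vec (b (Suc i)) w"
      proof (rule eq_vecI)
        show "dim_vec ?v = dim_vec (D (Suc i) *\<^sub>v vec (b (Suc i)) w)" using c[of i] by simp
        fix p assume "p < dim_vec (D (Suc i) *\<^sub>v vec (b (Suc i)) w)"
        then have "p < b i" using c[of i] by simp
        then show "?v $ p = (D (Suc i) *\<^sub>v vec (b (Suc i)) w) $ p"
          using mv[of p i "vec (b (Suc i)) w"] w by simp
      qed
      then show "\<exists>w\<in>carrier_vec (b (Suc i)). ?v = D (Suc i) *\<^sub>v w"
        by (intro bexI[of _ "vec (b (Suc i)) w"]) simp_all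
    qed
    finally show ?thesis .
  qed
qed

text \<open>A single degree \<open>c i\<close> per module replaces the degrees \<open>a i q\<close>
  of the basis elements; linear resolutions provide it.\<close>

definition shifted_entries :: "(nat \<Rightarrow> nat) \<Rightarrow> (nat \<Rightarrow> int) \<Rightarrow> (nat \<Rightarrow> ('v::finite, 'k::field) mpoly mat) \<Rightarrow> bool"
  where "shifted_entries b c D \<longleftrightarrow> (\<forall>i. \<forall>p<b i. \<forall>q<b (Suc i). D (Suc i) $$ (p, q) \<noteq> 0 \<longrightarrow>
    (\<exists>e. c (Suc i) = c i + int e \<and> homogeneous e (D (Suc i) $$ (p, q))))"

text \<open>Taking degree \<open>z\<close> strands of an exact complex whose \<open>i\<close>-th module is generated in the single
  degree \<open>c i\<close>.\<close>

lemma dim_cycles: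
  fixes D :: "nat \<Rightarrow> ('v::finite, 'k::field) mpoly mat"
  assumes R: "resolution J b D" and sh: "shifted_entries b c D"
  shows "fv.dim (cycles J b D i \<inter> free_piece (b i) (z - c i))
      + fv.dim (cycles J b D (Suc i) \<inter> free_piece (b (Suc i)) (z - c (Suc i)))
    = b (Suc i) * pv.dim (homz (z - c (Suc i)) :: ('v, 'k) mpoly set)"
proof -
  define M where "M v = (\<lambda>p. if p < b i then \<Sum>q<b (Suc i). D (Suc i) $$ (p, q) * v q else 0)" for v
  have lin: "Vector_Spaces.linear fscale fscale M"
  proof (intro Vector_Spaces.linear_iff[THEN iffD2] conjI allI fv.vector_space_axioms)
    fix v w show "M (v + w) = M v + M w"
      by (simp add: M_def fun_eq_iff distrib_left sum.distrib)
  next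
    fix a v show "M (fscale a v) = fscale a (M v)"
      by (simp add: M_def fun_eq_iff fscale_def pscale_def sum_distrib_left mult.left_commute)
  qed
  let ?F = "free_piece (b (Suc i)) (z - c (Suc i)) :: (nat \<Rightarrow> ('v, 'k) mpoly) set"
  \<comment> \<open>A homogeneous entry of degree \<open>c (Suc i) - c i\<close> commutes with
    taking components, up to this shift.\<close>
  have entry: "D (Suc i) $$ (p, q) * hcz (z - c (Suc i)) f = hcz (z - c i) (D (Suc i) $$ (p, q) * f)"
    if pq: "p < b i" "q < b (Suc i)" for p q f
  proof (cases "D (Suc i) $$ (p, q) = 0")
    case True
    then show ?thesis by (simp add: hcz_def)
  next
    case False
    then obtain e where e: "c (Suc i) = c i + int e" "homogeneous e (D (Suc i) $$ (p, q))"
      using sh pq unfolding shifted_entries_def by blast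
    have "z - c (Suc i) = z - c i - int e" using e by simp
    then show ?thesis by (simp only: hcz_mult[OF e(2)])
  qed
  have img: "M ` ?F = cycles J b D i \<inter> free_piece (b i) (z - c i)"
  proof (intro subset_antisym subsetI)
    fix u assume "u \<in> M ` ?F"
    then obtain w where w: "u = M w" "w \<in> ?F" by blast
    have "u \<in> cycles J b D i"
      unfolding cycles_iff[OF R] by (intro exI[of _ w]) (simp add: w(1) M_def)
    moreover have "u p \<in> homz (z - c i)" if p: "p < b i" for p
    proof -
      have "D (Suc i) $$ (p, q) * w q \<in> homz (z - c i)" if q: "q < b (Suc i)" for q
      proof -
        have "hcz (z - c (Suc i)) (w q) = w q"
          using w(2) q by (intro hcz_id) (simp add: free_piece_def)
        then show ?thesis using entry[OF p q, of "w q"] by (metis hcz_homz)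
      qed
      then show ?thesis using p by (auto simp: w(1) M_def intro!: homz_sum)
    qed
    moreover have "u p = 0" if "p \<ge> b i" for p using that by (simp add: w(1) M_def)
    ultimately show "u \<in> cycles J b D i \<inter> free_piece (b i) (z - c i)" by (simp add: free_piece_def)
  next
    fix u assume u: "u \<in> cycles J b D i \<inter> free_piece (b i) (z - c i)"
    then obtain w where w: "\<And>p. p < b i \<Longrightarrow> u p = (\<Sum>q<b (Suc i). D (Suc i) $$ (p, q) * w q)"
      using cycles_iff[OF R, of u i] by blast
    \<comment> \<open>The preimage supplied by exactness need not be homogeneous; its components in
      degree \<open>z - c (Suc i)\<close> form one that is.\<close>
    define w' where "w' q = (if q < b (Suc i) then hcz (z - c (Suc i)) (w q) else 0)" for q
    have "w' \<in> ?F" by (simp add: w'_def free_piece_def)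
    moreover have "u = M w'"
    proof
      fix p
      show "u p = M w' p"
      proof (cases "p < b i")
        case True
        have "M w' p = (\<Sum>q<b (Suc i). D (Suc i) $$ (p, q) * hcz (z - c (Suc i)) (w q))"
          using True by (simp add: M_def w'_def)
        also have "\<dots> = (\<Sum>q<b (Suc i). hcz (z - c i) (D (Suc i) $$ (p, q) * w q))"
          using entry[OF True] by (intro sum.cong) auto
        also have "\<dots> = hcz (z - c i) (u p)" by (simp add: w[OF True] hcz_sum)
        also have "\<dots> = u p" using u True by (intro hcz_id) (simp add: free_piece_def)
        finally show ?thesis by simp
      next
        case False
        then show ?thesis using u by (simp add: free_piece_def M_def)
      qed
    qed
    ultimately show "u \<in> M ` ?F" by blast
  qed
  have ker: "{v \<in> ?F. M v = 0} = cycles J b D (Suc i) \<inter> ?F"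
    by (auto simp: cycles_def M_def fun_eq_iff)
  obtain C where C: "finite C" "?F \<subseteq> fv.span C"
    using free_piece_finite_span by blast
  have "fv.dim ?F = fv.dim {v \<in> ?F. M v = 0} + fv.dim (M ` ?F)"
    by (rule fvf.dim_kernel_image[OF lin fv_subspace_free_piece C(2,1)])
  then show ?thesis unfolding ker img dim_free_piece by simp
qed

lemma dim_cycles_0:
  fixes J :: "('v::finite, 'k::field) mpoly set"
  assumes J: "rmod.subspace J" and b0: "b 0 = 1" and c0: "c 0 = 0"
  shows "fv.dim (cycles J b D 0 \<inter> free_piece (b 0) (z - c 0)) = pv.dim (J \<inter> homz z)"
proof -
  interpret pf: vector_space_pair
    "pscale :: 'k \<Rightarrow> ('v, 'k) mpoly \<Rightarrow> ('v, 'k) mpoly"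
    "fscale :: 'k \<Rightarrow> (nat \<Rightarrow> ('v, 'k) mpoly) \<Rightarrow> nat \<Rightarrow> ('v, 'k) mpoly" ..
  let ?u = "\<lambda>(f :: ('v, 'k) mpoly) q::nat. if q = 0 then f else 0"
  have sub: "pv.subspace (J \<inter> homz z)"
    by (intro pv.subspace_inter pv_subspace_ideal J pv_subspace_homz)
  obtain C where C: "finite C" "(homz z :: ('v, 'k) mpoly set) \<subseteq> pv.span C"
    using homz_finite_span by blast
  have "pv.dim (J \<inter> homz z) = pv.dim {f \<in> J \<inter> homz z. ?u f = 0} + fv.dim (?u ` (J \<inter> homz z))"
    by (rule pf.dim_kernel_image[OF linear_unit sub order.trans[OF Int_lower2 C(2)] C(1)])
  also have "{f \<in> J \<inter> homz z. ?u f = 0} = {0}"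
    using rmod.subspace_0[OF J] by (auto simp: fun_eq_iff)
  also have "?u ` (J \<inter> homz z) = cycles J b D 0 \<inter> free_piece (b 0) (z - c 0)"
  proof (intro subset_antisym subsetI)
    fix v assume "v \<in> ?u ` (J \<inter> homz z)"
    then show "v \<in> cycles J b D 0 \<inter> free_piece (b 0) (z - c 0)"
      by (auto simp: cycles_def free_piece_def b0 c0)
  next
    fix v assume "v \<in> cycles J b D 0 \<inter> free_piece (b 0) (z - c 0)"
    then have "v = ?u (v 0)" "v 0 \<in> J \<inter> homz z"
      by (auto simp: cycles_def free_piece_def b0 c0 fun_eq_iff)
    then show "v \<in> ?u ` (J \<inter> homz z)" by blast
  qed
  finally show ?thesis by (simp add: pv.dim_zero_subspace)
qed

text \<open>By \<open>dim_cycles\<close> each module contributes the cycle dimensions of two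
  neighbouring positions, so the alternating sum telescopes. What remains is the dimension of
  \<open>homz z\<close> minus that of the cycles in position \<open>0\<close>, which are the degree
  \<open>z\<close> part of \<open>J\<close>.\<close>

lemma hilb_resolution:
  fixes D :: "nat \<Rightarrow> ('v::finite, 'k::field) mpoly mat"
  assumes J: "rmod.subspace J" and R: "resolution J b D" and sh: "shifted_entries b c D"
    and c0: "c 0 = 0" and bn: "\<And>i. i > n \<Longrightarrow> b i = 0"
  shows "hilb J z = (\<Sum>i\<le>n. (-1) ^ i * int (b i) * hilb (var_ideal {} :: ('v, 'k) mpoly set) (z - c i))"
proof -
  have b0: "b 0 = 1" using R by (simp add: resolution_def)
  define N where "N w = int (pv.dim (homz w :: ('v, 'k) mpoly set))" for w
  have N: "hilb (var_ideal {} :: ('v, 'k) mpoly set) w = N w" for w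
  proof -
    have "var_ideal {} \<inter> homz w = {0 :: ('v, 'k) mpoly}" by auto
    then show ?thesis by (simp add: hilb_def N_def pv.dim_zero_subspace)
  qed
  define k where "k i = int (fv.dim (cycles J b D i \<inter> free_piece (b i) (z - c i)))" for i
  have step: "int (b (Suc i)) * N (z - c (Suc i)) = k i + k (Suc i)" for i
    using dim_cycles[OF R sh, of i z] unfolding k_def N_def
    by (metis of_nat_add of_nat_mult)
  \<comment> \<open>\<open>k n\<close> and \<open>k (Suc n)\<close> are nonnegative with sum
    \<open>0\<close>, because \<open>b (Suc n) = 0\<close>.\<close>
  have kn: "k (Suc n) = 0"
    using step[of n] bn[of "Suc n"] by (simp add: k_def)
  have kn': "k n = 0" using step[of n] kn bn[of "Suc n"] by simp
  have tele: "(\<Sum>i\<le>m. (-1) ^ i * int (b i) * N (z - c i)) = N z - k 0 + (-1) ^ m * k m" for m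
  proof (induction m)
    case 0
    then show ?case by (simp add: b0 c0)
  next
    case (Suc m)
    have "(\<Sum>i\<le>Suc m. (-1) ^ i * int (b i) * N (z - c i))
        = N z - k 0 + (-1) ^ m * k m + (-1) ^ Suc m * (int (b (Suc m)) * N (z - c (Suc m)))"
      using Suc by (simp add: mult.assoc)
    then show ?case unfolding step by (simp add: distrib_left)
  qed
  have "k 0 = int (pv.dim (J \<inter> homz z))"
    unfolding k_def by (simp only: dim_cycles_0[of J b c D z, OF J b0 c0])
  then have "hilb J z = N z - k 0" by (simp add: hilb_def N_def)
  also have "\<dots> = (\<Sum>i\<le>n. (-1) ^ i * int (b i) * N (z - c i))"
    using tele[of n] kn' by simp
  finally show ?thesis unfolding N .
qed

section \<open>Prime chains, powers and generator degrees\<close>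

lemma poly_ring_simps [simp]:
  "carrier (ring_of_type_algebra :: 'a::comm_ring_1 ring) = UNIV"
  "x \<otimes>\<^bsub>ring_of_type_algebra\<^esub> y = x * (y :: 'a)"
  "x \<oplus>\<^bsub>ring_of_type_algebra\<^esub> y = x + (y :: 'a)"
  "\<one>\<^bsub>ring_of_type_algebra\<^esub> = (1 :: 'a)"
  "\<zero>\<^bsub>ring_of_type_algebra\<^esub> = (0 :: 'a)"
  by (simp_all add: ring_of_type_algebra_def)

lemma ideal_iff_subspace:
  "ideal J ring_of_type_algebra \<longleftrightarrow> rmod.subspace (J :: 'a::comm_ring_1 set)"
proof
  assume "ideal J ring_of_type_algebra"
  then interpret ideal J "ring_of_type_algebra :: 'a ring" .
  show "rmod.subspace J"
    using additive_subgroup.zero_closed[OF additive_subgroup_axioms]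
      additive_subgroup.a_closed[OF additive_subgroup_axioms] I_l_closed
    by (simp add: rmod.subspace_def)
next
  assume J: "rmod.subspace J"
  interpret cring "ring_of_type_algebra :: 'a ring" by (rule cring_from_type_algebra)
  show "ideal J ring_of_type_algebra"
  proof (rule idealI[OF ring_axioms])
    show "subgroup J (add_monoid ring_of_type_algebra)"
    proof (rule add.subgroupI)
      fix a assume a: "a \<in> J"
      have "a \<oplus>\<^bsub>ring_of_type_algebra\<^esub> (- a) = \<zero>\<^bsub>ring_of_type_algebra\<^esub>" by simp
      then have "\<ominus>\<^bsub>ring_of_type_algebra\<^esub> a = - a" by (intro minus_equality) (simp_all add: add.commute)
      then show "\<ominus>\<^bsub>ring_of_type_algebra\<^esub> a \<in> J" using rmod.subspace_neg[OF J a] by simp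
    qed (use J rmod.subspace_0[OF J] rmod.subspace_add[OF J] in auto)
  qed (use rmod.subspace_scale[OF J] in \<open>auto simp: mult.commute\<close>)
qed

lemma genideal_eq_span: "Idl\<^bsub>ring_of_type_algebra\<^esub> G = rmod.span (G :: 'a::comm_ring_1 set)"
proof -
  interpret cring "ring_of_type_algebra :: 'a ring" by (rule cring_from_type_algebra)
  show ?thesis
  proof
    show "Idl\<^bsub>ring_of_type_algebra\<^esub> G \<subseteq> rmod.span G"
      by (rule genideal_minimal) (auto simp: ideal_iff_subspace rmod.span_base)
    show "rmod.span G \<subseteq> Idl\<^bsub>ring_of_type_algebra\<^esub> G"
      using genideal_ideal[of G] genideal_self[of G]
      by (intro rmod.span_minimal) (auto simp: ideal_iff_subspace)
  qed
qed

text \<open>The second claim lets a prime above \<open>I\<close> be recovered from its image in the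
  quotient, so strict inclusions stay strict there.\<close>

lemma primeideal_Quot:
  fixes I P :: "'a::comm_ring_1 set"
  assumes I: "rmod.subspace I" and P: "prime_idl P" and IP: "I \<subseteq> P"
  defines "R \<equiv> (ring_of_type_algebra :: 'a ring)"
  shows "primeideal ((+>\<^bsub>R\<^esub>) I ` P) (R Quot I)"
    and "I +>\<^bsub>R\<^esub> x \<in> (+>\<^bsub>R\<^esub>) I ` P \<longleftrightarrow> x \<in> P"
proof -
  have subP: "rmod.subspace P" using P by (simp add: prime_idl_def)
  interpret cring R unfolding R_def by (rule cring_from_type_algebra)
  have idI: "ideal I R" and idP: "ideal P R" unfolding R_def using I subP by (simp_all add: ideal_iff_subspace)
  have coset: "I +>\<^bsub>R\<^esub> y = {i + y |i. i \<in> I}" for y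
    by (auto simp: a_r_coset_def' R_def)
  have mem: "I +>\<^bsub>R\<^esub> x \<in> (+>\<^bsub>R\<^esub>) I ` P \<longleftrightarrow> x \<in> P" for x
  proof
    assume "I +>\<^bsub>R\<^esub> x \<in> (+>\<^bsub>R\<^esub>) I ` P"
    then obtain p where p: "p \<in> P" "I +>\<^bsub>R\<^esub> x = I +>\<^bsub>R\<^esub> p" by blast
    have "x \<in> I +>\<^bsub>R\<^esub> x" unfolding coset using rmod.subspace_0[OF I] by force
    then have "x \<in> I +>\<^bsub>R\<^esub> p" unfolding p(2) .
    then obtain i where "x = i + p" "i \<in> I" unfolding coset by blast
    then show "x \<in> P" using p IP rmod.subspace_add[OF subP] by blast
  qed simp
  then show "I +>\<^bsub>R\<^esub> x \<in> (+>\<^bsub>R\<^esub>) I ` P \<longleftrightarrow> x \<in> P" .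
  have carr: "carrier (R Quot I) = range ((+>\<^bsub>R\<^esub>) I)"
    unfolding FactRing_def A_RCOSETS_def' by (auto simp: R_def)
  show "primeideal ((+>\<^bsub>R\<^esub>) I ` P) (R Quot I)"
  proof (rule primeidealI)
    show "ideal ((+>\<^bsub>R\<^esub>) I ` P) (R Quot I)"
      using quot_ideal_correspondence[OF idI] idP IP unfolding bij_betw_def by blast
    show "cring (R Quot I)" using ideal.quotient_is_cring[OF idI] is_cring by simp
    obtain y where "y \<notin> P" using P by (auto simp: prime_idl_def)
    then show "carrier (R Quot I) \<noteq> (+>\<^bsub>R\<^esub>) I ` P"
      using mem[of y] unfolding carr by blast
    fix a b assume "a \<in> carrier (R Quot I)" "b \<in> carrier (R Quot I)"
      and ab: "a \<otimes>\<^bsub>R Quot I\<^esub> b \<in> (+>\<^bsub>R\<^esub>) I ` P"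
    then obtain x y where xy: "a = I +>\<^bsub>R\<^esub> x" "b = I +>\<^bsub>R\<^esub> y" unfolding carr by blast
    have "a \<otimes>\<^bsub>R Quot I\<^esub> b = I +>\<^bsub>R\<^esub> (x * y)"
      unfolding xy using ideal.rcoset_mult_add[OF idI, of x y] by (simp add: FactRing_simps R_def)
    then have "x * y \<in> P" using ab mem by simp
    then have "x \<in> P \<or> y \<in> P" using P unfolding prime_idl_def by blast
    then show "a \<in> (+>\<^bsub>R\<^esub>) I ` P \<or> b \<in> (+>\<^bsub>R\<^esub>) I ` P" unfolding xy by blast
  qed
qed

lemma prime_chain_le_dim:
  fixes I :: "('v::finite, 'k::field) mpoly set"
  assumes I: "rmod.subspace I" and ch: "prime_chain l I"
  shows "enat l \<le> dim_ideal I"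
proof -
  let ?R = "poly_ring :: ('v, 'k) mpoly ring"
  obtain P where P: "\<forall>i\<le>l. prime_idl (P i)" "\<forall>i<l. P i \<subset> P (Suc i)" "I \<subseteq> P 0"
    using ch unfolding prime_chain_def by blast
  have IP: "I \<subseteq> P i" if "i \<le> l" for i
    using that
  proof (induction i)
    case (Suc i)
    then have "P i \<subset> P (Suc i)" using P(2) by simp
    then show ?case using Suc by auto
  qed (use P in auto)
  define Q where "Q i = (+>\<^bsub>?R\<^esub>) I ` P i" for i
  have "primeideal (Q i) (?R Quot I)" if "i \<le> l" for i
    unfolding Q_def using primeideal_Quot(1)[OF I _ IP[OF that]] P(1) that by blast
  moreover have "Q i \<subset> Q (Suc i)" if i: "i < l" for i
  proof -
    have PP: "P i \<subset> P (Suc i)" using P(2) i by blast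
    then obtain x where x: "x \<in> P (Suc i)" "x \<notin> P i" by blast
    have "I +>\<^bsub>?R\<^esub> x \<in> Q (Suc i)" unfolding Q_def using x by blast
    moreover have "I +>\<^bsub>?R\<^esub> x \<notin> Q i"
      unfolding Q_def using primeideal_Quot(2)[OF I _ IP[of i], of x] P(1) i x by simp
    moreover have "Q i \<subseteq> Q (Suc i)" unfolding Q_def using PP by blast
    ultimately show ?thesis by blast
  qed
  ultimately have "enat l \<in> {enat l | l. \<exists>Q. (\<forall>i \<le> l. primeideal (Q i) (?R Quot I)) \<and> (\<forall>i < l. Q i \<subset> Q (Suc i))}"
    by blast
  then show ?thesis unfolding dim_ideal_def krull_dim_def by (rule Sup_upper)
qed

section \<open>Powers of ideals and the primes above them\<close>

lemma ideal_pow_0: "ideal_pow J 0 = UNIV"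
  by (simp add: ideal_pow_def ideals_set_def)

lemma ideal_pow_Suc: "ideal_pow J (Suc k) = ideal_prod poly_ring (ideal_pow J k) J"
  by (simp add: ideal_pow_def ideals_set_def)

lemma subspace_ideal_pow:
  fixes J :: "('v::finite, 'k::field) mpoly set"
  assumes "rmod.subspace J"
  shows "rmod.subspace (ideal_pow J k)"
proof -
  interpret cring "poly_ring :: ('v, 'k) mpoly ring" by (rule cring_from_type_algebra)
  show ?thesis
  proof (induction k)
    case 0
    then show ?case by (simp add: ideal_pow_0)
  next
    case (Suc k)
    then show ?case
      using ideal_prod_is_ideal[of "ideal_pow J k" J] assms by (simp add: ideal_pow_Suc ideal_iff_subspace)
  qed
qed

lemma ideal_pow_1:
  fixes J :: "('v::finite, 'k::field) mpoly set"
  assumes "rmod.subspace J"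
  shows "ideal_pow J 1 = J"
proof -
  interpret cring "poly_ring :: ('v, 'k) mpoly ring" by (rule cring_from_type_algebra)
  show ?thesis
    using ideal_prod_one[of J] ideal_prod_commute[of UNIV J] assms rmod.subspace_UNIV
    by (simp add: ideal_pow_Suc ideal_pow_0 ideal_iff_subspace)
qed

lemma power_mem_ideal_pow: "f \<in> J \<Longrightarrow> f ^ k \<in> ideal_pow J k"
proof (induction k)
  case (Suc k)
  then have "f ^ k \<otimes>\<^bsub>poly_ring\<^esub> f \<in> ideal_prod poly_ring (ideal_pow J k) J"
    by (intro ideal_prod.prod) auto
  then show ?case by (simp add: ideal_pow_Suc mult.commute)
qed (simp add: ideal_pow_0)

lemma prime_idl_power:
  assumes "prime_idl P" "f ^ k \<in> P"
  shows "f \<in> P"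
  using assms(2)
proof (induction k)
  case 0
  then have "g \<in> P" for g using rmod.subspace_scale[of P 1 g] assms(1) by (simp add: prime_idl_def)
  then show ?case .
next
  case (Suc k)
  then show ?case using assms(1) by (auto simp: prime_idl_def)
qed

text \<open>A prime containing \<open>f^k\<close> contains \<open>f\<close>, so the lowest prime of
  the chain already contains \<open>J\<close>.\<close>

lemma prime_chain_ideal_pow:
  assumes "prime_chain l (ideal_pow J k)"
  shows "prime_chain l J"
proof -
  obtain P where P: "\<forall>i\<le>l. prime_idl (P i)" "\<forall>i<l. P i \<subset> P (Suc i)" "ideal_pow J k \<subseteq> P 0"
    using assms unfolding prime_chain_def by blast
  have "J \<subseteq> P 0" using prime_idl_power[of "P 0"] P power_mem_ideal_pow[of _ J k] by blast
  then show ?thesis using P unfolding prime_chain_def by blast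
qed

text \<open>This form of generation in one degree passes to products and powers, which a condition
  on all minimal generating sets does not do visibly.\<close>

definition gen_degree :: "nat \<Rightarrow> ('v::finite, 'k::field) mpoly set \<Rightarrow> bool"
  where "gen_degree e J \<longleftrightarrow> J = rmod.span {f \<in> J. homogeneous e f}"

lemma gen_degreeI:
  assumes "rmod.subspace J" "J \<subseteq> rmod.span {f \<in> J. homogeneous e f}"
  shows "gen_degree e J"
  unfolding gen_degree_def using assms rmod.span_minimal[of "{f \<in> J. homogeneous e f}" J] by blast

lemma gen_degree_ideal_prod:
  fixes A B :: "('v::finite, 'k::field) mpoly set"
  assumes A: "rmod.subspace A" "gen_degree a A" and B: "rmod.subspace B" "gen_degree b B"
  shows "gen_degree (a + b) (ideal_prod poly_ring A B)"
proof -
  interpret cring "poly_ring :: ('v, 'k) mpoly ring" by (rule cring_from_type_algebra)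
  let ?C = "ideal_prod poly_ring A B"
  have sub: "rmod.subspace ?C"
    using ideal_prod_is_ideal[of A B] A B by (simp add: ideal_iff_subspace)
  let ?H = "{f \<in> ?C. homogeneous (a + b) f}"
  have 1: "f * g \<in> rmod.span ?H" if f: "f \<in> A" "homogeneous a f" and g: "g \<in> B" for f g
  proof -
    have "g \<in> rmod.span {g \<in> B. homogeneous b g}" using g B(2) unfolding gen_degree_def by blast
    then show ?thesis
    proof (induction rule: rmod.span_induct_alt)
      case base
      then show ?case by (simp add: rmod.span_zero)
    next
      case (step c x y)
      have "f * x \<in> ?H"
        using ideal_prod.prod[of f A x B poly_ring] f step(1) homogeneous_mult by auto
      then have "c * (f * x) \<in> rmod.span ?H" by (rule rmod.span_scale[OF rmod.span_base])
      moreover have "f * (c * x + y) = c * (f * x) + f * y" by (simp add: algebra_simps)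
      ultimately show ?case using step(2) by (simp only: rmod.span_add)
    qed
  qed
  have 2: "f * g \<in> rmod.span ?H" if f: "f \<in> A" and g: "g \<in> B" for f g
  proof -
    have "f \<in> rmod.span {f \<in> A. homogeneous a f}" using f A(2) unfolding gen_degree_def by blast
    then show ?thesis
    proof (induction rule: rmod.span_induct_alt)
      case base
      then show ?case by (simp add: rmod.span_zero)
    next
      case (step c x y)
      have "x * g \<in> rmod.span ?H" using 1[of x g] step(1) g by simp
      then have "c * (x * g) \<in> rmod.span ?H" by (rule rmod.span_scale)
      moreover have "(c * x + y) * g = c * (x * g) + y * g" by (simp add: algebra_simps)
      ultimately show ?case using step(2) by (simp only: rmod.span_add)
    qed
  qed
  show ?thesis
  proof (rule gen_degreeI[OF sub], rule subsetI)
    fix h assume "h \<in> ?C"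
    then show "h \<in> rmod.span ?H"
    proof induction
      case (prod i j)
      then show ?case using 2 by simp
    next
      case (sum s1 s2)
      then show ?case by (simp add: rmod.span_add)
    qed
  qed
qed

lemma gen_degree_ideal_pow:
  assumes J: "rmod.subspace J" "gen_degree d J"
  shows "gen_degree (d * k) (ideal_pow J k)"
proof (induction k)
  case 0
  have "homogeneous 0 (1 :: ('a, 'b) mpoly)" by (simp add: homogeneous_def)
  then have "1 \<in> rmod.span {f :: ('a, 'b) mpoly. homogeneous 0 f}" by (intro rmod.span_base) simp
  then have "f \<in> rmod.span {f :: ('a, 'b) mpoly. homogeneous 0 f}" for f
    using rmod.span_scale[of 1 "{f. homogeneous 0 f}" f] by simp
  then show ?case by (auto simp: gen_degree_def ideal_pow_0)
next
  case (Suc k)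
  then show ?case
    using gen_degree_ideal_prod[OF subspace_ideal_pow[OF J(1)] Suc J] by (simp add: ideal_pow_Suc add.commute)
qed

lemma gen_degree_graded:
  assumes "rmod.subspace J" "gen_degree e J"
  shows "graded_ideal J"
proof (rule graded_idealI_homogeneous[OF assms(1)])
  fix f assume "f \<in> J"
  then have "f \<in> rmod.span {f \<in> J. homogeneous e f}" using assms(2) unfolding gen_degree_def by blast
  also have "\<dots> \<subseteq> rmod.span {g \<in> J. \<exists>e. homogeneous e g}" by (rule rmod.span_mono) blast
  finally show "f \<in> rmod.span {g \<in> J. \<exists>e. homogeneous e g}" .
qed

lemma gen_degree_hcomp_less:
  assumes "gen_degree e J" "f \<in> J" "j < e"
  shows "hcomp j f = 0"
proof -
  have "f \<in> rmod.span {f \<in> J. homogeneous e f}" using assms(1,2) unfolding gen_degree_def by blast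
  then show ?thesis
  proof (induction rule: rmod.span_induct_alt)
    case (step c x y)
    have "hcomp j (x * c) = 0" using hcomp_homogeneous_mult[of e x j c] step(1) assms(3) by simp
    then show ?case using step(2) by (simp add: restrict_keys_add mult.commute)
  qed simp
qed

section \<open>The first matrix and the degrees of generators\<close>

lemma first_matrix_mem:
  assumes R: "resolution J b D"
  shows "f \<in> J \<longleftrightarrow> (\<exists>w. f = (\<Sum>q<b 1. D 1 $$ (0, q) * w q))"
  using cycles_iff[OF R, of "\<lambda>_. f" 0] R by (simp add: cycles_def resolution_def)

lemma first_matrix_entry:
  assumes R: "resolution J b D" and q: "q < b 1"
  shows "D 1 $$ (0, q) \<in> J"
proof -
  have "D 1 $$ (0, q) = (\<Sum>r<b 1. D 1 $$ (0, r) * (if r = q then 1 else 0))"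
    using q by (simp add: if_distrib cong: if_cong)
  then show ?thesis
    unfolding first_matrix_mem[OF R] by (rule exI[of _ "\<lambda>r. if r = q then 1 else 0"])
qed

lemma first_matrix_homogeneous:
  assumes G: "graded_free_resolution J b a D" and q: "q < b 1"
  shows "\<exists>e. homogeneous e (D 1 $$ (0, q))"
proof (cases "D 1 $$ (0, q) = 0")
  case True
  then show ?thesis by simp
next
  case False
  have "\<forall>i \<ge> 1. \<forall>p < b (i - 1). \<forall>q < b i. D i $$ (p, q) \<noteq> 0 \<longrightarrow>
       (\<exists>e. a i q = a (i - 1) p + int e \<and> homogeneous e (D i $$ (p, q)))" "b 0 = 1"
    using G unfolding graded_free_resolution_def by blast+
  from this(1)[rule_format, of 1 0 q] this(2) False q show ?thesis by auto
qed

text \<open>\<open>generated_in_degree\<close> speaks about minimal generating sets, so one has to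
  be exhibited: the entries of the first matrix are finitely many homogeneous generators, and a
  generating subset of least cardinality is minimal.\<close>

lemma gen_degree_of_resolution:
  fixes J :: "('v::finite, 'k::field) mpoly set"
  assumes G: "graded_free_resolution J b a D" and d: "generated_in_degree d J"
  shows "gen_degree d J"
proof -
  note R = graded_free_resolution_resolution[OF G]
  let ?F = "(\<lambda>q. D 1 $$ (0, q)) ` {..<b 1}"
  have "J = rmod.span ?F"
  proof (intro subset_antisym subsetI)
    fix f assume "f \<in> J"
    then obtain w where f: "f = (\<Sum>q<b 1. w q * D 1 $$ (0, q))"
      using first_matrix_mem[OF R, of f] by (auto simp: mult.commute)
    show "f \<in> rmod.span ?F"
      unfolding f by (intro rmod.span_sum rmod.span_scale rmod.span_base) auto
  next
    fix f assume "f \<in> rmod.span ?F"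
    then show "f \<in> J"
    proof (induction rule: rmod.span_induct_alt)
      case base
      show ?case unfolding first_matrix_mem[OF R] by (intro exI[of _ "\<lambda>_. 0"]) simp
    next
      case (step c x y)
      then obtain q w where q: "q < b 1" "x = D 1 $$ (0, q)" and w: "y = (\<Sum>r<b 1. D 1 $$ (0, r) * w r)"
        using first_matrix_mem[OF R, of y] by blast
      have "c * x = (\<Sum>r<b 1. D 1 $$ (0, r) * (if r = q then c else 0))"
        using q by (simp add: if_distrib mult.commute cong: if_cong)
      then have "c * x + y = (\<Sum>r<b 1. D 1 $$ (0, r) * ((if r = q then c else 0) + w r))"
        by (simp add: w sum.distrib distrib_left)
      then show ?case
        unfolding first_matrix_mem[OF R] by (rule exI[of _ "\<lambda>r. (if r = q then c else 0) + w r"])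
    qed
  qed
  then have "?F \<subseteq> ?F \<and> rmod.span ?F = J" by simp
  from ex_has_least_nat[of "\<lambda>H. H \<subseteq> ?F \<and> rmod.span H = J", OF this, of card]
  obtain H where H': "(H \<subseteq> ?F \<and> rmod.span H = J) \<and>
      (\<forall>H'. H' \<subseteq> ?F \<and> rmod.span H' = J \<longrightarrow> card H \<le> card H')" ..
  then have H: "H \<subseteq> ?F" "rmod.span H = J"
    "\<And>H'. H' \<subseteq> ?F \<Longrightarrow> rmod.span H' = J \<Longrightarrow> card H \<le> card H'"
    by simp_all
  have finH: "finite H" using H(1) by (rule finite_subset) simp
  have "minimal_homogeneous_generators H J"
    unfolding minimal_homogeneous_generators_def homogeneous_generators_def genideal_eq_span
  proof (intro conjI ballI allI impI)
    fix g assume "g \<in> H"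
    then obtain q where "q < b 1" "g = D 1 $$ (0, q)" using H(1) by blast
    then show "\<exists>e. homogeneous e g" using first_matrix_homogeneous[OF G] by blast
  next
    show "rmod.span H = J" by (rule H)
    fix H' assume H': "H' \<subset> H"
    show "rmod.span H' \<noteq> J"
      using H(3)[of H'] H' H(1) psubset_card_mono[OF finH H'] by auto
  qed
  then have "\<forall>g\<in>H. homogeneous d g" using d unfolding generated_in_degree_def by blast
  then have "H \<subseteq> {f \<in> J. homogeneous d f}" using H(2) rmod.span_base by blast
  then have "J \<subseteq> rmod.span {f \<in> J. homogeneous d f}" using H(2) rmod.span_mono by blast
  moreover have "rmod.subspace J" using H(2) rmod.subspace_span by blast
  ultimately show ?thesis by (intro gen_degreeI)
qed

text \<open>A column of the first matrix in a degree above \<open>e\<close> would be a combination of the columns in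
  degree \<open>e\<close>, giving a first syzygy with an entry \<open>1\<close>.\<close>

lemma minimal_first_matrix_degree:
  fixes J :: "('v::finite, 'k::field) mpoly set"
  assumes M: "minimal_graded_free_resolution J b a D" and J: "gen_degree e J" and q: "q < b 1"
  shows "homogeneous e (D 1 $$ (0, q))"
proof (rule ccontr)
  assume nq: "\<not> homogeneous e (D 1 $$ (0, q))"
  have G: "graded_free_resolution J b a D" and min: "minimal_res b D"
    using M unfolding minimal_graded_free_resolution_def by blast+
  note R = graded_free_resolution_resolution[OF G]
  have b0: "b 0 = 1" using R by (simp add: resolution_def)
  let ?f = "\<lambda>p. D 1 $$ (0, p)"
  define Pe where "Pe = {p. p < b 1 \<and> homogeneous e (?f p)}"
  \<comment> \<open>The ideal generated by the entries of degree \<open>e\<close>. It contains every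
    element of \<open>J\<close> of degree \<open>e\<close>, hence all of \<open>J\<close>.\<close>
  define V where "V = {\<Sum>p\<in>Pe. ?f p * h p |h. True}"
  have V: "rmod.subspace V"
    unfolding rmod.subspace_def V_def
  proof (intro conjI ballI allI)
    show "0 \<in> {\<Sum>p\<in>Pe. ?f p * h p |h. True}"
      by (intro CollectI exI[of _ "\<lambda>_. 0"]) simp
  next
    fix x y assume "x \<in> {\<Sum>p\<in>Pe. ?f p * h p |h. True}" "y \<in> {\<Sum>p\<in>Pe. ?f p * h p |h. True}"
    then obtain h h' where "x = (\<Sum>p\<in>Pe. ?f p * h p)" "y = (\<Sum>p\<in>Pe. ?f p * h' p)" by blast
    then have "x + y = (\<Sum>p\<in>Pe. ?f p * (h p + h' p))" by (simp add: distrib_left sum.distrib)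
    then show "x + y \<in> {\<Sum>p\<in>Pe. ?f p * h p |h. True}"
      by (intro CollectI exI[of _ "\<lambda>p. h p + h' p"]) simp
  next
    fix c x assume "x \<in> {\<Sum>p\<in>Pe. ?f p * h p |h. True}"
    then obtain h where "x = (\<Sum>p\<in>Pe. ?f p * h p)" by blast
    then have "c * x = (\<Sum>p\<in>Pe. ?f p * (c * h p))" by (simp add: sum_distrib_left mult.left_commute)
    then show "c * x \<in> {\<Sum>p\<in>Pe. ?f p * h p |h. True}"
      by (intro CollectI exI[of _ "\<lambda>p. c * h p"]) simp
  qed
  have "g \<in> V" if g: "g \<in> J" "homogeneous e g" for g
  proof -
    obtain w where w: "g = (\<Sum>p<b 1. ?f p * w p)" using g(1) first_matrix_mem[OF R] by blast
    have "g = hcomp e g" using g(2) by (simp add: hcomp_homogeneous)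
    also have "\<dots> = (\<Sum>p<b 1. hcomp e (?f p * w p))"
      unfolding w by (rule restrict_keys_sum)
    also have "\<dots> = (\<Sum>p<b 1. if p \<in> Pe then ?f p * hcomp 0 (w p) else 0)"
    proof (rule sum.cong[OF refl])
      fix p assume p: "p \<in> {..<b 1}"
      show "hcomp e (?f p * w p) = (if p \<in> Pe then ?f p * hcomp 0 (w p) else 0)"
      proof (cases "p \<in> Pe")
        case True
        then show ?thesis using hcomp_homogeneous_mult[of e "?f p" e "w p"] by (simp add: Pe_def)
      next
        case False
        obtain j where j: "homogeneous j (?f p)" using first_matrix_homogeneous[OF G] p by blast
        have "?f p \<noteq> 0" "j \<noteq> e" using False p j by (auto simp: Pe_def)
        \<comment> \<open>A nonzero element of \<open>J\<close> has no component below degree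
          \<open>e\<close>, so this entry has degree above \<open>e\<close> and its multiples have
          no component in degree \<open>e\<close>.\<close>
        moreover have "\<not> j < e"
          using gen_degree_hcomp_less[OF J first_matrix_entry[OF R, of p], of j] p j \<open>?f p \<noteq> 0\<close>
          by (auto simp: hcomp_homogeneous)
        ultimately show ?thesis using False hcomp_homogeneous_mult[OF j, of e "w p"] by simp
      qed
    qed
    also have "\<dots> = (\<Sum>p\<in>Pe. ?f p * hcomp 0 (w p))"
      by (rule sum.mono_neutral_cong_right) (auto simp: Pe_def)
    finally show ?thesis
      unfolding V_def by (intro CollectI exI[of _ "\<lambda>p. hcomp 0 (w p)"] conjI TrueI)
  qed
  then have "rmod.span {g \<in> J. homogeneous e g} \<subseteq> V" by (intro rmod.span_minimal V) blast
  then have "?f q \<in> V" using first_matrix_entry[OF R q] J unfolding gen_degree_def by blast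
  then obtain h where h: "?f q = (\<Sum>p\<in>Pe. ?f p * h p)" unfolding V_def by blast
  \<comment> \<open>The syzygy behind \<open>h\<close>. As \<open>q\<close> is not in
    \<open>Pe\<close>, its entry at \<open>q\<close> is the constant \<open>1\<close>; exactness
    writes this entry as a combination of entries of \<open>D 2\<close>, whose constant coefficients
    vanish.\<close>
  define v where "v p = (if p = q then 1 else if p \<in> Pe then - h p else 0)" for p
  have "(\<Sum>p<b 1. ?f p * v p) = ?f q + (\<Sum>p\<in>{..<b 1} - {q}. ?f p * v p)"
    using q by (subst sum.remove[of _ q]) (auto simp: v_def)
  also have "(\<Sum>p\<in>{..<b 1} - {q}. ?f p * v p) = (\<Sum>p\<in>Pe. ?f p * (- h p))"
    using nq by (intro sum.mono_neutral_cong_right) (auto simp: Pe_def v_def)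
  finally have "(\<Sum>p<b 1. ?f p * v p) = 0"
    by (simp add: sum_negf flip: h del: One_nat_def)
  then have "v \<in> cycles J b D 1" by (simp add: cycles_def b0)
  then obtain w where "v q = (\<Sum>r<b 2. D 2 $$ (q, r) * w r)"
    using cycles_iff[OF R, of v 1] q by (auto simp: numeral_2_eq_2)
  then have "const_coeff (v q) = (\<Sum>r<b 2. const_coeff (D 2 $$ (q, r)) * const_coeff (w r))"
    by (simp add: const_coeff.hom_sum const_coeff.hom_mult)
  also have "\<dots> = 0"
  proof (rule sum.neutral, rule ballI)
    fix r assume "r \<in> {..<b 2}"
    then have "Poly_Mapping.lookup (D 2 $$ (q, r)) 0 = 0"
      using min[rule_format, of 2 q r] q by simp
    then show "const_coeff (D 2 $$ (q, r)) * const_coeff (w r) = 0" by (simp add: const_coeff_def)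
  qed
  finally show False by (simp add: v_def)
qed

section \<open>Binomial formulas from the numerator of the Hilbert series\<close>

text \<open>Split off the full power of \<open>[:- 1, 1:]\<close> from \<open>K\<close>. If its
  exponent were below \<open>m\<close>, the cofactor \<open>L\<close> would still be bounded by a
  multiple of a positive power of \<open>1 - t\<close>, and the limit from the left would give
  \<open>L\<close> a root at \<open>1\<close>.\<close>

lemma linear_power_dvd_of_bound:
  fixes K :: "real poly"
  assumes bound: "\<And>t. 0 < t \<Longrightarrow> t < 1 \<Longrightarrow> \<bar>poly K t\<bar> \<le> C * (1 - t) ^ m"
  shows "[:- 1, 1:] ^ m dvd K"
proof (cases "K = 0")
  case False
  obtain L where L: "K = [:- 1, 1:] ^ order 1 K * L" "\<not> [:- 1, 1:] dvd L"
    using order_decomp[OF False, of 1] by blast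
  have "m \<le> order 1 K"
  proof (rule ccontr)
    assume "\<not> m \<le> order 1 K"
    then obtain s where s: "m = order 1 K + Suc s" by (metis less_imp_Suc_add not_le add_Suc_right)
    have Lb: "\<bar>poly L t\<bar> \<le> C * (1 - t) ^ Suc s" if t: "0 < t" "t < 1" for t
    proof -
      have "poly K t = (t - 1) ^ order 1 K * poly L t"
        by (subst L(1)) (simp add: poly_power)
      then have "(1 - t) ^ order 1 K * \<bar>poly L t\<bar> = \<bar>poly K t\<bar>"
        using t by (simp add: abs_mult power_abs)
      also have "\<dots> \<le> C * (1 - t) ^ m" by (rule bound[OF t])
      also have "\<dots> = (1 - t) ^ order 1 K * (C * (1 - t) ^ Suc s)" by (simp add: s power_add)
      finally show ?thesis using t by (subst (asm) mult_le_cancel_left_pos) simp_all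
    qed
    have "\<bar>poly L 1\<bar> \<le> 0"
    proof (rule tendsto_le[of "at_left (1::real)"])
      show "((\<lambda>t. C * (1 - t) ^ Suc s) \<longlongrightarrow> 0) (at_left 1)"
        by (rule tendsto_eq_intros refl | simp)+
      show "((\<lambda>t. \<bar>poly L t\<bar>) \<longlongrightarrow> \<bar>poly L 1\<bar>) (at_left 1)"
        by (intro tendsto_intros)
      show "\<forall>\<^sub>F t in at_left 1. \<bar>poly L t\<bar> \<le> C * (1 - t) ^ Suc s"
        unfolding eventually_at_left_field by (intro exI[of _ 0]) (simp add: Lb del: power_Suc)
    qed simp
    then show False using L(2) by (simp add: poly_eq_0_iff_dvd)
  qed
  then show ?thesis using L(1) by (metis dvd_mult2 le_imp_power_dvd)
qed simp

text \<open>The negative binomial series; multiplication by \<open>1 - fps_X\<close> lowers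
  \<open>e\<close> by Pascal's rule.\<close>

lemma fps_one_minus_X_power_inverse:
  "(1 - fps_X) ^ Suc e * Abs_fps (\<lambda>i. of_nat ((e + i) choose i)) = (1 :: 'a::field_char_0 fps)"
proof (induction e)
  case 0
  have "(1 - fps_X) * Abs_fps (\<lambda>i. 1) = (1 :: 'a fps)"
  proof (rule fps_ext)
    fix i show "((1 - fps_X) * Abs_fps (\<lambda>i. 1)) $ i = (1 :: 'a fps) $ i"
      by (cases i) (simp_all add: left_diff_distrib)
  qed
  then show ?case by simp
next
  case (Suc e)
  have "(1 - fps_X) * Abs_fps (\<lambda>i. of_nat ((Suc e + i) choose i))
      = (Abs_fps (\<lambda>i. of_nat ((e + i) choose i)) :: 'a fps)"
  proof (rule fps_ext)
    fix i show "((1 - fps_X) * Abs_fps (\<lambda>i. of_nat ((Suc e + i) choose i))) $ i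
        = (Abs_fps (\<lambda>i. of_nat ((e + i) choose i)) :: 'a fps) $ i"
      by (cases i) (simp_all add: left_diff_distrib)
  qed
  then have eq: "(1 - fps_X) ^ Suc (Suc e) * Abs_fps (\<lambda>i. of_nat ((Suc e + i) choose i))
      = (1 - fps_X) ^ Suc e * (Abs_fps (\<lambda>i. of_nat ((e + i) choose i)) :: 'a fps)"
    by (subst power_Suc2) (simp only: mult.assoc)
  show ?case by (simp only: eq Suc.IH)
qed

lemma pcompose_power: "pcompose (p ^ k) q = pcompose p q ^ k" for p :: "'a::comm_semiring_1 poly"
  by (induction k) (simp_all add: pcompose_mult pcompose_1)

text \<open>After the substitution \<open>t = 1 - u\<close> the hypothesis says
  \<open>R (1 - u) = B / (1 - u) - 1 / (1 - u) ^ (e + 1)\<close> modulo \<open>u ^ m\<close>.\<close>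

lemma coeff_pcompose_of_dvd:
  fixes R :: "real poly"
  assumes dvd: "[:- 1, 1:] ^ m dvd 1 - monom B e + monom 1 (Suc e) * R" and i: "i < m"
  shows "coeff (pcompose R [:1, - 1:]) i = B - of_nat ((e + i) choose i)"
proof -
  let ?s = "[:1, - 1 :: real:]" and ?u = "1 - fps_X :: real fps"
  obtain L where L: "1 - monom B e + monom 1 (Suc e) * R = [:- 1, 1:] ^ m * L"
    using dvd by (elim dvdE)
  have mon: "pcompose (monom a k) ?s = smult a (?s ^ k)" for a k
    by (simp add: monom_altdef pcompose_smult pcompose_power pcompose_pCons)
  define S where "S = pcompose R ?s"
  have "1 - smult B (?s ^ e) + ?s ^ Suc e * S = pcompose (1 - monom B e + monom 1 (Suc e) * R) ?s"
    by (simp add: pcompose_add pcompose_diff pcompose_mult mon S_def pcompose_1)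
  also have "\<dots> = [:0, - 1:] ^ m * pcompose L ?s"
    unfolding L by (simp add: pcompose_mult pcompose_power pcompose_pCons)
  finally have "fps_of_poly (1 - smult B (?s ^ e) + ?s ^ Suc e * S)
      = fps_of_poly ([:0, - 1:] ^ m * pcompose L ?s)"
    by (rule arg_cong)
  moreover have "fps_of_poly ?s = ?u" "fps_of_poly [:0, - 1 :: real:] = - fps_X"
    by (simp_all add: fps_of_poly_pCons)
  ultimately have main: "1 - fps_const B * ?u ^ e + ?u ^ Suc e * fps_of_poly S
      = (- fps_X) ^ m * fps_of_poly (pcompose L ?s)"
    by (simp only: fps_of_poly_add fps_of_poly_diff fps_of_poly_mult fps_of_poly_power fps_of_poly_smult
        fps_of_poly_1)
  define A :: "real fps" where "A = Abs_fps (\<lambda>i. of_nat ((e + i) choose i))"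
  define ones :: "real fps" where "ones = Abs_fps (\<lambda>i. 1)"
  have A: "?u ^ Suc e * A = 1" unfolding A_def by (rule fps_one_minus_X_power_inverse)
  have ones: "?u * ones = 1" using fps_one_minus_X_power_inverse[of 0, where 'a = real] by (simp add: ones_def)
  have "?u ^ e * A = ones"
  proof -
    have "?u ^ e * A = ?u ^ e * A * (?u * ones)" by (simp only: ones mult_1_right)
    also have "\<dots> = (?u ^ Suc e * A) * ones" by (simp add: mult_ac)
    also have "\<dots> = ones" by (simp only: A mult_1_left)
    finally show ?thesis .
  qed
  \<comment> \<open>Multiplication by \<open>A\<close>, the inverse of \<open>?u ^ Suc e\<close>,
    isolates \<open>S\<close>. The right side of \<open>main\<close> keeps its factor
    \<open>fps_X ^ m\<close>, so it does not reach the coefficients below \<open>m\<close>.\<close>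
  moreover have "(1 - fps_const B * ?u ^ e + ?u ^ Suc e * fps_of_poly S) * A
      = A - fps_const B * (?u ^ e * A) + (?u ^ Suc e * A) * fps_of_poly S"
    by (simp add: algebra_simps)
  ultimately have eq: "fps_of_poly S = fps_const B * ones - A + (- fps_X) ^ m * fps_of_poly (pcompose L ?s) * A"
    unfolding main A by (simp add: algebra_simps)
  have "((- fps_X) ^ m * fps_of_poly (pcompose L ?s) * A) $ i = 0"
  proof -
    have "(- fps_X) ^ m * fps_of_poly (pcompose L ?s) * A
        = fps_X ^ m * ((- 1) ^ m * fps_of_poly (pcompose L ?s) * A)"
      by (subst power_minus) (simp add: mult_ac)
    then show ?thesis using i by (simp only: fps_X_power_mult_nth) simp
  qed
  moreover have "coeff S i = fps_of_poly S $ i" by simp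
  ultimately show ?thesis unfolding S_def[symmetric] by (simp add: eq ones_def A_def)
qed

lemma coeff_one_minus_power: "coeff ([:1, - 1:] ^ j) i = of_nat (j choose i) * (- 1 :: real) ^ i"
proof (induction j arbitrary: i)
  case 0
  then show ?case by (cases i) auto
next
  case (Suc j)
  then show ?case by (cases i) (auto simp: coeff_pCons algebra_simps split: nat.splits)
qed

text \<open>\<open>r\<close> lists the coefficients of \<open>R(1 - u)\<close>; substituting once
  more gives back \<open>R\<close>. The signs in \<open>R\<close> cancel those in the expansion of
  \<open>(1 - u)^j\<close>, which leaves plain binomials.\<close>

lemma linear_betti_binomial:
  fixes b :: "nat \<Rightarrow> nat" and n :: nat
  defines "R \<equiv> (\<Sum>i\<le>n. monom ((- 1) ^ i * real (b (i + 2))) i)"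
  assumes dvd: "[:- 1, 1:] ^ m dvd 1 - monom (real (b 1)) e + monom 1 (Suc e) * R"
  obtains r where "\<And>i. i < m \<Longrightarrow> r i = int (b 1) - int ((e + i) choose i)" "r n = int (b (n + 2))"
    "\<And>i. i \<le> n \<Longrightarrow> int (b (i + 2)) = (\<Sum>j\<le>n. int (j choose i) * r j)"
proof -
  define S where "S = pcompose R [:1, - 1:]"
  have Rc: "coeff R i = (if i \<le> n then (- 1) ^ i * real (b (i + 2)) else 0)" for i
    by (simp add: R_def coeff_sum)
  have "pcompose R [:1, - 1:] = (\<Sum>j\<le>n. smult ((- 1) ^ j * real (b (j + 2))) ([:1, - 1:] ^ j))"
    unfolding R_def
    by (simp add: pcompose_sum monom_altdef pcompose_smult pcompose_power pcompose_pCons)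
  then have Sc: "coeff S i = (\<Sum>j\<le>n. (- 1) ^ j * real (b (j + 2)) * (real (j choose i) * (- 1) ^ i))" for i
    by (simp add: S_def coeff_sum coeff_one_minus_power)
  \<comment> \<open>An integer copy of the coefficients of \<open>S\<close>, so that the result can
    be read over the integers.\<close>
  define r where "r i = (\<Sum>j\<le>n. (- 1) ^ j * int (b (j + 2)) * (int (j choose i) * (- 1) ^ i))" for i
  have rS: "real_of_int (r i) = coeff S i" for i
    by (simp add: r_def Sc)
  have Sdeg: "coeff S i = 0" if "i > n" for i
    using that unfolding Sc by (intro sum.neutral) (auto simp: binomial_eq_0)
  have S: "S = (\<Sum>j\<le>n. monom (coeff S j) j)"
    using Sdeg by (intro poly_eqI) (auto simp: coeff_sum not_le)
  have "pcompose S [:1, - 1:] = (\<Sum>j\<le>n. smult (coeff S j) ([:1, - 1:] ^ j))"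
    by (subst (1) S)
      (simp add: pcompose_sum monom_altdef pcompose_smult pcompose_power pcompose_pCons)
  moreover have "pcompose S [:1, - 1:] = R"
    unfolding S_def by (simp add: pcompose_assoc[symmetric] pcompose_pCons)
  ultimately have RS: "coeff R i = (\<Sum>j\<le>n. coeff S j * (real (j choose i) * (- 1) ^ i))" for i
    by (simp add: coeff_sum coeff_one_minus_power)
  show thesis
  proof (rule that)
    fix i assume "i < m"
    then have "coeff S i = real (b 1) - real ((e + i) choose i)"
      unfolding S_def by (rule coeff_pcompose_of_dvd[OF dvd])
    then have "real_of_int (r i) = real_of_int (int (b 1) - int ((e + i) choose i))"
      by (simp add: rS)
    then show "r i = int (b 1) - int ((e + i) choose i)" by (simp only: of_int_eq_iff)
  next
    have "r n = (\<Sum>j\<in>{n}. (- 1) ^ j * int (b (j + 2)) * (int (j choose n) * (- 1) ^ n))"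
      unfolding r_def by (rule sum.mono_neutral_right) (auto simp: binomial_eq_0)
    then show "r n = int (b (n + 2))" by (simp add: mult_ac flip: power_add mult_2)
  next
    fix i assume i: "i \<le> n"
    have "(- 1) ^ i * real (b (i + 2)) = (- 1) ^ i * (\<Sum>j\<le>n. real (j choose i) * coeff S j)"
      using RS[of i] Rc[of i] i by (simp add: sum_distrib_left mult_ac)
    then have "real (b (i + 2)) = (\<Sum>j\<le>n. real (j choose i) * coeff S j)" by simp
    then have "real_of_int (int (b (i + 2))) = real_of_int (\<Sum>j\<le>n. int (j choose i) * r j)"
      by (simp add: rS)
    then show "int (b (i + 2)) = (\<Sum>j\<le>n. int (j choose i) * r j)" by (simp only: of_int_eq_iff)
  qed
qed

text \<open>Since \<open>(m choose j) (j choose i) = (m choose i) (m - i choose j - i)\<close>, this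
  is a multiple of the alternating sum over row \<open>m - i\<close> of Pascal's triangle, which is
  zero as \<open>m - i > 0\<close>.\<close>

lemma alternating_sum_choose_choose:
  assumes "i < m"
  shows "(\<Sum>j\<le>m. (- 1) ^ j * int (j choose i) * int (m choose j)) = 0"
proof -
  have "(\<Sum>j\<le>m. (- 1) ^ j * int (j choose i) * int (m choose j))
      = (\<Sum>j\<in>{i..m}. (- 1) ^ j * int (j choose i) * int (m choose j))"
    by (rule sum.mono_neutral_right) (auto simp: binomial_eq_0)
  also have "\<dots> = (\<Sum>l\<le>m - i. (- 1) ^ (l + i) * int ((l + i) choose i) * int (m choose (l + i)))"
    using assms by (intro sum.reindex_bij_witness[of _ "\<lambda>l. l + i" "\<lambda>j. j - i"]) auto
  also have "\<dots> = (\<Sum>l\<le>m - i. (- 1) ^ i * int (m choose i) * ((- 1) ^ l * int ((m - i) choose l)))"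
  proof (rule sum.cong[OF refl])
    fix l assume "l \<in> {..m - i}"
    then have "(m choose (l + i)) * ((l + i) choose i) = (m choose i) * ((m - i) choose l)"
      using choose_mult[of i "l + i" m] assms by simp
    then have "int (m choose (l + i)) * int ((l + i) choose i) = int (m choose i) * int ((m - i) choose l)"
      by (metis of_nat_mult)
    then show "(- 1) ^ (l + i) * int ((l + i) choose i) * int (m choose (l + i))
        = (- 1) ^ i * int (m choose i) * ((- 1) ^ l * int ((m - i) choose l))"
      by (simp add: power_add mult_ac)
  qed
  also have "\<dots> = 0"
    using choose_alternating_sum[of "m - i", where 'a = int] assms
    by (simp flip: sum_distrib_left)
  finally show ?thesis .
qed

section \<open>Linear resolutions\<close>

text \<open>The series of \<open>S\<close> is \<open>1 / (1 - t)^N\<close> for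
  \<open>N = CARD('v)\<close>, and generators in degree \<open>c i\<close> multiply it by
  \<open>t^(c i)\<close>.\<close>

lemma hs_resolution:
  fixes D :: "nat \<Rightarrow> ('v::finite, 'k::field) mpoly mat"
  assumes J: "rmod.subspace J" and R: "resolution J b D" and sh: "shifted_entries b (\<lambda>i. int (c i)) D"
    and c0: "c 0 = 0" and bn: "\<And>i. i > n \<Longrightarrow> b i = 0" and t: "0 < t" "t < 1"
  shows "(1 - t) ^ CARD('v) * hs J t = (\<Sum>i\<le>n. (- 1) ^ i * real (b i) * t ^ c i)"
proof -
  let ?N = "\<lambda>z. hilb (var_ideal {} :: ('v, 'k) mpoly set) z"
  let ?S = "(1 / (1 - t)) ^ CARD('v)"
  have "(\<lambda>m. real_of_int (?N (int m)) * t ^ m) sums ?S"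
    using hilb_var_ideal_sums[OF t, of "{} :: 'v set", where 'k = 'k] by simp
  then have "(\<lambda>m. real_of_int (?N (int m - int (c i))) * t ^ m) sums (t ^ c i * ?S)" for i
    by (rule sums_shift_int[rotated])
      (simp add: hilb_neg graded_ideal_subspace[OF graded_var_ideal] del: var_ideal_empty)
  then have "(\<lambda>m. \<Sum>i\<le>n. ((- 1) ^ i * real (b i)) * (real_of_int (?N (int m - int (c i))) * t ^ m))
      sums (\<Sum>i\<le>n. ((- 1) ^ i * real (b i)) * (t ^ c i * ?S))"
    by (intro sums_sum sums_mult)
  moreover have "(\<Sum>i\<le>n. ((- 1) ^ i * real (b i)) * (real_of_int (?N (int m - int (c i))) * t ^ m))
      = real_of_int (hilb J (int m)) * t ^ m" for m
    by (subst hilb_resolution[OF J R sh _ bn])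
      (simp_all add: c0 sum_distrib_right mult.assoc del: var_ideal_empty)
  ultimately have "hs J t = (\<Sum>i\<le>n. ((- 1) ^ i * real (b i)) * (t ^ c i * ?S))"
    using hilb_sums_hs[OF J t] sums_unique2 by fastforce
  also have "\<dots> = (\<Sum>i\<le>n. (- 1) ^ i * real (b i) * t ^ c i) * ?S"
    by (simp add: sum_distrib_right mult.assoc)
  finally show ?thesis using t by (simp add: power_divide)
qed

text \<open>Here \<open>n + 2\<close> is the number of variables, so \<open>b (n + 2)\<close> is the
  last Betti number. The polynomial is \<open>(1 - t)^(n+2)\<close> times the Hilbert series, and
  the factor \<open>(1 - t)^r\<close> already keeps the series bounded by
  \<open>hs_bounded\<close>.\<close>

lemma linear_resolution_dvd:
  fixes J :: "('v::finite, 'k::field) mpoly set"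
  assumes J: "graded_ideal J" and M: "minimal_graded_free_resolution J b a D"
    and lin: "\<forall>i>1. \<forall>p<b (i - 1). \<forall>q<b i. D i $$ (p, q) \<noteq> 0 \<longrightarrow> homogeneous 1 (D i $$ (p, q))"
    and e: "gen_degree e J" and dim: "\<not> prime_chain (Suc r) J" and n: "CARD('v) = n + 2" "r \<le> n + 2"
  shows "[:- 1, 1:] ^ (n + 2 - r) dvd 1 - monom (real (b 1)) e
    + monom 1 (Suc e) * (\<Sum>i\<le>n. monom ((- 1) ^ i * real (b (i + 2))) i)"
    (is "_ dvd ?K")
proof -
  note sub = graded_ideal_subspace[OF J]
  have G: "graded_free_resolution J b a D" using M unfolding minimal_graded_free_resolution_def by blast
  note R = graded_free_resolution_resolution[OF G]
  have "\<forall>i>CARD('v). b i = 0" using G unfolding graded_free_resolution_def by (elim conjE)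
  then have bn: "b i = 0" if "i > n + 2" for i using n that by simp
  have b0: "b 0 = 1" using R by (simp add: resolution_def)
  \<comment> \<open>The first matrix raises the degree from \<open>0\<close> to \<open>e\<close>,
    every later one by \<open>1\<close>. Position \<open>0\<close> is separate, since the formula
    for the others would give \<open>e - 1\<close>.\<close>
  define c where "c i = (if i = 0 then 0 else e + i - 1)" for i :: nat
  have sh: "shifted_entries b (\<lambda>i. int (c i)) D"
    unfolding shifted_entries_def
  proof (intro allI impI)
    fix i p q assume pq: "p < b i" "q < b (Suc i)" "D (Suc i) $$ (p, q) \<noteq> 0"
    show "\<exists>j. int (c (Suc i)) = int (c i) + int j \<and> homogeneous j (D (Suc i) $$ (p, q))"
    proof (cases i)
      case 0
      then show ?thesis
        using minimal_first_matrix_degree[OF M e, of q] pq b0 by (intro exI[of _ e]) (simp add: c_def)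
    next
      case (Suc l)
      then show ?thesis
        using lin[rule_format, of "Suc i" p q] pq by (intro exI[of _ 1]) (simp add: c_def)
    qed
  qed
  obtain C where C: "\<And>t. t \<in> {0<..<1} \<Longrightarrow> (1 - t) ^ r * hs J t \<le> C"
    using hs_bounded[OF J dim] by blast
  show ?thesis
  proof (rule linear_power_dvd_of_bound)
    fix t :: real assume t: "0 < t" "t < 1"
    \<comment> \<open>Positions \<open>0\<close> and \<open>1\<close> give the first two terms;
      position \<open>i + 2\<close> has degree \<open>e + i + 1\<close> and sign
      \<open>(-1)^i\<close>.\<close>
    have "poly ?K t = (\<Sum>i\<le>n + 2. (- 1) ^ i * real (b i) * t ^ c i)"
      by (simp add: poly_sum poly_monom numeral_2_eq_2 sum.atMost_Suc_shift b0 c_def sum_distrib_left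
          power_add mult_ac del: sum.atMost_Suc)
    also have "\<dots> = (1 - t) ^ (n + 2) * hs J t"
      using hs_resolution[OF sub R sh _ bn t] n by (simp add: c_def)
    also have "\<dots> = (1 - t) ^ (n + 2 - r) * ((1 - t) ^ r * hs J t)"
      using n(2) by (simp flip: power_add mult.assoc)
    finally have K: "poly ?K t = (1 - t) ^ (n + 2 - r) * ((1 - t) ^ r * hs J t)" .
    have "0 \<le> hs J t" by (rule hs_nonneg[OF t sub])
    then have "\<bar>poly ?K t\<bar> = (1 - t) ^ (n + 2 - r) * ((1 - t) ^ r * hs J t)"
      unfolding K using t by simp
    also have "\<dots> \<le> (1 - t) ^ (n + 2 - r) * C"
      using C[of t] t by (intro mult_left_mono) simp_all
    finally show "\<bar>poly ?K t\<bar> \<le> C * (1 - t) ^ (n + 2 - r)" by (simp add: mult.commute)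
  qed
qed

theorem theorem2p2:
  fixes I :: "('v::finite, 'k::field) mpoly set" and n d k :: nat
  assumes "n = CARD('v)"
    and "ideal I poly_ring" and "I \<noteq> UNIV" and "homogeneous_ideal I"
    and "has_linear_powers I" and "generated_in_degree d I"
    and "k \<ge> 1"
  shows
    "(dim_ideal I = 1 \<longrightarrow>
       vec (n - 1) (\<lambda>i. int (betti (ideal_pow I k) (i + 2))) =
       mat (n - 1) (n - 1) (\<lambda>(i, j). int (j choose i)) *\<^sub>v
       vec (n - 1) (\<lambda>i. int (betti (ideal_pow I k) 1) - int ((d * k + i) choose i))) \<and>
     (dim_ideal I = 2 \<longrightarrow>
       vec (n - 2) (\<lambda>i. int (betti (ideal_pow I k) (i + 2))) =
       mat (n - 2) (n - 2) (\<lambda>(i, j). int (j choose i)) *\<^sub>v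
       vec (n - 2) (\<lambda>i. int (betti (ideal_pow I k) 1)
         - (-1) ^ (n + i) * int ((n - 2) choose i) * int (betti (ideal_pow I k) n)
         - int ((d * k + i) choose i)))"
proof -
  let ?J = "ideal_pow I k" and ?e = "d * k"
  have sub: "rmod.subspace I" using assms(2) by (simp add: ideal_iff_subspace)
  \<comment> \<open>The power with exponent \<open>1\<close> is \<open>I\<close> itself; its
    resolution supplies the finite generating set from which the degree is read off.\<close>
  have "has_linear_resolution (ideal_pow I 1)" using assms(5) unfolding has_linear_powers_def by blast
  then obtain b1 a1 D1 where "minimal_graded_free_resolution I b1 a1 D1"
    unfolding has_linear_resolution_def ideal_pow_1[OF sub] by blast
  then have "gen_degree d I"
    using gen_degree_of_resolution assms(6) unfolding minimal_graded_free_resolution_def by blast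
  then have gd: "gen_degree ?e ?J" by (rule gen_degree_ideal_pow[OF sub])
  have J: "graded_ideal ?J" by (rule gen_degree_graded[OF subspace_ideal_pow[OF sub] gd])
  have "has_linear_resolution ?J" using assms(5,7) unfolding has_linear_powers_def by blast
  then obtain b a D where M: "minimal_graded_free_resolution ?J b a D"
    and lin: "\<forall>i>1. \<forall>p<b (i - 1). \<forall>q<b i. D i $$ (p, q) \<noteq> 0 \<longrightarrow> homogeneous 1 (D i $$ (p, q))"
    unfolding has_linear_resolution_def by blast
  have betti: "betti ?J i = b i" for i by (rule betti_eq[OF M])
  \<comment> \<open>Common to both dimensions: the first \<open>n - s\<close> numbers
    \<open>r i\<close> are explicit, and the one with index \<open>n - 2\<close> is the last Betti
    number.\<close>
  have numbers: "\<exists>r. (\<forall>i<n - s. r i = int (b 1) - int ((?e + i) choose i)) \<and> r (n - 2) = int (b n) \<and>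
      (\<forall>i\<le>n - 2. int (b (i + 2)) = (\<Sum>j\<le>n - 2. int (j choose i) * r j))"
    if dim: "dim_ideal I = enat s" and n: "n \<ge> 2" "s \<le> n" for s
  proof -
    obtain l where l: "n = l + 2" using n by (metis le_add_diff_inverse2)
    have "\<not> prime_chain (Suc s) ?J"
      using prime_chain_le_dim[OF sub, of "Suc s"] prime_chain_ideal_pow[of "Suc s" I k] dim by auto
    then have "[:- 1, 1:] ^ (l + 2 - s) dvd 1 - monom (real (b 1)) ?e
        + monom 1 (Suc ?e) * (\<Sum>i\<le>l. monom ((- 1) ^ i * real (b (i + 2))) i)"
      using linear_resolution_dvd[OF J M lin gd, of s l] assms(1) l n by simp
    then obtain r where "\<And>i. i < l + 2 - s \<Longrightarrow> r i = int (b 1) - int ((?e + i) choose i)"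
      "r l = int (b (l + 2))" "\<And>i. i \<le> l \<Longrightarrow> int (b (i + 2)) = (\<Sum>j\<le>l. int (j choose i) * r j)"
      by (rule linear_betti_binomial) blast
    then show ?thesis by (intro exI[of _ r]) (simp add: l)
  qed
  show ?thesis
    unfolding betti
  proof (intro conjI impI)
    assume dim: "dim_ideal I = 1"
    show "vec (n - 1) (\<lambda>i. int (b (i + 2))) = mat (n - 1) (n - 1) (\<lambda>(i, j). int (j choose i)) *\<^sub>v
       vec (n - 1) (\<lambda>i. int (b 1) - int ((?e + i) choose i))"
    proof (cases "n \<ge> 2")
      case True
      then obtain r where r: "\<And>i. i < n - 1 \<Longrightarrow> r i = int (b 1) - int ((?e + i) choose i)"
        "\<And>i. i \<le> n - 2 \<Longrightarrow> int (b (i + 2)) = (\<Sum>j\<le>n - 2. int (j choose i) * r j)"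
        using numbers[of 1] dim by (auto simp: one_enat_def)
      \<comment> \<open>In dimension 1 the \<open>n - 1\<close> explicit numbers are all that
        occur.\<close>
      have set: "{..n - 2} = {..<n - 1}" using True by auto
      show ?thesis
      proof (rule eq_vecI)
        fix i assume "i < dim_vec (mat (n - 1) (n - 1) (\<lambda>(i, j). int (j choose i)) *\<^sub>v
          vec (n - 1) (\<lambda>i. int (b 1) - int ((?e + i) choose i)))"
        then have i: "i < n - 1" by simp
        then have "int (b (i + 2)) = (\<Sum>j<n - 1. int (j choose i) * (int (b 1) - int ((?e + j) choose j)))"
          using r(2)[of i] r(1) by (simp add: set)
        then show "vec (n - 1) (\<lambda>i. int (b (i + 2))) $ i = (mat (n - 1) (n - 1) (\<lambda>(i, j). int (j choose i)) *\<^sub>v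
          vec (n - 1) (\<lambda>i. int (b 1) - int ((?e + i) choose i))) $ i"
          using i by (simp add: scalar_prod_def atLeast0LessThan)
      qed simp
    \<comment> \<open>For \<open>n < 2\<close> both vectors are empty.\<close>
    qed (auto intro: eq_vecI)
  next
    assume dim: "dim_ideal I = 2"
    let ?w = "\<lambda>i. int (b 1) - (-1) ^ (n + i) * int ((n - 2) choose i) * int (b n) - int ((?e + i) choose i)"
    show "vec (n - 2) (\<lambda>i. int (b (i + 2))) = mat (n - 2) (n - 2) (\<lambda>(i, j). int (j choose i)) *\<^sub>v vec (n - 2) ?w"
    proof (cases "n \<ge> 2")
      case True
      then obtain l where l: "n = l + 2" by (metis le_add_diff_inverse2)
      have nl: "n - 2 = l" by (simp add: l)
      have "dim_ideal I = enat 2" using dim by (simp add: numeral_eq_enat)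
      from numbers[OF this True True, unfolded nl]
      obtain r where r: "\<And>i. i < l \<Longrightarrow> r i = int (b 1) - int ((?e + i) choose i)" "r l = int (b n)"
        "\<And>i. i \<le> l \<Longrightarrow> int (b (i + 2)) = (\<Sum>j\<le>l. int (j choose i) * r j)"
        by blast
      show ?thesis
      proof (rule eq_vecI)
        fix i assume "i < dim_vec (mat (n - 2) (n - 2) (\<lambda>(i, j). int (j choose i)) *\<^sub>v vec (n - 2) ?w)"
        then have i: "i < l" by (simp add: l)
        \<comment> \<open>In dimension 2 the number with index \<open>l = n - 2\<close> has no
          explicit value and enters as \<open>b n\<close>.\<close>
        have "int (b (i + 2)) = (\<Sum>j<l. int (j choose i) * (int (b 1) - int ((?e + j) choose j)))
            + int (l choose i) * int (b n)"
          using r(3)[of i] r(1,2) i by (simp flip: lessThan_Suc_atMost)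
        \<comment> \<open>Trades the column \<open>j = l\<close> for the columns
          \<open>j < l\<close>, which is possible because \<open>i < l\<close>.\<close>
        also have "int (l choose i) = - ((- 1) ^ l * (\<Sum>j<l. (- 1) ^ j * int (j choose i) * int (l choose j)))"
        proof -
          have "(\<Sum>j<l. (- 1) ^ j * int (j choose i) * int (l choose j)) = - ((- 1) ^ l * int (l choose i))"
            using alternating_sum_choose_choose[OF i] by (simp flip: lessThan_Suc_atMost)
          then show ?thesis by (simp flip: power_add mult.assoc mult_2)
        qed
        \<comment> \<open>As \<open>n = l + 2\<close>, the collected sign \<open>(-1)^(l+j)\<close>
          is the \<open>(-1)^(n+j)\<close> in \<open>?w j\<close>.\<close>
        also have "(\<Sum>j<l. int (j choose i) * (int (b 1) - int ((?e + j) choose j)))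
            + - ((- 1) ^ l * (\<Sum>j<l. (- 1) ^ j * int (j choose i) * int (l choose j))) * int (b n)
            = (\<Sum>j<l. int (j choose i) * ?w j)"
          by (simp add: l sum_distrib_left sum_distrib_right power_add algebra_simps
              flip: sum_subtractf sum.distrib sum_negf)
        finally have "int (b (i + 2)) = (\<Sum>j<l. int (j choose i) * ?w j)" .
        then show "vec (n - 2) (\<lambda>i. int (b (i + 2))) $ i
            = (mat (n - 2) (n - 2) (\<lambda>(i, j). int (j choose i)) *\<^sub>v vec (n - 2) ?w) $ i"
          using i by (simp add: scalar_prod_def atLeast0LessThan l)
      qed simp
    qed (auto intro: eq_vecI)
  qed
qed

end
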